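(* Let $n\le t$, let $S\subseteq\mathbb{R}^n$ be a $\Pi_n^{\pm}$-invariant real algebraic variety, and let $M:=\sigma^{-1}(S)\subseteq\mathbb{C}^{n\times t}$ be the induced real variety. Then there is a semialgebraic open dense subset of $\mathbb{C}^{n\times t}$ such that every $Y$ in this subset admits a singular value decomposition $Y=U\,\mathrm{diag}(y)\,V^*$ with $U\in U(n)$, $V\in U(t)$, $y\in\mathbb{R}^n$, and moreover the set of Hermitian distance (HD) critical points of $Y$ with respect to $M$ is $$\{\,U\,\mathrm{diag}(x)\,V^* : x \text{ is an ED critical point of } y \text{ with respect to } S\,\}.$$ In particular, the Hermitian distance degree of $M$ equals the real Euclidean distance degree of $S$: $$\mathrm{HDdeg}(M)=\mathbb{R}\mathrm{EDdeg}(S).$$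
   Context: $\mathbb{C}^{n\times t}$ is viewed as a real vector space $V^{\mathbb{R}}\cong\mathbb{R}^{2nt}$ with real inner product $q(A,B)=\mathrm{Re}\,\mathrm{Tr}(AB^* )$, where $B^*$ is the conjugate transpose; algebraic subsets are viewed as real algebraic sets in $V^{\mathbb{R}}$. $U(n)$ is the unitary group. For $n\le t$ and $d\in\mathbb{C}^n$, $\mathrm{diag}(d)\in\mathbb{C}^{n\times t}$ is the rectangular diagonal matrix with $(i,i)$ entry $d_i$ for $1\le i\le n$ and all other entries zero. $\Pi_n^{\pm}$ is the group of signed permutations of $\mathbb{R}^n$ (of order $2^n n!$); $S$ is $\Pi_n^{\pm}$-invariant (absolutely symmetric) if $\pi S=S$ for all $\pi\in\Pi_n^{\pm}$. For such $S$, $\sigma^{-1}(S):=\{U\,\mathrm{diag}(x)\,V^*: x\in S,\ U\in U(n),\ V\in U(t)\}$. For a real algebraic set, the superscript $\mathrm{reg}$ denotes its set of smooth points. A point $x\in S^{\mathrm{reg}}$ is an ED critical point of $y\in\mathbb{R}^n$ on $S$ if $(x-y)^{\top}a=0$ for all $a\in T_xS$. A point $X\in M^{\mathrm{reg}}$ is an HD critical point of $Y\in\mathbb{C}^{n\times t}$ on $M$ if $\mathrm{Re}\,\mathrm{Tr}((Y-X)A^* )=0$ for all $A\in T_XM$ (the real tangent space). For $y$ outside the ED discriminant of $S$, the number of real ED critical points of $y$ on $S$ is finite and constant on each chamber (connected component of the complement of the discriminant); this number is $\mathbb{R}\mathrm{EDdeg}(S;y)$ and $\mathbb{R}\mathrm{EDdeg}(S)\subset\mathbb{N}$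 is the set of all such values. Likewise, for $Y$ outside a semialgebraic discriminant locus $\Delta_M\subset V^{\mathbb{R}}$, the number of HD critical points of $Y$ on $M$ is finite and constant on the chamber of $Y$; this number is $\mathrm{HDdeg}(M;Y)$, and $\mathrm{HDdeg}(M):=\{\mathrm{HDdeg}(M;Y): Y\in V^{\mathbb{R}}\setminus\Delta_M\}$. The equality of degrees is understood chamberwise: $\mathrm{HDdeg}(M;Y)=\mathbb{R}\mathrm{EDdeg}(S;y)$ for generic $Y=U\,\mathrm{diag}(y)\,V^*$. *)

theory Defs
  imports "HOL-Analysis.Analysis"
begin

section \<open>Real algebraic and semialgebraic sets\<close>

text \<open>
  Everything in this section is stated for a Euclidean space \<^typ>\<open>'a\<close>. It is used both for
  real \<open>n\<close>-space and for the space of complex \<open>n \<times> t\<close> matrices, which the library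
  regards as a real Euclidean space of dimension \<open>2nt\<close>. Polynomials are the library's
  \<^const>\<open>real_polynomial_function\<close>s, that is, the functions generated from the real-linear
  functionals and the constants by sums and products.
\<close>

definition algebraic_set :: "'a::euclidean_space set \<Rightarrow> bool" where
  "algebraic_set S \<longleftrightarrow>
     (\<exists>P. finite P \<and> (\<forall>p\<in>P. real_polynomial_function p) \<and> S = {x. \<forall>p\<in>P. p x = 0})"

inductive semialgebraic :: "'a::euclidean_space set \<Rightarrow> bool" where
  pos: "real_polynomial_function p \<Longrightarrow> semialgebraic {x. 0 < p x}"
| Compl: "semialgebraic A \<Longrightarrow> semialgebraic (- A)"
| Un: "semialgebraic A \<Longrightarrow> semialgebraic B \<Longrightarrow> semialgebraic (A \<union> B)"

definition vanishing_ideal :: "'a::euclidean_space set \<Rightarrow> ('a \<Rightarrow> real) set" where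
  "vanishing_ideal S = {p. real_polynomial_function p \<and> (\<forall>x\<in>S. p x = 0)}"

definition gradient :: "('a::euclidean_space \<Rightarrow> real) \<Rightarrow> 'a \<Rightarrow> 'a" where
  "gradient p x = (\<Sum>b\<in>Basis. frechet_derivative p (at x) b *\<^sub>R b)"

text \<open>
  Smooth (nonsingular) points in the sense of real algebraic geometry: near \<open>x\<close>, the set \<open>S\<close>
  is cut out by polynomials vanishing on all of \<open>S\<close> whose gradients at \<open>x\<close> are linearly
  independent. The number of these polynomials is the local codimension; it may depend on \<open>x\<close>,
  since \<open>S\<close> need be neither irreducible nor equidimensional. See Akbulut and King, Topology of
  Real Algebraic Sets, and Bochnak, Coste and Roy, Real Algebraic Geometry, Prop. 3.3.10, where
  this is shown to agree with regularity of the local ring.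
\<close>

definition smooth_points :: "'a::euclidean_space set \<Rightarrow> 'a set" where
  "smooth_points S =
     {x \<in> S. \<exists>P W. finite P \<and> P \<subseteq> vanishing_ideal S \<and>
        inj_on (\<lambda>p. gradient p x) P \<and> independent ((\<lambda>p. gradient p x) ` P) \<and>
        open W \<and> x \<in> W \<and> S \<inter> W = {z \<in> W. \<forall>p\<in>P. p z = 0}}"

definition tangent_space :: "'a::euclidean_space set \<Rightarrow> 'a \<Rightarrow> 'a set" where
  "tangent_space S x = {v. \<forall>p\<in>vanishing_ideal S. gradient p x \<bullet> v = 0}"


section \<open>Matrices\<close>

definition adj :: "complex^'t^'n \<Rightarrow> complex^'n^'t" where
  "adj A = (\<chi> i j. cnj (A $ j $ i))"

definition unitary :: "complex^'n^'n \<Rightarrow> bool" where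
  "unitary U \<longleftrightarrow> U ** adj U = mat 1 \<and> adj U ** U = mat 1"

text \<open>
  Rows and columns of \<open>n \<times> t\<close> matrices are indexed by finite types \<^typ>\<open>'n\<close> and \<^typ>\<open>'t\<close>.
  The map \<open>\<iota> :: 'n \<Rightarrow> 't\<close>, always assumed injective, sends the \<open>i\<close>-th row index to the \<open>i\<close>-th
  column index. An injective \<open>\<iota>\<close> exists exactly when \<open>n \<le> t\<close>, and it plays the role of
  the inclusion of \<open>{1..n}\<close> in \<open>{1..t}\<close>.
\<close>

definition rect_diag :: "('n \<Rightarrow> 't) \<Rightarrow> complex^'n \<Rightarrow> complex^'t^'n" where
  "rect_diag \<iota> d = (\<chi> i j. if j = \<iota> i then d $ i else 0)"

definition complexify :: "real^'n \<Rightarrow> complex^'n" where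
  "complexify x = (\<chi> i. complex_of_real (x $ i))"

definition svd_matrix ::
  "('n::finite \<Rightarrow> 't::finite) \<Rightarrow> complex^'n^'n \<Rightarrow> real^'n \<Rightarrow> complex^'t^'t \<Rightarrow> complex^'t^'n"
  where "svd_matrix \<iota> U x V = U ** rect_diag \<iota> (complexify x) ** adj V"

definition signed_permutations :: "(real^'n \<Rightarrow> real^'n) set" where
  "signed_permutations =
     {(\<lambda>x. \<chi> i. s i * x $ \<pi> i) | s \<pi>. bij \<pi> \<and> (\<forall>i. s i \<in> {-1, 1})}"

definition absolutely_symmetric :: "(real^'n) set \<Rightarrow> bool" where
  "absolutely_symmetric S \<longleftrightarrow> (\<forall>g\<in>signed_permutations. g ` S = S)"

definition sigma_inv ::
  "('n::finite \<Rightarrow> 't::finite) \<Rightarrow> (real^'n) set \<Rightarrow> (complex^'t^'n) set" where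
  "sigma_inv \<iota> S = {svd_matrix \<iota> U x V | U x V. unitary U \<and> x \<in> S \<and> unitary V}"


section \<open>Critical points and degrees\<close>

definition ED_critical :: "(real^'n) set \<Rightarrow> real^'n \<Rightarrow> (real^'n) set" where
  "ED_critical S y = {x \<in> smooth_points S. \<forall>a\<in>tangent_space S x. (x - y) \<bullet> a = 0}"

definition HD_critical :: "(complex^'t^'n) set \<Rightarrow> complex^'t^'n \<Rightarrow> (complex^'t^'n) set" where
  "HD_critical M Y =
     {X \<in> smooth_points M. \<forall>A\<in>tangent_space M X. Re (trace ((Y - X) ** adj A)) = 0}"

text \<open>
  The discriminant of a family \<open>Crit\<close> of critical sets is taken to be the smallest closed set off
  which the number of critical points is finite and locally constant. The lemma
  \<open>degree_values_eq\<close> below shows that every other closed nowhere dense set off which the number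
  of critical points is finite and constant on chambers leads to the same set of degrees.
\<close>

definition discriminant :: "('a::topological_space \<Rightarrow> 'b set) \<Rightarrow> 'a set" where
  "discriminant Crit =
     {y. \<not> (\<exists>W. open W \<and> y \<in> W \<and> (\<forall>z\<in>W. finite (Crit z) \<and> card (Crit z) = card (Crit y)))}"

definition REDdeg_at :: "(real^'n) set \<Rightarrow> real^'n \<Rightarrow> nat" where
  "REDdeg_at S y = card (ED_critical S y)"

definition REDdeg :: "(real^'n) set \<Rightarrow> nat set" where
  "REDdeg S = {REDdeg_at S y | y. y \<notin> discriminant (ED_critical S)}"

definition HDdeg_at :: "(complex^'t^'n) set \<Rightarrow> complex^'t^'n \<Rightarrow> nat" where
  "HDdeg_at M Y = card (HD_critical M Y)"

definition HDdeg :: "(complex^'t^'n) set \<Rightarrow> nat set" where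
  "HDdeg M = {HDdeg_at M Y | Y. Y \<notin> discriminant (HD_critical M)}"

lemma open_Compl_discriminant: "open (- discriminant Crit)"
proof (subst open_subopen, safe)
  fix y assume "y \<notin> discriminant Crit"
  then obtain W where W: "open W" "y \<in> W"
    "\<forall>z\<in>W. finite (Crit z) \<and> card (Crit z) = card (Crit y)"
    unfolding discriminant_def by blast
  have "W \<subseteq> - discriminant Crit"
  proof
    fix z assume "z \<in> W"
    then have "\<forall>w\<in>W. finite (Crit w) \<and> card (Crit w) = card (Crit z)"
      using W(3) by simp
    then show "z \<in> - discriminant Crit"
      using W(1) \<open>z \<in> W\<close> unfolding discriminant_def by blast
  qed
  then show "\<exists>T. open T \<and> y \<in> T \<and> T \<subseteq> - discriminant Crit"
    using W by blast
qed

lemma discriminant_subset: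
  fixes Crit :: "'a::real_normed_vector \<Rightarrow> 'b set"
  assumes "closed \<Delta>"
    and fin: "\<And>y. y \<notin> \<Delta> \<Longrightarrow> finite (Crit y)"
    and const: "\<And>C y z. C \<in> components (- \<Delta>) \<Longrightarrow> y \<in> C \<Longrightarrow> z \<in> C \<Longrightarrow> card (Crit y) = card (Crit z)"
  shows "discriminant Crit \<subseteq> \<Delta>"
proof (rule ccontr)
  assume "\<not> discriminant Crit \<subseteq> \<Delta>"
  then obtain y where y: "y \<in> discriminant Crit" "y \<in> - \<Delta>" by blast
  let ?C = "connected_component_set (- \<Delta>) y"
  have C: "?C \<in> components (- \<Delta>)" using y(2) by (simp add: componentsI)
  have o: "open ?C" using assms(1) by (intro open_connected_component) auto
  have "y \<in> ?C" using y(2) by simp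
  moreover have "\<forall>z\<in>?C. finite (Crit z) \<and> card (Crit z) = card (Crit y)"
    using const[OF C _ \<open>y \<in> ?C\<close>] fin in_components_subset[OF C] by blast
  ultimately show False using y(1) o unfolding discriminant_def by blast
qed

lemma degree_values_eq:
  fixes Crit :: "'a::real_normed_vector \<Rightarrow> 'b set"
  assumes "closed \<Delta>" and "interior \<Delta> = {}"
    and fin: "\<And>y. y \<notin> \<Delta> \<Longrightarrow> finite (Crit y)"
    and const: "\<And>C y z. C \<in> components (- \<Delta>) \<Longrightarrow> y \<in> C \<Longrightarrow> z \<in> C \<Longrightarrow> card (Crit y) = card (Crit z)"
  shows "{card (Crit y) | y. y \<notin> \<Delta>} = {card (Crit y) | y. y \<notin> discriminant Crit}"
proof (intro subset_antisym subsetI)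
  have "discriminant Crit \<subseteq> \<Delta>"
    by (rule discriminant_subset[OF assms(1)]) (fact fin, fact const)
  moreover fix k assume "k \<in> {card (Crit y) | y. y \<notin> \<Delta>}"
  ultimately show "k \<in> {card (Crit y) | y. y \<notin> discriminant Crit}"
    by blast
next
  fix k assume "k \<in> {card (Crit y) | y. y \<notin> discriminant Crit}"
  then obtain y W where k: "k = card (Crit y)" and W: "open W" "y \<in> W"
    "\<forall>z\<in>W. finite (Crit z) \<and> card (Crit z) = card (Crit y)"
    unfolding discriminant_def by blast
  have "\<not> W \<subseteq> \<Delta>" using W(1,2) assms(2) interior_maximal by blast
  then obtain z where "z \<in> W" "z \<notin> \<Delta>" by blast
  moreover have "k = card (Crit z)" using k W(3) \<open>z \<in> W\<close> by simp
  ultimately show "k \<in> {card (Crit y) | y. y \<notin> \<Delta>}" by blast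
qed

end

theory Submission
  imports Defs
begin

text \<open>
  Write \<open>diag x\<close> for the rectangular matrix with real diagonal \<open>x\<close>. Two things have to be
  compared: being a critical point of \<open>M\<close> at \<open>diag y\<close> and being a critical point of \<open>S\<close> at \<open>y\<close>,
  for \<open>y\<close> with distinct nonzero squares. Matrices of this kind, up to unitary factors, form the
  complement of the zero set of one polynomial, and this complement serves as \<open>\<Omega>\<close>.

  A critical point \<open>X\<close> of \<open>diag y\<close> on \<open>M\<close> is again diagonal. Since \<open>M\<close> is a union of orbits of
  \<open>U(n) \<times> U(t)\<close>, the difference \<open>diag y - X\<close> is orthogonal to the orbit of \<open>X\<close>, which makes
  \<open>diag y X\<^sup>*\<close> and \<open>X\<^sup>* diag y\<close> Hermitian; comparing entries forces \<open>X = diag x\<close> with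
  \<open>x\<close> real, and \<open>x \<in> S\<close> because singular values are unique up to signed permutations
  (\<open>critical_imp_diagonal\<close>).

  The main difficulty is that \<open>x\<close> may have zero or coinciding entries although \<open>y\<close> has none, so that
  \<open>diag x\<close> can lie in a singular stratum of the singular value map. Smoothness is therefore rephrased
  in a form that passes through this map: \<open>x \<in> S\<close> is smooth if and only if there is a polynomial map
  \<open>G\<close> of the ambient space to itself that vanishes on \<open>S\<close>, has no other zeros near \<open>x\<close>, and
  satisfies \<open>\<parallel>G (z - G z)\<parallel> \<le> \<parallel>G z\<parallel> / 4\<close> near \<open>x\<close> (\<open>tubular\<close>); the model is the difference
  between \<open>z\<close> and its projection to \<open>S\<close>. If a finite group of isometries preserves \<open>S\<close>, then \<open>G\<close> can be
  chosen equivariant (\<open>equivariant_tubular_map\<close>).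

  These conditions only involve norms, sums and values of \<open>G\<close>, so they survive in both directions. A
  map \<open>G\<close> on real \<open>n\<close>-space that is equivariant under signed permutations extends to a polynomial map
  of matrices by \<open>U diag z V\<^sup>* \<mapsto> U diag (G z) V\<^sup>*\<close> (\<open>liftable_equivariant\<close>). Conversely, a map of
  matrices that is equivariant under complex conjugation and under conjugation by diagonal sign
  matrices preserves the real diagonal matrices, the common fixed points of these operations, and can
  be restricted to them. Hence \<open>x\<close> is smooth in \<open>S\<close> if and only if \<open>diag x\<close> is smooth in \<open>M\<close>, and
  the real diagonal tangent vectors of \<open>M\<close> at \<open>diag x\<close> are exactly those coming from \<open>S\<close>
  (\<open>smooth_lift\<close>, \<open>smooth_restrict\<close>, \<open>tangent_space_linear_image\<close>). Averaging a tangent vector over the same operations replaces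
  it by a diagonal one without changing its inner product with \<open>diag (y - x)\<close>, which gives the
  equality of the two critical sets.

  The degrees agree because a small perturbation of \<open>diag y\<close> has singular values that can be ordered
  and signed so as to be close to \<open>y\<close> (\<open>svd_near_real_diag\<close>), so that a locally constant number of
  critical points on one side is locally constant on the other.
\<close>

section \<open>Strict derivatives of polynomial maps\<close>

text \<open>
  The difference quotient is controlled for both arguments moving, which for \<open>C\<^sup>1\<close> maps follows from
  continuity of the derivative. This is the form in which derivatives of polynomial maps enter all
  contraction estimates below.
\<close>

definition strict_derivative ::
  "('a::euclidean_space \<Rightarrow> 'b::euclidean_space) \<Rightarrow> ('a \<Rightarrow> 'b) \<Rightarrow> 'a \<Rightarrow> bool" where
  "strict_derivative f D x \<longleftrightarrow> linear D \<and>
     (\<forall>\<epsilon>>0. \<forall>\<^sub>F w in nhds (x, x).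
        norm (f (fst w) - f (snd w) - D (fst w - snd w)) \<le> \<epsilon> * norm (fst w - snd w))"

lemma strict_derivative_ball:
  assumes "strict_derivative f D x" "0 < \<epsilon>"
  obtains \<delta> where "\<delta> > 0"
    "\<And>y z. y \<in> ball x \<delta> \<Longrightarrow> z \<in> ball x \<delta> \<Longrightarrow> norm (f y - f z - D (y - z)) \<le> \<epsilon> * norm (y - z)"
proof -
  have "\<forall>\<^sub>F w in nhds x \<times>\<^sub>F nhds x.
      norm (f (fst w) - f (snd w) - D (fst w - snd w)) \<le> \<epsilon> * norm (fst w - snd w)"
    using assms unfolding strict_derivative_def nhds_prod by blast
  then obtain P Q where PQ: "eventually P (nhds x)" "eventually Q (nhds x)"
    "\<And>y z. P y \<Longrightarrow> Q z \<Longrightarrow> norm (f y - f z - D (y - z)) \<le> \<epsilon> * norm (y - z)"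
    unfolding eventually_prod_filter by auto
  then have "eventually (\<lambda>y. P y \<and> Q y) (nhds x)" by (simp add: eventually_conj)
  then obtain \<delta> where "\<delta> > 0" "\<And>y. dist y x < \<delta> \<Longrightarrow> P y \<and> Q y"
    unfolding eventually_nhds_metric by blast
  with PQ(3) show thesis by (intro that[of \<delta>]) (auto simp: dist_commute)
qed

lemma strict_derivative_imp_has_derivative:
  assumes "strict_derivative f D x"
  shows "(f has_derivative D) (at x)"
  unfolding has_derivative_at_alt
proof (intro conjI allI impI)
  show "bounded_linear D"
    using assms by (simp add: strict_derivative_def linear_linear)
  fix e :: real assume "e > 0"
  then obtain \<delta> where "\<delta> > 0"
    "\<And>y z. y \<in> ball x \<delta> \<Longrightarrow> z \<in> ball x \<delta> \<Longrightarrow> norm (f y - f z - D (y - z)) \<le> e * norm (y - z)"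
    using strict_derivative_ball[OF assms] by blast
  then show "\<exists>d>0. \<forall>y. norm (y - x) < d \<longrightarrow> norm (f y - f x - D (y - x)) \<le> e * norm (y - x)"
    by (intro exI[of _ \<delta>]) (auto simp: dist_norm norm_minus_commute)
qed

lemma strict_derivative_linear: "linear f \<Longrightarrow> strict_derivative f f x"
  by (auto simp: strict_derivative_def linear_diff)

lemma strict_derivative_const: "strict_derivative (\<lambda>x. c) (\<lambda>_. 0) x"
  by (auto simp: strict_derivative_def linear_zero)

lemma strict_derivative_add:
  assumes "strict_derivative f D x" "strict_derivative g E x"
  shows "strict_derivative (\<lambda>x. f x + g x) (\<lambda>v. D v + E v) x"
  unfolding strict_derivative_def
proof (intro conjI allI impI)
  show "linear (\<lambda>v. D v + E v)"
    using assms by (intro linear_compose_add) (auto simp: strict_derivative_def)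
  fix \<epsilon> :: real assume "\<epsilon> > 0"
  then have
    "\<forall>\<^sub>F w in nhds (x, x). norm (f (fst w) - f (snd w) - D (fst w - snd w)) \<le> \<epsilon>/2 * norm (fst w - snd w)"
    "\<forall>\<^sub>F w in nhds (x, x). norm (g (fst w) - g (snd w) - E (fst w - snd w)) \<le> \<epsilon>/2 * norm (fst w - snd w)"
    using assms half_gt_zero unfolding strict_derivative_def by blast+
  then show "\<forall>\<^sub>F w in nhds (x, x).
      norm (f (fst w) + g (fst w) - (f (snd w) + g (snd w)) - (D (fst w - snd w) + E (fst w - snd w)))
      \<le> \<epsilon> * norm (fst w - snd w)"
  proof eventually_elim
    case (elim w)
    have *: "f (fst w) + g (fst w) - (f (snd w) + g (snd w)) - (D (fst w - snd w) + E (fst w - snd w))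
      = (f (fst w) - f (snd w) - D (fst w - snd w)) + (g (fst w) - g (snd w) - E (fst w - snd w))"
      by simp
    show ?case unfolding *
      using norm_triangle_ineq[of "f (fst w) - f (snd w) - D (fst w - snd w)"
          "g (fst w) - g (snd w) - E (fst w - snd w)"] elim
      by simp
  qed
qed

lemma strict_derivative_mult:
  fixes f g :: "'a::euclidean_space \<Rightarrow> real"
  assumes f: "strict_derivative f D x" and g: "strict_derivative g E x"
  shows "strict_derivative (\<lambda>x. f x * g x) (\<lambda>v. f x * E v + g x * D v) x"
  unfolding strict_derivative_def
proof (intro conjI allI impI)
  have lin: "linear D" "linear E" using f g by (auto simp: strict_derivative_def)
  show "linear (\<lambda>v. f x * E v + g x * D v)"
    using linear_compose_add[OF linear_compose_scale_right[OF lin(2)] linear_compose_scale_right[OF lin(1)]]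
    by simp
  obtain K where K: "K > 0" "\<And>v. norm (D v) \<le> norm v * K" 
    using lin(1) linear_linear bounded_linear.pos_bounded by blast
  obtain L where L: "L > 0" "\<And>v. norm (E v) \<le> norm v * L"
    using lin(2) linear_linear bounded_linear.pos_bounded by blast
  define C where "C = \<bar>f x\<bar> + 1 + L + (\<bar>g x\<bar> + 1) + K"
  have C: "C > 0" using K L by (simp add: C_def)
  fix \<epsilon> :: real assume "\<epsilon> > 0"
  then have \<epsilon>: "\<epsilon> / C > 0" using C by simp
  have "isCont f x" "isCont g x"
    using strict_derivative_imp_has_derivative f g has_derivative_continuous by blast+
  then have lim: "(f \<longlongrightarrow> f x) (nhds x)" "(g \<longlongrightarrow> g x) (nhds x)"
    by (auto simp: isCont_def tendsto_at_iff_tendsto_nhds)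
  have fs: "filterlim fst (nhds x) (nhds (x, x))" "filterlim snd (nhds x) (nhds (x, x))"
    unfolding nhds_prod by (rule filterlim_fst filterlim_snd)+
  have "((\<lambda>w. f (fst w)) \<longlongrightarrow> f x) (nhds (x, x))" "((\<lambda>w. g (snd w)) \<longlongrightarrow> g x) (nhds (x, x))"
    using filterlim_compose[OF lim(1) fs(1)] filterlim_compose[OF lim(2) fs(2)] by auto
  then have c: "\<And>e. e > 0 \<Longrightarrow> \<forall>\<^sub>F w in nhds (x, x). \<bar>f (fst w) - f x\<bar> < e"
    "\<And>e. e > 0 \<Longrightarrow> \<forall>\<^sub>F w in nhds (x, x). \<bar>g (snd w) - g x\<bar> < e"
    by (simp_all add: tendsto_iff dist_real_def)
  have
    "\<forall>\<^sub>F w in nhds (x, x). norm (f (fst w) - f (snd w) - D (fst w - snd w)) \<le> \<epsilon>/C * norm (fst w - snd w)"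
    "\<forall>\<^sub>F w in nhds (x, x). norm (g (fst w) - g (snd w) - E (fst w - snd w)) \<le> \<epsilon>/C * norm (fst w - snd w)"
    using f g \<epsilon> unfolding strict_derivative_def by blast+
  then show "\<forall>\<^sub>F w in nhds (x, x).
      norm (f (fst w) * g (fst w) - f (snd w) * g (snd w) -
            (f x * E (fst w - snd w) + g x * D (fst w - snd w)))
      \<le> \<epsilon> * norm (fst w - snd w)"
    using c(1)[OF \<epsilon>] c(2)[OF \<epsilon>] c(1)[of 1, simplified] c(2)[of 1, simplified]
  proof eventually_elim
    case (elim w)
    define y z h where "y = fst w" and "z = snd w" and "h = y - z"
    note e = elim[folded y_def z_def, folded h_def]
    have b: "\<bar>f y\<bar> \<le> \<bar>f x\<bar> + 1" "\<bar>g z\<bar> \<le> \<bar>g x\<bar> + 1" using e by linarith+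
    have "f y * g y - f z * g z - (f x * E h + g x * D h)
      = f y * (g y - g z - E h) + (f y - f x) * E h + g z * (f y - f z - D h) + (g z - g x) * D h"
      by (simp add: algebra_simps)
    also have "\<bar>\<dots>\<bar> \<le> \<bar>f y * (g y - g z - E h)\<bar> + \<bar>(f y - f x) * E h\<bar> + \<bar>g z * (f y - f z - D h)\<bar>
        + \<bar>(g z - g x) * D h\<bar>"
      by linarith
    also have "\<dots> \<le> (\<bar>f x\<bar> + 1) * (\<epsilon>/C * norm h) + \<epsilon>/C * (norm h * L)
        + (\<bar>g x\<bar> + 1) * (\<epsilon>/C * norm h) + \<epsilon>/C * (norm h * K)"
      unfolding abs_mult
    proof (intro add_mono mult_mono)
      show "\<bar>g y - g z - E h\<bar> \<le> \<epsilon>/C * norm h" "\<bar>f y - f z - D h\<bar> \<le> \<epsilon>/C * norm h"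
        using e(1,2) unfolding real_norm_def by blast+
      show "\<bar>E h\<bar> \<le> norm h * L" "\<bar>D h\<bar> \<le> norm h * K"
        using K(2) L(2) unfolding real_norm_def by auto
      show "\<bar>f y\<bar> \<le> \<bar>f x\<bar> + 1" "\<bar>g z\<bar> \<le> \<bar>g x\<bar> + 1" by (rule b)+
      show "\<bar>f y - f x\<bar> \<le> \<epsilon>/C" "\<bar>g z - g x\<bar> \<le> \<epsilon>/C" using e(3,4) by simp_all
      show "0 \<le> \<epsilon>/C" using \<epsilon> by simp
    qed (use \<epsilon> in simp_all)
    also have "\<dots> = \<epsilon> / C * norm h * C"
      unfolding C_def by algebra
    also have "\<dots> = \<epsilon> * norm h" using C by simp
    finally show ?case by (simp add: y_def z_def h_def)
  qed
qed

lemma strict_derivative_real_polynomial_function: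
  fixes p :: "'a::euclidean_space \<Rightarrow> real"
  assumes "real_polynomial_function p"
  shows "\<exists>D. strict_derivative p D x"
  using assms
proof induction
  case (linear f)
  then show ?case
    using strict_derivative_linear bounded_linear.linear by blast
next
  case (const c)
  show ?case using strict_derivative_const by blast
qed (blast intro: strict_derivative_add strict_derivative_mult)+

lemma strict_derivative_sum:
  assumes "finite I" "\<And>i. i \<in> I \<Longrightarrow> strict_derivative (f i) (D i) x"
  shows "strict_derivative (\<lambda>x. \<Sum>i\<in>I. f i x) (\<lambda>v. \<Sum>i\<in>I. D i v) x"
  using assms
  by (induction rule: finite_induct) (simp_all add: strict_derivative_const strict_derivative_add)

lemma strict_derivative_scaleR_const:
  assumes "strict_derivative p D x"
  shows "strict_derivative (\<lambda>z. p z *\<^sub>R b) (\<lambda>v. D v *\<^sub>R b) x"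
  unfolding strict_derivative_def
proof (intro conjI allI impI)
  have "linear D" using assms by (simp add: strict_derivative_def)
  then show "linear (\<lambda>v. D v *\<^sub>R b)"
    by (auto simp: linear_iff algebra_simps)
  fix \<epsilon> :: real assume "\<epsilon> > 0"
  then have "\<epsilon> / (norm b + 1) > 0" by (simp add: add_nonneg_pos)
  then have "\<forall>\<^sub>F w in nhds (x, x). norm (p (fst w) - p (snd w) - D (fst w - snd w))
      \<le> \<epsilon> / (norm b + 1) * norm (fst w - snd w)"
    using assms unfolding strict_derivative_def by blast
  then show "\<forall>\<^sub>F w in nhds (x, x).
      norm (p (fst w) *\<^sub>R b - p (snd w) *\<^sub>R b - D (fst w - snd w) *\<^sub>R b) \<le> \<epsilon> * norm (fst w - snd w)"
  proof eventually_elim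
    case (elim w)
    have "norm (p (fst w) *\<^sub>R b - p (snd w) *\<^sub>R b - D (fst w - snd w) *\<^sub>R b)
       = norm (p (fst w) - p (snd w) - D (fst w - snd w)) * norm b"
      by (metis norm_scaleR real_norm_def scaleR_diff_left)
    also have "\<dots> \<le> \<epsilon> / (norm b + 1) * norm (fst w - snd w) * (norm b + 1)"
      using elim by (intro mult_mono) auto
    also have "\<dots> = \<epsilon> * norm (fst w - snd w)"
      by (simp add: add_nonneg_pos add_nonneg_eq_0_iff)
    finally show ?case .
  qed
qed

lemma strict_derivative_polynomial_function:
  fixes f :: "'a::euclidean_space \<Rightarrow> 'b::euclidean_space"
  assumes f: "polynomial_function f" and D: "(f has_derivative D) (at x)"
  shows "strict_derivative f D x"
proof -
  have "\<forall>b\<in>Basis. \<exists>E. strict_derivative (\<lambda>z. f z \<bullet> b) E x"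
    using f by (auto simp: polynomial_function_iff_Basis_inner intro: strict_derivative_real_polynomial_function)
  then obtain E where E: "\<And>b. b \<in> Basis \<Longrightarrow> strict_derivative (\<lambda>z. f z \<bullet> b) (E b) x" by metis
  have *: "strict_derivative (\<lambda>z. \<Sum>b\<in>Basis. (f z \<bullet> b) *\<^sub>R b) (\<lambda>v. \<Sum>b\<in>Basis. E b v *\<^sub>R b) x"
    by (intro strict_derivative_sum strict_derivative_scaleR_const E) auto
  have "strict_derivative f (\<lambda>v. \<Sum>b\<in>Basis. E b v *\<^sub>R b) x"
    using * by (simp add: euclidean_representation)
  with strict_derivative_imp_has_derivative[OF this] show ?thesis
    using has_derivative_unique D by blast
qed

lemma isCont_polynomial:
  fixes f :: "'a::euclidean_space \<Rightarrow> 'b::euclidean_space"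
  shows "polynomial_function f \<Longrightarrow> isCont f x"
  using continuous_on_polymonial_function[of f UNIV] by (simp add: continuous_on_eq_continuous_at)

section \<open>Gradients and tangent vectors\<close>

lemma gradient_inner:
  assumes "real_polynomial_function p"
  shows "gradient p x \<bullet> v = frechet_derivative p (at x) v"
proof -
  have "p differentiable (at x)"
    using assms by (rule differentiable_at_real_polynomial_function)
  then have lin: "linear (frechet_derivative p (at x))"
    by (rule linear_frechet_derivative)
  have "frechet_derivative p (at x) v = frechet_derivative p (at x) (\<Sum>b\<in>Basis. (v \<bullet> b) *\<^sub>R b)"
    by (simp add: euclidean_representation)
  also have "\<dots> = (\<Sum>b\<in>Basis. (v \<bullet> b) * frechet_derivative p (at x) b)"
    using lin by (simp add: linear_sum linear.scaleR)
  also have "\<dots> = gradient p x \<bullet> v"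
    by (simp add: gradient_def inner_sum_left inner_sum_right inner_commute[of _ v] mult.commute)
  finally show ?thesis by simp
qed

lemma has_derivative_gradient:
  assumes "real_polynomial_function p"
  shows "(p has_derivative (\<lambda>v. gradient p x \<bullet> v)) (at x)"
  unfolding gradient_inner[OF assms]
  using differentiable_at_real_polynomial_function[OF assms] frechet_derivative_works by blast

lemma gradient_unique:
  assumes "real_polynomial_function p" "(p has_derivative (\<lambda>v. a \<bullet> v)) (at x)"
  shows "gradient p x = a"
proof -
  have "(\<lambda>v. gradient p x \<bullet> v) = (\<lambda>v. a \<bullet> v)"
    using has_derivative_unique has_derivative_gradient assms by blast
  then show ?thesis by (metis vector_eq_rdot)
qed

text \<open>
  The derivative of a polynomial in the vanishing ideal along a curve in the set is zero. Below, the
  curve runs in a unitary orbit contained in \<open>M\<close>.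
\<close>

lemma tangent_of_curve:
  assumes \<phi>: "(\<phi> has_vector_derivative v) (at 0)" and "\<And>t. \<phi> t \<in> S"
  shows "v \<in> tangent_space S (\<phi> 0)"
  unfolding tangent_space_def
proof safe
  fix p assume p: "p \<in> vanishing_ideal S"
  then have "(p has_derivative (\<lambda>v. gradient p (\<phi> 0) \<bullet> v)) (at (\<phi> 0))"
    by (auto simp: vanishing_ideal_def has_derivative_gradient)
  from vector_derivative_diff_chain_within[OF \<phi> has_derivative_at_withinI, OF this]
  have "((p \<circ> \<phi>) has_vector_derivative gradient p (\<phi> 0) \<bullet> v) (at 0)" by simp
  moreover have "p \<circ> \<phi> = (\<lambda>_. 0)" using p assms(2) by (auto simp: vanishing_ideal_def)
  ultimately show "gradient p (\<phi> 0) \<bullet> v = 0"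
    using vector_derivative_unique_at[of "p \<circ> \<phi>" _ 0 0] by simp
qed

lemma tangent_space_subspace: "subspace (tangent_space S x)"
  unfolding tangent_space_def subspace_def by (auto simp: inner_add_right)

lemma smooth_in: "X \<in> smooth_points T \<Longrightarrow> X \<in> T"
  by (simp add: smooth_points_def)

text \<open>
  Composition with \<open>L\<close> maps the vanishing ideal of \<open>T\<close> into that of \<open>S\<close>.
\<close>

lemma tangent_space_linear_image:
  assumes "linear L" and "\<And>z. z \<in> S \<Longrightarrow> L z \<in> T" and v: "v \<in> tangent_space S x"
  shows "L v \<in> tangent_space T (L x)"
  unfolding tangent_space_def
proof safe
  fix p assume p: "p \<in> vanishing_ideal T"
  have bl: "bounded_linear L" using assms(1) by (simp add: linear_linear)
  have rp: "real_polynomial_function p" using p by (simp add: vanishing_ideal_def)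
  have "real_polynomial_function (p \<circ> L)"
    using rp polynomial_function_bounded_linear[OF bl] by (rule real_polynomial_function_compose[rotated])
  moreover have "((p \<circ> L) has_derivative (\<lambda>v. adjoint L (gradient p (L x)) \<bullet> v)) (at x)"
    using diff_chain_at[OF bounded_linear_imp_has_derivative[OF bl] has_derivative_gradient[OF rp]]
    by (simp add: o_def adjoint_clauses[OF assms(1)])
  ultimately have "gradient (p \<circ> L) x = adjoint L (gradient p (L x))" "p \<circ> L \<in> vanishing_ideal S"
    using gradient_unique p assms(2) by (auto simp: vanishing_ideal_def)
  then show "gradient p (L x) \<bullet> L v = 0"
    using v adjoint_clauses[OF assms(1)] by (fastforce simp: tangent_space_def)
qed

section \<open>Local structure of a set near a smooth point\<close>

text \<open>
  Gradients of defining equations together with the dual basis of their span. They turn a system of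
  scalar equations into a single map with values in the normal space whose derivative is the
  orthogonal projection.
\<close>

locale dual_frame =
  fixes P :: "'i set" and a e :: "'i \<Rightarrow> 'a::euclidean_space"
  assumes finite_P: "finite P"
    and e_span: "p \<in> P \<Longrightarrow> e p \<in> span (a ` P)"
    and dual: "p \<in> P \<Longrightarrow> q \<in> P \<Longrightarrow> a q \<bullet> e p = (if p = q then 1 else 0)"
begin

definition proj :: "'a \<Rightarrow> 'a" where "proj v = (\<Sum>p\<in>P. (a p \<bullet> v) *\<^sub>R e p)"

lemma linear_proj: "linear proj"
  unfolding proj_def linear_iff by (simp add: sum.distrib scaleR_sum_right inner_add_right scaleR_add_left)

lemma proj_in_span: "proj v \<in> span (a ` P)"
  unfolding proj_def by (intro span_sum span_scale e_span)

lemma inner_sum_dual: "q \<in> P \<Longrightarrow> a q \<bullet> (\<Sum>p\<in>P. c p *\<^sub>R e p) = c q"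
proof -
  assume q: "q \<in> P"
  have "a q \<bullet> (\<Sum>p\<in>P. c p *\<^sub>R e p) = (\<Sum>p\<in>P. if p = q then c p else 0)"
    unfolding inner_sum_right by (intro sum.cong refl) (simp add: dual q)
  then show ?thesis by (simp add: finite_P q)
qed

lemma proj_orthogonal: "(\<And>q. q \<in> P \<Longrightarrow> a q \<bullet> v = 0) \<Longrightarrow> proj v = 0"
  by (simp add: proj_def)

lemma orthogonal_span_iff: "(\<forall>n\<in>span (a ` P). n \<bullet> v = 0) \<longleftrightarrow> (\<forall>q\<in>P. a q \<bullet> v = 0)"
proof
  assume "\<forall>q\<in>P. a q \<bullet> v = 0"
  then have "orthogonal v n" if "n \<in> span (a ` P)" for n
    using orthogonal_to_span[OF that, of v] \<open>\<forall>q\<in>P. a q \<bullet> v = 0\<close>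
    by (metis imageE inner_commute orthogonal_def)
  then show "\<forall>n\<in>span (a ` P). n \<bullet> v = 0" by (simp add: orthogonal_def inner_commute)
qed (auto intro: span_base)

lemma proj_diff_orthogonal: "n \<in> span (a ` P) \<Longrightarrow> n \<bullet> (v - proj v) = 0"
  using orthogonal_span_iff[of "v - proj v"] inner_sum_dual by (auto simp: proj_def inner_diff_right)

lemma inj_frame: "inj_on a P"
proof (rule inj_onI)
  fix p q assume "p \<in> P" "q \<in> P" "a p = a q"
  then show "p = q" using dual[of p p] dual[of p q] by (auto split: if_splits)
qed

lemma independent_frame: "independent (a ` P)"
  unfolding dependent_def
proof safe
  fix q assume q: "q \<in> P" "a q \<in> span (a ` P - {a q})"
  have "orthogonal (e q) (a q)"
    using q by (intro orthogonal_to_span[OF q(2)]) (auto simp: orthogonal_def inner_commute[of "e q"] dual)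
  then show False using dual[OF q(1) q(1)] by (simp add: orthogonal_def inner_commute)
qed

lemma proj_id: assumes "v \<in> span (a ` P)" shows "proj v = v"
proof -
  have "v - proj v \<in> span (a ` P)" using assms proj_in_span span_diff by blast
  then have "(v - proj v) \<bullet> (v - proj v) = 0" using proj_diff_orthogonal by blast
  then show ?thesis by simp
qed

lemma norm_proj_le: "norm (proj v) \<le> norm v"
proof -
  have "proj v \<bullet> proj v = proj v \<bullet> v"
    using proj_diff_orthogonal[OF proj_in_span, of v v] by (simp add: inner_diff_right)
  then have "norm (proj v) * norm (proj v) \<le> norm (proj v) * norm v"
    using norm_cauchy_schwarz[of "proj v" v] by (simp add: dot_square_norm power2_eq_square)
  then show ?thesis by (cases "proj v = 0") auto
qed

end

text \<open>
  The coordinate functionals of a basis are represented by vectors, and only the component of such a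
  vector in the span of the basis matters.
\<close>

lemma dual_frame_exists:
  fixes a :: "'i \<Rightarrow> 'a::euclidean_space"
  assumes "finite P" "inj_on a P" "independent (a ` P)"
  obtains e where "dual_frame P a e"
proof -
  have "\<exists>u. u \<in> span (a ` P) \<and> (\<forall>q\<in>P. a q \<bullet> u = (if p = q then 1 else 0))" if "p \<in> P" for p
  proof -
    obtain g :: "'a \<Rightarrow> real" where g: "linear g" "\<And>u. u \<in> a ` P \<Longrightarrow> g u = (if u = a p then 1 else 0)"
      using linear_independent_extend[OF assms(3), of "\<lambda>u. if u = a p then 1 else 0"] by auto
    obtain y z where yz: "y \<in> span (a ` P)" "\<And>w. w \<in> span (a ` P) \<Longrightarrow> orthogonal z w"
      "adjoint g 1 = y + z"
      using orthogonal_subspace_decomp_exists by metis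
    have "a q \<bullet> y = (if p = q then 1 else 0)" if "q \<in> P" for q
    proof -
      have "a q \<bullet> z = 0"
        using yz(2)[OF span_base[of "a q"]] that by (simp add: orthogonal_def inner_commute)
      then have "a q \<bullet> y = a q \<bullet> adjoint g 1" by (simp add: yz(3) inner_add_right)
      also have "\<dots> = g (a q)" using adjoint_works[OF g(1), of "a q" 1] by simp
      also have "\<dots> = (if p = q then 1 else 0)"
        using g(2) that \<open>p \<in> P\<close> assms(2) by (auto simp: inj_on_eq_iff)
      finally show ?thesis .
    qed
    then show ?thesis using yz(1) by blast
  qed
  then obtain e where "\<And>p. p \<in> P \<Longrightarrow> e p \<in> span (a ` P) \<and> (\<forall>q\<in>P. a q \<bullet> e p = (if p = q then 1 else 0))"
    by metis
  then show thesis using assms(1) by (intro that[of e]) (unfold_locales, auto)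
qed

text \<open>
  The equations \<open>P\<close> hold on \<open>S\<close>, but need not cut it out. This generality is used in
  \<open>gradient_in_N\<close>, where a further equation is adjoined to a complete system.
\<close>

locale polynomial_frame = dual_frame P "\<lambda>p. gradient p x" e
  for S :: "'a::euclidean_space set" and x :: 'a and P e +
  assumes P_vanish: "P \<subseteq> vanishing_ideal S" and x_in: "x \<in> S"
begin

abbreviation N :: "'a set" where "N \<equiv> span ((\<lambda>p. gradient p x) ` P)"

definition eqn :: "'a \<Rightarrow> 'a" where "eqn z = (\<Sum>p\<in>P. p z *\<^sub>R e p)"

lemma P_poly: "p \<in> P \<Longrightarrow> real_polynomial_function p"
  using P_vanish by (auto simp: vanishing_ideal_def)

lemma polynomial_eqn: "polynomial_function eqn"
  unfolding eqn_def
  using finite_P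
proof (intro polynomial_function_sum polynomial_function_mult)
  show "polynomial_function p" if "p \<in> P" for p
    using P_poly[OF that] by (simp add: real_polynomial_function_eq)
qed simp_all

lemma has_derivative_eqn: "(eqn has_derivative proj) (at x)"
  unfolding eqn_def proj_def
  by (intro has_derivative_sum has_derivative_scaleR_left has_derivative_gradient P_poly)

lemma eqn_zero: "z \<in> S \<Longrightarrow> eqn z = 0"
  using P_vanish by (auto simp: eqn_def vanishing_ideal_def intro!: sum.neutral)

lemma eqn_zero_imp: "eqn z = 0 \<Longrightarrow> q \<in> P \<Longrightarrow> q z = 0"
  using inner_sum_dual[of q "\<lambda>p. p z"] by (simp add: eqn_def)

text \<open>
  To first order \<open>eqn\<close> is injective in the normal directions.
\<close>

lemma locally_unique:
  obtains \<delta> where "\<delta> > 0" "\<And>s. s \<in> S \<Longrightarrow> s \<in> ball x \<delta> \<Longrightarrow> s - x \<in> N \<Longrightarrow> s = x"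
proof -
  have "strict_derivative eqn proj x"
    using polynomial_eqn has_derivative_eqn by (rule strict_derivative_polynomial_function)
  then obtain \<delta> where \<delta>: "\<delta> > 0" "\<And>y z. y \<in> ball x \<delta> \<Longrightarrow> z \<in> ball x \<delta> \<Longrightarrow>
      norm (eqn y - eqn z - proj (y - z)) \<le> 1/2 * norm (y - z)"
    by (rule strict_derivative_ball[where \<epsilon> = "1/2"]) auto
  show thesis
  proof (rule that[OF \<delta>(1)])
    fix s assume s: "s \<in> S" "s \<in> ball x \<delta>" "s - x \<in> N"
    have "norm (eqn s - eqn x - proj (s - x)) \<le> 1/2 * norm (s - x)"
      using \<delta>(2)[OF s(2), of x] \<delta>(1) by simp
    then show "s = x" using eqn_zero s x_in proj_id[OF s(3)] by (simp add: norm_minus_commute)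
  qed
qed

end

locale smooth_chart = polynomial_frame S x P e
  for S :: "'a::euclidean_space set" and x :: 'a and P e +
  fixes W
  assumes openW: "open W" and x_W: "x \<in> W" and cut_out: "S \<inter> W = {z \<in> W. \<forall>p\<in>P. p z = 0}"
begin

text \<open>
  The set \<open>S\<close> near \<open>x\<close> is a graph over the tangent space, so that every nearby point can be moved to
  \<open>S\<close> in a normal direction. This follows from the open mapping property of \<open>\<Psi>\<close>, whose derivative at \<open>x\<close> is the identity.
\<close>

lemma local_projection:
  assumes "open V" "x \<in> V"
  obtains \<delta> where "\<delta> > 0" "\<And>z. z \<in> ball x \<delta> \<Longrightarrow> \<exists>s\<in>S \<inter> V. z - s \<in> N"
proof -
  define \<Psi> where "\<Psi> s = eqn s + (s - proj s)" for s
  have blp: "bounded_linear proj" using linear_proj by (simp add: linear_linear)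
  have dproj: "(proj has_derivative proj) (at z)" for z
    using blp by (rule bounded_linear_imp_has_derivative)
  have "(\<Psi> has_derivative (\<lambda>v. proj v + (v - proj v))) (at x)"
    unfolding \<Psi>_def
    by (intro has_derivative_add has_derivative_diff has_derivative_eqn has_derivative_ident dproj)
  then have d\<Psi>: "(\<Psi> has_derivative id) (at x)" by (simp add: id_def)
  have "polynomial_function \<Psi>"
    unfolding \<Psi>_def
    by (intro polynomial_function_add polynomial_function_diff polynomial_eqn polynomial_function_id
        polynomial_function_bounded_linear blp)
  then have c: "continuous_on UNIV \<Psi>" by (rule continuous_on_polymonial_function)
  have "\<Psi> x \<in> interior (\<Psi> ` (V \<inter> W))"
    using assms openW x_W
    by (intro sussmann_open_mapping[OF open_UNIV c _ d\<Psi>, of id])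
       (auto simp: interior_open open_Int bounded_linear_ident id_def)
  then obtain r where r: "r > 0" "ball (\<Psi> x) r \<subseteq> \<Psi> ` (V \<inter> W)"
    by (meson mem_interior)
  have "isCont (\<lambda>z. z - proj z) x"
    using has_derivative_continuous[OF dproj] by (intro continuous_intros)
  then obtain \<delta> where \<delta>: "\<delta> > 0" "\<And>z. dist z x < \<delta> \<Longrightarrow> dist (z - proj z) (x - proj x) < r"
    using r(1) unfolding continuous_at_eps_delta by blast
  show thesis
  proof (rule that[OF \<delta>(1)])
    fix z assume "z \<in> ball x \<delta>"
    then have "z - proj z \<in> ball (\<Psi> x) r"
      using \<delta>(2)[of z] eqn_zero[OF x_in] by (simp add: \<Psi>_def dist_commute)
    then obtain s where s: "s \<in> V \<inter> W" "z - proj z = \<Psi> s" using r(2) by blast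
    have "eqn s \<in> N" unfolding eqn_def by (intro span_sum span_scale e_span)
    then have "proj (eqn s) = eqn s" by (rule proj_id)
    moreover have "proj (z - proj z) = 0" "proj (s - proj s) = 0"
      using linear_proj proj_id[OF proj_in_span] by (simp_all add: linear_diff)
    ultimately have eq: "eqn s = 0"
      using s(2) linear_proj by (simp add: \<Psi>_def linear_add)
    then have "s \<in> S" using eqn_zero_imp s(1) cut_out by blast
    moreover have "z - s = proj (z - s)"
      using s(2) eq linear_proj by (simp add: \<Psi>_def linear_diff algebra_simps)
    then have "z - s \<in> N" using proj_in_span by metis
    ultimately show "\<exists>s\<in>S \<inter> V. z - s \<in> N" using s(1) by blast
  qed
qed

text \<open>
  The chosen equations already determine the Zariski tangent space. If the gradient \<open>b\<close> of some \<open>q\<close>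
  in the ideal were not in \<open>N\<close>, then \<open>S\<close> would contain a point close to \<open>x + t b\<close>, by
  \<open>local_projection\<close> for \<open>P\<close>; but \<open>P\<close> extended by \<open>q\<close> admits no point of \<open>S\<close> in that direction,
  by \<open>locally_unique\<close>.
\<close>

lemma gradient_in_N:
  assumes q: "q \<in> vanishing_ideal S"
  shows "gradient q x \<in> N"
proof (rule ccontr)
  assume n: "gradient q x \<notin> N"
  let ?a = "\<lambda>p. gradient p x"
  let ?P = "insert q P"
  have ind: "inj_on ?a P" "independent (?a ` P)"
    by (rule inj_frame, rule independent_frame)
  have "q \<notin> P" using n by (auto intro: span_base)
  moreover have "independent (?a ` ?P)" using n ind by (simp add: independent_insert)
  moreover have "inj_on ?a ?P" using n ind by (auto simp: intro: span_base)
  ultimately obtain e' where "dual_frame ?P ?a e'"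
    using dual_frame_exists[of ?P ?a] finite_P by auto
  then interpret F: polynomial_frame S x ?P e'
    using P_vanish x_in q by (simp add: polynomial_frame_def polynomial_frame_axioms_def)
  obtain \<delta> where \<delta>: "\<delta> > 0" "\<And>s. s \<in> S \<Longrightarrow> s \<in> ball x \<delta> \<Longrightarrow> s - x \<in> F.N \<Longrightarrow> s = x"
    using F.locally_unique by blast
  obtain \<eta> where \<eta>: "\<eta> > 0" "\<And>z. z \<in> ball x \<eta> \<Longrightarrow> \<exists>s\<in>S \<inter> ball x \<delta>. z - s \<in> N"
    using local_projection[of "ball x \<delta>"] \<delta>(1) by auto
  define b where "b = gradient q x"
  have b: "b \<noteq> 0" "b \<notin> N" using n span_zero[of "?a ` P"] by (auto simp: b_def)
  define t where "t = \<eta> / 2 / norm b"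
  have t: "t \<noteq> 0" "norm (t *\<^sub>R b) < \<eta>" using \<eta>(1) b by (auto simp: t_def)
  obtain s where s: "s \<in> S" "s \<in> ball x \<delta>" "x + t *\<^sub>R b - s \<in> N"
    using \<eta>(2)[of "x + t *\<^sub>R b"] t(2) by (auto simp: dist_norm)
  have "N \<subseteq> F.N" by (intro span_mono) auto
  moreover have "t *\<^sub>R b \<in> F.N" unfolding b_def by (intro span_scale span_base) auto
  ultimately have "t *\<^sub>R b - (x + t *\<^sub>R b - s) \<in> F.N" using s(3) span_diff by blast
  then have "s = x" using \<delta>(2) s by (simp add: algebra_simps)
  then have "t *\<^sub>R b \<in> N" using s(3) by simp
  then show False using b t(1) span_scale[of "t *\<^sub>R b" _ "1/t"] by simp
qed

lemma tangent_space_eq: "tangent_space S x = {v. proj v = 0}"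
proof safe
  fix v assume "v \<in> tangent_space S x"
  then show "proj v = 0"
    using P_vanish by (intro proj_orthogonal) (auto simp: tangent_space_def)
next
  fix v assume "proj v = 0"
  then show "v \<in> tangent_space S x"
    using proj_diff_orthogonal[OF gradient_in_N, of _ v] by (simp add: tangent_space_def)
qed

end

lemma smooth_chart_exists:
  assumes "x \<in> smooth_points S"
  obtains P e W where "smooth_chart S x P e W"
proof -
  obtain P W where PW: "x \<in> S" "finite P" "P \<subseteq> vanishing_ideal S"
    "inj_on (\<lambda>p. gradient p x) P" "independent ((\<lambda>p. gradient p x) ` P)"
    "open W" "x \<in> W" "S \<inter> W = {z \<in> W. \<forall>p\<in>P. p z = 0}"
    using assms unfolding smooth_points_def by blast
  obtain e where "dual_frame P (\<lambda>p. gradient p x) e"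
    using dual_frame_exists PW by blast
  then have "smooth_chart S x P e W"
    using PW by (intro smooth_chart.intro polynomial_frame.intro polynomial_frame_axioms.intro
        smooth_chart_axioms.intro)
  then show thesis by (rule that)
qed


section \<open>Smooth points and tubular maps\<close>

text \<open>
  In the model case \<open>G z = z - r z\<close> for the projection \<open>r\<close> of a tubular neighbourhood onto \<open>S\<close>, and
  \<open>G (z - G z) = 0\<close>. For a polynomial map only an approximation can be expected. The last
  inequality takes the place of independent gradients: to first order it says that the derivative
  of \<open>G\<close> at \<open>x\<close> almost fixes the values of \<open>G\<close> near \<open>x\<close>, so that these values are determined by
  their component in its range.
\<close>

definition tubular :: "'a::euclidean_space set \<Rightarrow> 'a \<Rightarrow> ('a \<Rightarrow> 'a) \<Rightarrow> bool" where
  "tubular S x G \<longleftrightarrow> polynomial_function G \<and> (\<forall>z\<in>S. G z = 0) \<and>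
     (\<exists>\<delta>>0. \<forall>z\<in>ball x \<delta>. (G z = 0 \<longrightarrow> z \<in> S) \<and> norm (G (z - G z)) \<le> norm (G z) / 4)"

text \<open>
  With \<open>D\<close> the derivative of \<open>G\<close> at \<open>x\<close> and \<open>w = G z\<close>, the inequality for \<open>G\<close> and strict
  differentiability give \<open>\<parallel>w - D w\<parallel> \<le> \<parallel>w\<parallel> / 2\<close>. Hence \<open>w = 0\<close> as soon as \<open>w\<close> is orthogonal to
  the range of \<open>D\<close>, and the components of \<open>G\<close> along a basis of that range cut out \<open>S\<close>. Their
  gradients are independent since the adjoint of \<open>D\<close> is injective on the range of \<open>D\<close>.
\<close>

lemma tubular_imp_smooth:
  assumes x: "x \<in> S" and tub: "tubular S x G"
  shows "x \<in> smooth_points S"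
proof -
  have G: "polynomial_function G" "\<And>z. z \<in> S \<Longrightarrow> G z = 0"
    using tub by (auto simp: tubular_def)
  obtain \<delta>0 where \<delta>0: "\<delta>0 > 0" "\<And>z. z \<in> ball x \<delta>0 \<Longrightarrow> G z = 0 \<Longrightarrow> z \<in> S"
    "\<And>z. z \<in> ball x \<delta>0 \<Longrightarrow> norm (G (z - G z)) \<le> norm (G z) / 4"
    using tub unfolding tubular_def by blast
  obtain D where D: "(G has_derivative D) (at x)"
    using G(1) differentiable_at_polynomial_function unfolding differentiable_def by blast
  then have linD: "linear D" by (rule has_derivative_linear)
  from G(1) D have "strict_derivative G D x" by (rule strict_derivative_polynomial_function)
  then obtain \<delta>1 where \<delta>1: "\<delta>1 > 0" "\<And>y z. y \<in> ball x \<delta>1 \<Longrightarrow> z \<in> ball x \<delta>1 \<Longrightarrow>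
      norm (G y - G z - D (y - z)) \<le> 1/4 * norm (y - z)"
    by (rule strict_derivative_ball[where \<epsilon> = "1/4"]) auto
  have "isCont (\<lambda>z. z - G z) x"
    using isCont_polynomial[OF G(1)] by (intro continuous_intros)
  then obtain \<delta>2 where \<delta>2: "\<delta>2 > 0" "\<And>z. dist z x < \<delta>2 \<Longrightarrow> dist (z - G z) (x - G x) < \<delta>1"
    using \<delta>1(1) unfolding continuous_at_eps_delta by blast
  define W where "W = ball x (min \<delta>0 (min \<delta>1 \<delta>2))"
  have near: "norm (G z - D (G z)) \<le> norm (G z) / 2" if "z \<in> W" for z
  proof -
    have z: "z \<in> ball x \<delta>0" "z \<in> ball x \<delta>1" "z - G z \<in> ball x \<delta>1"
      using that \<delta>2(2)[of z] G(2)[OF x] by (auto simp: W_def dist_commute)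
    have "norm (G z - G (z - G z) - D (z - (z - G z))) \<le> 1/4 * norm (z - (z - G z))"
      by (rule \<delta>1(2)[OF z(2,3)])
    then have "norm (G z - D (G z) - G (z - G z)) \<le> norm (G z) / 4"
      by (simp add: algebra_simps)
    then show ?thesis
      using \<delta>0(3)[OF z(1)] norm_triangle_ineq[of "G z - D (G z) - G (z - G z)" "G (z - G z)"]
      by simp
  qed
  obtain B where B: "B \<subseteq> range D" "independent B" "range D = span B"
    using basis_exists[of "range D"] linD
    by (metis linear_subspace_image span_eq_iff span_mono subset_antisym subspace_UNIV)
  have finB: "finite B" using B(2) by (rule independent_imp_finite)
  define P where "P = (\<lambda>b z. G z \<bullet> b) ` B"
  have poly: "real_polynomial_function (\<lambda>z. G z \<bullet> b)" for b
    using polynomial_function_inner[OF G(1)] by (simp add: real_polynomial_function_eq)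
  have grad: "gradient (\<lambda>z. G z \<bullet> b) x = adjoint D b" for b
  proof (rule gradient_unique[OF poly])
    show "((\<lambda>z. G z \<bullet> b) has_derivative (\<bullet>) (adjoint D b)) (at x)"
      using has_derivative_inner_left[OF D, of b] unfolding adjoint_clauses(2)[OF linD]
      by (simp only: inner_commute[of _ b])
  qed
  have inj: "inj_on (adjoint D) (span B)"
  proof (subst linear_inj_on_iff_eq_0)
    show "linear (adjoint D)" by (rule adjoint_linear[OF linD])
    show "subspace (span B)" by (rule subspace_span)
    show "\<forall>b\<in>span B. adjoint D b = 0 \<longrightarrow> b = 0"
    proof (intro ballI impI)
      fix b assume b: "b \<in> span B" "adjoint D b = 0"
      then obtain u where "b = D u" using B(3) by blast
      then have "b \<bullet> b = adjoint D b \<bullet> u" by (simp add: adjoint_clauses[OF linD])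
      then show "b = 0" using b(2) by simp
    qed
  qed
  have "inj_on (\<lambda>p. gradient p x) P"
  proof (rule inj_onI)
    fix p q assume pq: "p \<in> P" "q \<in> P" "gradient p x = gradient q x"
    then obtain b c where bc: "b \<in> B" "c \<in> B" "p = (\<lambda>z. G z \<bullet> b)" "q = (\<lambda>z. G z \<bullet> c)"
      by (auto simp: P_def)
    then have "b = c" using pq(3) grad inj span_base[of _ B] by (auto dest: inj_onD)
    then show "p = q" using bc by simp
  qed
  moreover have "(\<lambda>p. gradient p x) ` P = adjoint D ` B"
    by (simp add: P_def image_image grad)
  moreover have "independent (adjoint D ` B)"
    by (rule linear_independent_injective_image[OF adjoint_linear[OF linD] B(2) inj])
  moreover have "P \<subseteq> vanishing_ideal S"
    using poly G(2) by (auto simp: P_def vanishing_ideal_def)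
  moreover have "S \<inter> W = {z \<in> W. \<forall>p\<in>P. p z = 0}"
  proof (intro subset_antisym subsetI)
    fix z assume z: "z \<in> {z \<in> W. \<forall>p\<in>P. p z = 0}"
    then have "\<And>b. b \<in> B \<Longrightarrow> orthogonal (G z) b" by (auto simp: P_def orthogonal_def)
    moreover have "D (G z) \<in> span B" using B(3) by blast
    ultimately have "G z \<bullet> D (G z) = 0"
      using orthogonal_to_span[of "D (G z)" B "G z"] by (simp add: orthogonal_def)
    then have "norm (G z) * norm (G z) = G z \<bullet> (G z - D (G z))"
      by (simp add: inner_diff_right dot_square_norm power2_eq_square)
    also have "\<dots> \<le> norm (G z) * norm (G z - D (G z))" by (rule norm_cauchy_schwarz)
    also have "\<dots> \<le> norm (G z) * (norm (G z) / 2)"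
      using near z by (intro mult_left_mono) auto
    finally have "norm (G z) * norm (G z) \<le> 0" by simp
    then have "G z = 0" by (simp add: mult_le_0_iff)
    then show "z \<in> S \<inter> W" using \<delta>0(2) z by (auto simp: W_def)
  qed (use G(2) in \<open>auto simp: P_def\<close>)
  moreover have "open W" "x \<in> W" using \<delta>0(1) \<delta>1(1) \<delta>2(1) by (auto simp: W_def)
  moreover have "finite P" using finB by (simp add: P_def)
  ultimately show ?thesis unfolding smooth_points_def using x by auto
qed

section \<open>Equivariant tubular maps\<close>

locale isometry_group =
  fixes \<Gamma> :: "('a::euclidean_space \<Rightarrow> 'a) set"
  assumes finite_group: "finite \<Gamma>"
    and isometry: "g \<in> \<Gamma> \<Longrightarrow> orthogonal_transformation g"
    and comp_closed: "g \<in> \<Gamma> \<Longrightarrow> h \<in> \<Gamma> \<Longrightarrow> g \<circ> h \<in> \<Gamma>"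
    and inv_closed: "g \<in> \<Gamma> \<Longrightarrow> inv g \<in> \<Gamma>"
    and id_closed: "id \<in> \<Gamma>"
begin

lemma inv_apply [simp]: "g \<in> \<Gamma> \<Longrightarrow> g (inv g v) = v" "g \<in> \<Gamma> \<Longrightarrow> inv g (g v) = v"
  using isometry orthogonal_transformation_bij[of g] by (simp_all add: bij_is_surj surj_f_inv_f bij_is_inj)

lemma linear_group: "g \<in> \<Gamma> \<Longrightarrow> linear g"
  using isometry orthogonal_transformation_linear by blast

text \<open>
  Right translation permutes the group; this is what makes averages over it equivariant.
\<close>

lemma sum_translate: assumes h: "h \<in> \<Gamma>" shows "(\<Sum>g\<in>\<Gamma>. f (g \<circ> h)) = (\<Sum>g\<in>\<Gamma>. f g)"
proof (rule sum.reindex_bij_witness[where i = "\<lambda>g. g \<circ> inv h" and j = "\<lambda>g. g \<circ> h"])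
  fix g assume "g \<in> \<Gamma>"
  show "g \<circ> h \<circ> inv h = g" "g \<circ> inv h \<circ> h = g" using h by (auto simp: fun_eq_iff)
  show "g \<circ> inv h \<in> \<Gamma>" "g \<circ> h \<in> \<Gamma>" using \<open>g \<in> \<Gamma>\<close> h comp_closed inv_closed by auto
qed simp

text \<open>
  The map \<open>eqn\<close> is averaged over the group, after multiplication with a polynomial \<open>sep\<close> that is \<open>1\<close>
  at \<open>x\<close> and \<open>0\<close> at the other points of the orbit of \<open>x\<close>. At \<open>x\<close> the group elements that move
  \<open>x\<close> then do not contribute to the derivative. The others preserve the tangent and the normal space,
  so that each of them contributes the normal projection. For \<open>z\<close> near \<open>x\<close> and a point \<open>s\<close> of \<open>S\<close>
  with \<open>z - s\<close> normal, it follows that \<open>G z\<close> is \<open>z - s\<close> up to a small relative error, which gives the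
  estimates of a tubular map.
\<close>

lemma equivariant_tubular_map:
  assumes x: "x \<in> smooth_points S" and inv: "\<And>g z. g \<in> \<Gamma> \<Longrightarrow> z \<in> S \<Longrightarrow> g z \<in> S"
  obtains G D where "tubular S x G" "\<And>g z. g \<in> \<Gamma> \<Longrightarrow> G (g z) = g (G z)"
    "(G has_derivative D) (at x)" "\<And>v. D v = 0 \<Longrightarrow> v \<in> tangent_space S x"
proof -
  obtain P e W where "smooth_chart S x P e W" using smooth_chart_exists[OF x] .
  then interpret smooth_chart S x P e W .
  define stab where "stab = {g \<in> \<Gamma>. g x = x}"
  define m where "m = real (card stab)"
  have "finite stab" using finite_group by (simp add: stab_def)
  moreover have "id \<in> stab" using id_closed by (simp add: stab_def)
  ultimately have m: "m > 0" unfolding m_def using card_gt_0_iff by auto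
  \<comment> \<open>each factor vanishes at one orbit point \<open>w \<noteq> x\<close> and equals \<open>1\<close> at \<open>x\<close>\<close>
  define sep where "sep y = (\<Prod>w\<in>(\<lambda>g. g x) ` \<Gamma> - {x}. ((y - w) \<bullet> (x - w)) / (norm (x - w))\<^sup>2)" for y
  have sep: "real_polynomial_function sep"
    unfolding sep_def
  proof (intro real_polynomial_function_prod real_polynomial_function_divide)
    show "finite ((\<lambda>g. g x) ` \<Gamma> - {x})" using finite_group by simp
    have "polynomial_function (\<lambda>y. y - w)" for w :: 'a
      by (intro polynomial_function_diff polynomial_function_id polynomial_function_const)
    then show "real_polynomial_function (\<lambda>y. (y - w) \<bullet> (x - w))" for w
      unfolding real_polynomial_function_eq by (rule polynomial_function_inner)
  qed
  have sep1: "sep x = 1"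
    unfolding sep_def by (intro prod.neutral) (auto simp: dot_square_norm)
  have sep0: "sep (g x) = 0" if "g \<in> \<Gamma>" "g x \<noteq> x" for g
    unfolding sep_def using finite_group that by (intro prod_zero bexI[of _ "g x"]) auto
  define G where "G z = (1 / m) *\<^sub>R (\<Sum>g\<in>\<Gamma>. sep (g z) *\<^sub>R inv g (eqn (g z)))" for z
  have blin: "bounded_linear g" if "g \<in> \<Gamma>" for g
    using linear_group[OF that] by (simp add: linear_linear)
  have poly: "polynomial_function G"
    unfolding G_def
  proof (intro polynomial_function_cmul polynomial_function_sum polynomial_function_mult finite_group)
    fix g assume g: "g \<in> \<Gamma>"
    have gp: "polynomial_function g" "polynomial_function (inv g)"
      using blin g inv_closed polynomial_function_bounded_linear by blast+
    show "polynomial_function (\<lambda>z. sep (g z))"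
      using polynomial_function_compose[OF gp(1), of sep] sep by (simp add: o_def real_polynomial_function_eq)
    show "polynomial_function (\<lambda>z. inv g (eqn (g z)))"
      using polynomial_function_compose[OF polynomial_function_compose[OF gp(1) polynomial_eqn] gp(2)]
      by (simp add: o_def)
  qed
  have G0: "G z = 0" if "z \<in> S" for z
  proof -
    have "inv g (eqn (g z)) = 0" if "g \<in> \<Gamma>" for g
      using eqn_zero[OF inv[OF that \<open>z \<in> S\<close>]] linear_0[OF linear_group[OF inv_closed[OF that]]] by simp
    then show ?thesis by (simp add: G_def)
  qed
  have equi: "G (h z) = h (G z)" if h: "h \<in> \<Gamma>" for h z
  proof -
    have "h (G z) = (1 / m) *\<^sub>R (\<Sum>g\<in>\<Gamma>. sep (g z) *\<^sub>R h (inv g (eqn (g z))))"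
      using linear_group[OF h] by (simp add: G_def linear_cmul linear_sum)
    also have "(\<Sum>g\<in>\<Gamma>. sep (g z) *\<^sub>R h (inv g (eqn (g z))))
        = (\<Sum>g\<in>\<Gamma>. sep ((g \<circ> h) z) *\<^sub>R h (inv (g \<circ> h) (eqn ((g \<circ> h) z))))"
      by (rule sum_translate[OF h, symmetric])
    also have "\<dots> = (\<Sum>g\<in>\<Gamma>. sep (g (h z)) *\<^sub>R inv g (eqn (g (h z))))"
    proof (intro sum.cong refl)
      fix g assume g: "g \<in> \<Gamma>"
      have "inv (g \<circ> h) = inv h \<circ> inv g"
        using g h isometry orthogonal_transformation_bij by (intro o_inv_distrib) auto
      then show "sep ((g \<circ> h) z) *\<^sub>R h (inv (g \<circ> h) (eqn ((g \<circ> h) z)))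
          = sep (g (h z)) *\<^sub>R inv g (eqn (g (h z)))"
        using h by simp
    qed
    finally show ?thesis by (simp add: G_def)
  qed
  have tan: "g v \<in> tangent_space S x" if "g \<in> stab" "v \<in> tangent_space S x" for g v
    using tangent_space_linear_image[OF linear_group, of g S S v x] inv that by (auto simp: stab_def)
  have stab_inv: "inv g \<in> stab" if "g \<in> stab" for g
    using that inv_closed inv_apply(2)[of g x] by (auto simp: stab_def)
  have perp: "t \<bullet> n = 0" if "t \<in> tangent_space S x" "n \<in> N" for t n
    using that P_vanish orthogonal_span_iff[of t] by (auto simp: tangent_space_def inner_commute)
  have diffT: "v - proj v \<in> tangent_space S x" for v
    using linear_proj proj_id[OF proj_in_span] by (simp add: tangent_space_eq linear_diff)
  have conj: "inv g (proj (g v)) = proj v" if g: "g \<in> stab" for g v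
  proof -
    have g': "g \<in> \<Gamma>" using g by (simp add: stab_def)
    define u where "u = proj v"
    have "g (v - u) \<in> tangent_space S x" using diffT tan g by (simp add: u_def)
    then have "proj (g v) = proj (g u)"
      using linear_proj linear_group[OF g'] by (simp add: tangent_space_eq linear_diff)
    also have "\<dots> = g u"
    proof -
      define t where "t = g u - proj (g u)"
      have t: "t \<in> tangent_space S x" by (simp add: t_def diffT)
      have "t \<bullet> t = t \<bullet> g u - t \<bullet> proj (g u)" by (simp add: t_def inner_diff_right)
      also have "\<dots> = t \<bullet> g u" using perp[OF t proj_in_span] by simp
      also have "\<dots> = g (inv g t) \<bullet> g u" using g' by simp
      also have "\<dots> = inv g t \<bullet> u"
        using isometry[OF g'] unfolding orthogonal_transformation_def by blast
      also have "\<dots> = 0"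
        using perp[OF tan[OF stab_inv[OF g] t] proj_in_span] by (simp add: u_def)
      finally show ?thesis by (simp add: t_def)
    qed
    finally show ?thesis using g' by (simp add: u_def)
  qed
  have D: "(G has_derivative proj) (at x)"
  proof -
    have summand: "((\<lambda>z. sep (g z) *\<^sub>R inv g (eqn (g z))) has_derivative
        (\<lambda>v. if g x = x then proj v else 0)) (at x)" if g: "g \<in> \<Gamma>" for g
    proof -
      obtain E where E: "(eqn has_derivative E) (at (g x))"
        using polynomial_eqn differentiable_at_polynomial_function unfolding differentiable_def by blast
      obtain s where s: "(sep has_derivative s) (at (g x))"
        using has_derivative_gradient[OF sep] by blast
      have dg: "(g has_derivative g) (at x)"
        using blin[OF g] by (rule bounded_linear_imp_has_derivative)
      have di: "(inv g has_derivative inv g) (at (eqn (g x)))"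
        using blin[OF inv_closed[OF g]] by (rule bounded_linear_imp_has_derivative)
      have 1: "((\<lambda>z. sep (g z)) has_derivative (\<lambda>v. s (g v))) (at x)"
        using diff_chain_at[OF dg s] by (simp add: o_def)
      have 2: "((\<lambda>z. inv g (eqn (g z))) has_derivative (\<lambda>v. inv g (E (g v)))) (at x)"
        using diff_chain_at[OF diff_chain_at[OF dg E], of "inv g"] di by (simp add: o_def)
      have z: "inv g (eqn (g x)) = 0"
        using eqn_zero inv[OF g x_in] linear_0[OF linear_group[OF inv_closed[OF g]]] by simp
      have "((\<lambda>z. sep (g z) *\<^sub>R inv g (eqn (g z))) has_derivative
          (\<lambda>v. sep (g x) *\<^sub>R inv g (E (g v)))) (at x)"
        using has_derivative_scaleR[OF 1 2] z by simp
      moreover have "(\<lambda>v. sep (g x) *\<^sub>R inv g (E (g v))) = (\<lambda>v. if g x = x then proj v else 0)"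
      proof (cases "g x = x")
        case True
        then have "E = proj" using E has_derivative_eqn has_derivative_unique by metis
        then show ?thesis using True g sep1 conj by (auto simp: stab_def fun_eq_iff)
      qed (use sep0[OF g] in auto)
      ultimately show ?thesis by simp
    qed
    have "(G has_derivative (\<lambda>v. (1 / m) *\<^sub>R (\<Sum>g\<in>\<Gamma>. if g x = x then proj v else 0))) (at x)"
      unfolding G_def by (intro has_derivative_scaleR_right has_derivative_sum summand)
    moreover have "(1 / m) *\<^sub>R (\<Sum>g\<in>\<Gamma>. if g x = x then proj v else 0) = proj v" for v
    proof -
      have "(\<Sum>g\<in>\<Gamma>. if g x = x then proj v else 0) = (\<Sum>g\<in>stab. proj v)"
        unfolding stab_def using finite_group by (simp add: sum.If_cases Int_def)
      also have "\<dots> = m *\<^sub>R proj v" by (simp add: sum_constant_scaleR m_def)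
      finally show ?thesis using m by simp
    qed
    ultimately show ?thesis by simp
  qed
  have "strict_derivative G proj x"
    using poly D by (rule strict_derivative_polynomial_function)
  then obtain \<delta>1 where \<delta>1: "\<delta>1 > 0" "\<And>y z. y \<in> ball x \<delta>1 \<Longrightarrow> z \<in> ball x \<delta>1 \<Longrightarrow>
      norm (G y - G z - proj (y - z)) \<le> 1/8 * norm (y - z)"
    by (rule strict_derivative_ball[where \<epsilon> = "1/8"]) auto
  obtain \<delta>2 where \<delta>2: "\<delta>2 > 0" "\<And>z. z \<in> ball x \<delta>2 \<Longrightarrow> \<exists>s\<in>S \<inter> ball x \<delta>1. z - s \<in> N"
    using local_projection[of "ball x \<delta>1"] \<delta>1(1) by auto
  have "isCont (\<lambda>z. z - G z) x"
    using isCont_polynomial[OF poly] by (intro continuous_intros)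
  then obtain \<delta>3 where \<delta>3: "\<delta>3 > 0" "\<And>z. dist z x < \<delta>3 \<Longrightarrow> dist (z - G z) (x - G x) < \<delta>1"
    using \<delta>1(1) unfolding continuous_at_eps_delta by blast
  have "(G z = 0 \<longrightarrow> z \<in> S) \<and> norm (G (z - G z)) \<le> norm (G z) / 4"
    if "z \<in> ball x (min \<delta>1 (min \<delta>2 \<delta>3))" for z
  proof -
    have z: "z \<in> ball x \<delta>1" "z \<in> ball x \<delta>2" "z - G z \<in> ball x \<delta>1"
      using that \<delta>3(2)[of z] G0[OF x_in] by (auto simp: dist_commute)
    obtain s where s: "s \<in> S" "s \<in> ball x \<delta>1" "z - s \<in> N" using \<delta>2(2)[OF z(2)] by blast
    define r where "r = norm (z - s)"
    have 1: "norm (G z - (z - s)) \<le> r / 8"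
      using \<delta>1(2)[OF z(1) s(2)] G0[OF s(1)] proj_id[OF s(3)] by (simp add: r_def)
    have 2: "norm (z - G z - s) \<le> r / 8"
      using 1 norm_minus_commute[of "G z" "z - s"] by (simp add: algebra_simps)
    have "norm (G (z - G z) - proj (z - G z - s)) \<le> 1/8 * norm (z - G z - s)"
      using \<delta>1(2)[OF z(3) s(2)] G0[OF s(1)] by simp
    then have "norm (G (z - G z)) \<le> 9/8 * norm (z - G z - s)"
      using norm_proj_le[of "z - G z - s"]
        norm_triangle_ineq[of "G (z - G z) - proj (z - G z - s)" "proj (z - G z - s)"] by simp
    then have 3: "norm (G (z - G z)) \<le> 9/64 * r" using 2 by simp
    have "r \<le> norm (G z) + norm (G z - (z - s))"
      using norm_triangle_ineq4[of "G z" "G z - (z - s)"] by (simp add: r_def)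
    then have 4: "7/8 * r \<le> norm (G z)" using 1 by simp
    have "z = s" if "G z = 0" using 4 that by (simp add: r_def)
    moreover have "r \<ge> 0" by (simp add: r_def)
    then have "norm (G (z - G z)) \<le> norm (G z) / 4" using 3 4 by linarith
    ultimately show ?thesis using s(1) by auto
  qed
  moreover have "min \<delta>1 (min \<delta>2 \<delta>3) > 0" using \<delta>1(1) \<delta>2(1) \<delta>3(1) by simp
  ultimately have "tubular S x G" unfolding tubular_def using poly G0 by blast
  then show thesis
    using that[of G proj] equi D tangent_space_eq by blast
qed

end

section \<open>Matrices, unitary matrices and singular value decompositions\<close>

definition real_diag :: "('n \<Rightarrow> 't) \<Rightarrow> real^'n \<Rightarrow> complex^'t^'n" where
  "real_diag \<iota> x = rect_diag \<iota> (complexify x)"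

lemma real_diag_nth: "real_diag \<iota> x $ i $ j = (if j = \<iota> i then complex_of_real (x $ i) else 0)"
  by (simp add: real_diag_def rect_diag_def complexify_def)

lemma svd_matrix_real_diag: "svd_matrix \<iota> U x V = U ** real_diag \<iota> x ** adj V"
  by (simp add: svd_matrix_def real_diag_def)

lemma adj_nth [simp]: "adj A $ i $ j = cnj (A $ j $ i)"
  by (simp add: adj_def)

lemma adj_adj [simp]: "adj (adj A) = A"
  by (simp add: vec_eq_iff)

lemma adj_mat_1 [simp]: "adj (mat 1 :: complex^'n^'n) = mat 1"
  by (simp add: vec_eq_iff mat_def)

lemma adj_mult: "adj (A ** B) = adj B ** adj A"
  by (simp add: vec_eq_iff matrix_matrix_mult_def mult.commute)

lemma linear_adj: "linear adj"
  by (simp add: linear_iff vec_eq_iff)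

lemma matrix_add_mult_distrib: "(A + B) ** C = A ** C + B ** (C :: complex^'k^'m)"
  by (simp add: vec_eq_iff matrix_matrix_mult_def sum.distrib distrib_right)

lemma matrix_mult_scaleR_left: "(c *\<^sub>R A) ** B = c *\<^sub>R (A ** (B :: complex^'k^'m))"
  by (simp add: vec_eq_iff matrix_matrix_mult_def scaleR_sum_right)

lemma matrix_mult_scaleR_right: "A ** (c *\<^sub>R B) = c *\<^sub>R (A ** (B :: complex^'k^'m))"
  by (simp add: vec_eq_iff matrix_matrix_mult_def scaleR_sum_right)

lemma bounded_bilinear_matrix_mult:
  "bounded_bilinear ((**) :: complex^'m^'n \<Rightarrow> complex^'k^'m \<Rightarrow> complex^'k^'n)"
  unfolding bilinear_conv_bounded_bilinear[symmetric] bilinear_def linear_iff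
  by (simp add: matrix_mult_scaleR_left matrix_mult_scaleR_right matrix_add_ldistrib matrix_add_mult_distrib)

lemma inner_matrix: "(A :: complex^'t^'n) \<bullet> B = Re (trace (A ** adj B))"
  by (simp add: inner_vec_def trace_def matrix_matrix_mult_def inner_complex_def)

lemma unitary_iff: "unitary U \<longleftrightarrow> U ** adj U = mat 1"
  using matrix_left_right_inverse[of U "adj U"] by (auto simp: unitary_def)

lemma unitary_adj: "unitary U \<Longrightarrow> unitary (adj U)"
  by (simp add: unitary_def)

lemma unitary_1: "unitary (mat 1)"
  by (simp add: unitary_def)

lemma unitary_mult: assumes "unitary U" "unitary V" shows "unitary (U ** V)"
proof -
  have "U ** V ** adj (U ** V) = U ** (V ** adj V) ** adj U"
    by (simp add: adj_mult matrix_mul_assoc)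
  then show ?thesis using assms by (simp add: unitary_iff)
qed

lemma unitary_cancel:
  assumes "unitary U"
  shows "adj U ** (U ** A) = A" "U ** (adj U ** A) = A" "B ** U ** adj U = B" "B ** adj U ** U = B"
  using assms by (simp_all add: matrix_mul_assoc[symmetric] unitary_def)
     (simp_all add: matrix_mul_assoc unitary_def)

lemma inner_adj: "adj A \<bullet> adj B = A \<bullet> B"
  unfolding inner_vec_def by (subst sum.swap) (simp add: inner_complex_def)

lemma inner_mult_right: "(A ** B) \<bullet> C = A \<bullet> (C ** adj B)"
  unfolding inner_matrix by (simp add: adj_mult matrix_mul_assoc)

lemma inner_mult_left: "(A ** B) \<bullet> C = B \<bullet> (adj A ** C)"
  using inner_mult_right[of "adj B" "adj A" "adj C"] inner_adj[of "A ** B" C] inner_adj[of B "adj A ** C"]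
  by (simp add: adj_mult)

lemma inner_unitary_left: "unitary U \<Longrightarrow> (U ** A) \<bullet> (U ** B) = A \<bullet> B"
  by (simp add: inner_mult_left unitary_cancel)

lemma inner_unitary_right: "unitary V \<Longrightarrow> (A ** adj V) \<bullet> (B ** adj V) = A \<bullet> B"
  by (simp add: inner_mult_right unitary_cancel)

lemma linear_real_diag: "linear (real_diag \<iota>)"
proof -
  have "complex_of_real (c * r) = c *\<^sub>R complex_of_real r" for c r
    by (simp add: scaleR_conv_of_real)
  then show ?thesis by (simp add: linear_iff vec_eq_iff real_diag_nth del: of_real_mult)
qed

lemma inner_real_diag: "real_diag \<iota> x \<bullet> real_diag \<iota> y = x \<bullet> y"
proof -
  have "real_diag \<iota> x $ i $ j \<bullet> real_diag \<iota> y $ i $ j = (if j = \<iota> i then x $ i * y $ i else 0)" for i j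
    by (simp add: real_diag_nth inner_complex_def)
  then show ?thesis by (simp add: inner_vec_def)
qed

lemma inner_svd_matrix:
  assumes "unitary U" "unitary V"
  shows "svd_matrix \<iota> U x V \<bullet> svd_matrix \<iota> U y V = x \<bullet> y"
  using assms
  by (simp add: svd_matrix_real_diag inner_unitary_right inner_unitary_left inner_real_diag)

lemma linear_svd_matrix: "linear (\<lambda>x. svd_matrix \<iota> U x V)"
  using linear_real_diag[of \<iota>]
  by (simp add: linear_iff svd_matrix_real_diag matrix_add_ldistrib matrix_add_mult_distrib
      matrix_mult_scaleR_left matrix_mult_scaleR_right)

lemma norm_svd_matrix:
  assumes "unitary U" "unitary V"
  shows "norm (svd_matrix \<iota> U x V) = norm x"
  using inner_svd_matrix[OF assms, of \<iota> x x] by (simp add: norm_eq_sqrt_inner)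

lemma svd_matrix_inj:
  assumes "unitary U" "unitary V" "svd_matrix \<iota> U x V = svd_matrix \<iota> U y V"
  shows "x = y"
  using norm_svd_matrix[OF assms(1,2), of \<iota> "x - y"] assms(3)
  by (simp add: linear_diff[OF linear_svd_matrix])

lemma svd_matrix_1: "svd_matrix \<iota> (mat 1) x (mat 1) = real_diag \<iota> x"
  by (simp add: svd_matrix_real_diag)

lemma mult_svd_matrix: "A ** svd_matrix \<iota> U x V ** adj B = svd_matrix \<iota> (A ** U) x (B ** V)"
  by (simp add: svd_matrix_real_diag adj_mult matrix_mul_assoc)

text \<open>
  The product \<open>X Y\<^sup>* Z\<close> is compatible with left and right unitary factors, and on diagonal matrices
  it multiplies entries. Below it lifts odd powers to matrices.
\<close>

lemma real_diag_triple:
  assumes "inj \<iota>"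
  shows "real_diag \<iota> x ** adj (real_diag \<iota> y) ** real_diag \<iota> w = real_diag \<iota> (\<chi> i. x $ i * y $ i * w $ i)"
proof -
  have "(real_diag \<iota> x ** adj (real_diag \<iota> y)) $ i $ j = (if i = j then of_real (x $ i * y $ i) else 0)" for i j
    using assms
    by (simp add: matrix_matrix_mult_def real_diag_nth if_distrib[of "\<lambda>u. u * _"] inj_eq cong: if_cong)
  then have "(real_diag \<iota> x ** adj (real_diag \<iota> y) ** real_diag \<iota> w) $ i $ j
      = (if j = \<iota> i then of_real (x $ i * y $ i * w $ i) else 0)" for i j
    by (simp add: matrix_matrix_mult_def[of "real_diag \<iota> x ** adj (real_diag \<iota> y)"] real_diag_nth
        if_distrib[of "\<lambda>u. u * _"] cong: if_cong)
  then show ?thesis by (simp add: vec_eq_iff real_diag_nth)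
qed

section \<open>Signed permutations\<close>

definition sperm :: "('n \<Rightarrow> real) \<Rightarrow> ('n \<Rightarrow> 'n) \<Rightarrow> real^'n \<Rightarrow> real^'n" where
  "sperm s \<pi> x = (\<chi> i. s i * x $ \<pi> i)"

abbreviation signs :: "('n \<Rightarrow> real) set" where
  "signs \<equiv> {s. \<forall>i. s i \<in> {-1, 1}}"

lemma signed_permutations_eq:
  "signed_permutations = {sperm s \<pi> | s \<pi>. bij \<pi> \<and> (\<forall>i. s i \<in> {-1, 1})}"
  unfolding signed_permutations_def sperm_def by blast

lemma finite_signs: "finite (signs :: ('n::finite \<Rightarrow> real) set)"
proof -
  have "{s :: 'n \<Rightarrow> real. \<forall>i. s i \<in> {-1, 1}} = PiE UNIV (\<lambda>_. {-1, 1})"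
    by (auto simp: PiE_def extensional_def)
  then show ?thesis by (simp add: finite_PiE)
qed

lemma sperm_inverse:
  assumes "bij \<pi>" "\<forall>i. s i \<in> {-1, 1::real}"
  shows "sperm s \<pi> (sperm (s \<circ> inv \<pi>) (inv \<pi>) x) = x" "sperm (s \<circ> inv \<pi>) (inv \<pi>) (sperm s \<pi> x) = x"
proof -
  have sq: "s i * (s i * r) = r" for i r using assms(2)[rule_format, of i] by auto
  show "sperm s \<pi> (sperm (s \<circ> inv \<pi>) (inv \<pi>) x) = x" "sperm (s \<circ> inv \<pi>) (inv \<pi>) (sperm s \<pi> x) = x"
    using assms(1)
    by (simp_all add: sperm_def vec_eq_iff sq bij_is_inj bij_is_surj surj_f_inv_f)
qed

lemma isometry_group_signed_permutations:
  "isometry_group (signed_permutations :: (real^'n::finite \<Rightarrow> real^'n) set)"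
proof
  let ?I = "{s :: 'n \<Rightarrow> real. \<forall>i. s i \<in> {-1, 1}} \<times> {\<pi> :: 'n \<Rightarrow> 'n. bij \<pi>}"
  have eq: "(signed_permutations :: (real^'n \<Rightarrow> real^'n) set) = (\<lambda>(s, \<pi>). sperm s \<pi>) ` ?I"
    unfolding signed_permutations_eq by auto
  have "finite ?I" using finite_signs by (intro finite_cartesian_product) auto
  then show "finite (signed_permutations :: (real^'n \<Rightarrow> real^'n) set)"
    unfolding eq by (rule finite_imageI)
  have "id = sperm (\<lambda>_ :: 'n. 1) id" by (rule ext) (simp add: sperm_def vec_eq_iff)
  then show "id \<in> (signed_permutations :: (real^'n \<Rightarrow> real^'n) set)"
    unfolding signed_permutations_eq
    by (intro CollectI exI[of _ "\<lambda>_. 1"] exI[of _ id]) simp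
next
  fix g :: "real^'n \<Rightarrow> real^'n" assume "g \<in> signed_permutations"
  then obtain s \<pi> where g: "g = sperm s \<pi>" "bij \<pi>" "\<forall>i. s i \<in> {-1, 1}"
    unfolding signed_permutations_eq by blast
  have "inv g = sperm (s \<circ> inv \<pi>) (inv \<pi>)"
    unfolding g(1) by (rule inv_equality) (simp_all only: sperm_inverse[OF g(2,3)])
  moreover have "bij (inv \<pi>)" using g(2) bij_imp_bij_inv by blast
  ultimately show "inv g \<in> signed_permutations"
    unfolding signed_permutations_eq using g(3)
    by (intro CollectI exI[of _ "s \<circ> inv \<pi>"] exI[of _ "inv \<pi>"]) auto
  have sq: "s i * s i = 1" for i using g(3)[rule_format, of i] by auto
  have "g v \<bullet> g w = v \<bullet> w" for v w
  proof -
    have "g v \<bullet> g w = (\<Sum>i\<in>UNIV. (s i * s i) * (v $ \<pi> i * w $ \<pi> i))"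
      by (simp add: g(1) sperm_def inner_vec_def algebra_simps)
    also have "\<dots> = (\<Sum>i\<in>UNIV. v $ \<pi> i * w $ \<pi> i)" by (simp add: sq)
    also have "\<dots> = v \<bullet> w"
      unfolding inner_vec_def using sum.reindex_bij_betw[OF g(2), of "\<lambda>i. v $ i * w $ i"] by simp
    finally show ?thesis .
  qed
  moreover have "linear g" by (simp add: g(1) linear_iff sperm_def vec_eq_iff algebra_simps)
  ultimately show "orthogonal_transformation g" by (simp add: orthogonal_transformation_def)
  fix h :: "real^'n \<Rightarrow> real^'n" assume "h \<in> signed_permutations"
  then obtain s' \<pi>' where h: "h = sperm s' \<pi>'" "bij \<pi>'" "\<forall>i. s' i \<in> {-1, 1}"
    unfolding signed_permutations_eq by blast
  have "g \<circ> h = sperm (\<lambda>i. s i * s' (\<pi> i)) (\<pi>' \<circ> \<pi>)"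
    by (simp add: fun_eq_iff g(1) h(1) sperm_def)
  moreover have "bij (\<pi>' \<circ> \<pi>)" using g(2) h(2) bij_comp by blast
  moreover have "s i * s' (\<pi> i) \<in> {-1, 1}" for i
    using g(3)[rule_format, of i] h(3)[rule_format, of "\<pi> i"] by auto
  ultimately show "g \<circ> h \<in> signed_permutations"
    unfolding signed_permutations_eq by blast
qed

interpretation signed_perms: isometry_group "signed_permutations :: (real^'n::finite \<Rightarrow> real^'n) set"
  by (rule isometry_group_signed_permutations)

text \<open>
  Monomial matrices. They realise signed permutations of the singular values as well as the diagonal
  sign matrices.
\<close>

definition mono_matrix :: "('n \<Rightarrow> complex) \<Rightarrow> ('n \<Rightarrow> 'n) \<Rightarrow> complex^'n^'n" where
  "mono_matrix s \<pi> = (\<chi> i j. if j = \<pi> i then s i else 0)"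

lemma mono_matrix_mult: "(mono_matrix s \<pi> ** A) $ i $ j = s i * A $ \<pi> i $ j"
  by (simp add: mono_matrix_def matrix_matrix_mult_def if_distrib[of "\<lambda>u. u * _"] cong: if_cong)

lemma mult_adj_mono_matrix: "(A ** adj (mono_matrix s \<pi>)) $ i $ j = A $ i $ \<pi> j * cnj (s j)"
  by (simp add: mono_matrix_def matrix_matrix_mult_def if_distrib[of "\<lambda>u. _ * u"] if_distrib[of cnj] cong: if_cong)

lemma unitary_mono_matrix:
  assumes "inj \<pi>" "\<And>i. s i * cnj (s i) = 1"
  shows "unitary (mono_matrix s \<pi>)"
  unfolding unitary_iff
  using assms by (auto simp: vec_eq_iff mono_matrix_mult mat_def) (auto simp: mono_matrix_def inj_eq)

text \<open>
  The permutation of the rows is extended along \<open>\<iota>\<close> to the columns and fixes the remaining columns;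
  the signs are put into the left factor.
\<close>

lemma signed_permutation_unitary:
  fixes \<iota> :: "'n::finite \<Rightarrow> 't::finite" and g :: "real^'n \<Rightarrow> real^'n"
  assumes "inj \<iota>" "g \<in> signed_permutations"
  obtains P :: "complex^'n^'n" and Q :: "complex^'t^'t" where "unitary P" "unitary Q"
    "\<And>z. real_diag \<iota> (g z) = svd_matrix \<iota> P z Q"
proof -
  obtain s \<pi> where g: "g = sperm s \<pi>" "bij \<pi>" "\<forall>i. s i \<in> {-1, 1}"
    using assms(2) unfolding signed_permutations_eq by blast
  define \<tau> where "\<tau> a = (if a \<in> range \<iota> then \<iota> (\<pi> (inv \<iota> a)) else a)" for a
  have \<tau>_range: "\<tau> a \<in> range \<iota> \<longleftrightarrow> a \<in> range \<iota>" and \<tau>_id: "a \<notin> range \<iota> \<Longrightarrow> \<tau> a = a" for a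
    by (simp_all add: \<tau>_def)
  have \<tau>\<iota>: "\<tau> (\<iota> i) = \<iota> (\<pi> i)" for i using assms(1) by (simp add: \<tau>_def)
  have "inj \<tau>"
  proof (rule injI)
    fix a b assume ab: "\<tau> a = \<tau> b"
    show "a = b"
    proof (cases "a \<in> range \<iota>")
      case True
      then have "b \<in> range \<iota>" using \<tau>_range ab by metis
      with True obtain i j where "a = \<iota> i" "b = \<iota> j" by blast
      then show ?thesis using ab assms(1) bij_is_inj[OF g(2)] by (simp add: \<tau>\<iota> inj_eq)
    next
      case False
      then have "b \<notin> range \<iota>" using \<tau>_range ab by metis
      then show ?thesis using False \<tau>_id ab by simp
    qed
  qed
  then have "unitary (mono_matrix (\<lambda>_. 1) \<tau>)" by (intro unitary_mono_matrix) auto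
  moreover have "unitary (mono_matrix (\<lambda>i. of_real (s i)) \<pi>)"
  proof (intro unitary_mono_matrix bij_is_inj[OF g(2)])
    show "complex_of_real (s i) * cnj (complex_of_real (s i)) = 1" for i
      using g(3)[rule_format, of i] by auto
  qed
  moreover have "real_diag \<iota> (g z) = svd_matrix \<iota> (mono_matrix (\<lambda>i. of_real (s i)) \<pi>) z (mono_matrix (\<lambda>_. 1) \<tau>)" for z
  proof -
    have "\<tau> j = \<iota> (\<pi> i) \<longleftrightarrow> j = \<iota> i" for i j
      using \<open>inj \<tau>\<close> \<tau>\<iota>[of i] by (metis injD)
    then show ?thesis
      by (simp add: vec_eq_iff svd_matrix_real_diag mult_adj_mono_matrix mono_matrix_mult real_diag_nth g(1) sperm_def)
  qed
  ultimately show thesis using that by blast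
qed

lemma svd_matrix_signed_permutation:
  fixes \<iota> :: "'n::finite \<Rightarrow> 't::finite" and g :: "real^'n \<Rightarrow> real^'n"
  assumes "inj \<iota>" "g \<in> signed_permutations" "unitary U" "unitary V"
  obtains U' V' where "unitary U'" "unitary V'" "\<And>z. svd_matrix \<iota> U (g z) V = svd_matrix \<iota> U' z V'"
proof -
  obtain P :: "complex^'n^'n" and Q :: "complex^'t^'t" where PQ: "unitary P" "unitary Q"
    "\<And>z. real_diag \<iota> (g z) = svd_matrix \<iota> P z Q"
    using signed_permutation_unitary[OF assms(1,2)] by blast
  have "svd_matrix \<iota> U (g z) V = svd_matrix \<iota> (U ** P) z (V ** Q)" for z
    by (simp add: mult_svd_matrix[symmetric] PQ(3)[symmetric]) (simp add: svd_matrix_real_diag)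
  moreover have "unitary (U ** P)" "unitary (V ** Q)" using PQ assms unitary_mult by blast+
  ultimately show thesis using that[of "U ** P" "V ** Q"] by simp
qed

section \<open>Lifting equivariant polynomial maps to matrices\<close>

lemma polynomial_function_bilinear:
  fixes f :: "'a::euclidean_space \<Rightarrow> 'b::euclidean_space" and k :: "'a \<Rightarrow> 'c::euclidean_space"
    and h :: "'b \<Rightarrow> 'c \<Rightarrow> 'd::euclidean_space"
  assumes h: "bounded_bilinear h" and f: "polynomial_function f" and k: "polynomial_function k"
  shows "polynomial_function (\<lambda>x. h (f x) (k x))"
proof -
  interpret h: bounded_bilinear h by fact
  have "h u v = (\<Sum>b\<in>Basis. \<Sum>c\<in>Basis. (u \<bullet> b) *\<^sub>R (v \<bullet> c) *\<^sub>R h b c)" for u v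
  proof -
    have "h u v = h (\<Sum>b\<in>Basis. (u \<bullet> b) *\<^sub>R b) (\<Sum>c\<in>Basis. (v \<bullet> c) *\<^sub>R c)"
      by (simp add: euclidean_representation)
    also have "\<dots> = (\<Sum>c\<in>Basis. \<Sum>b\<in>Basis. (u \<bullet> b) *\<^sub>R (v \<bullet> c) *\<^sub>R h b c)"
      by (simp add: h.sum_left h.sum_right h.scaleR_left h.scaleR_right scaleR_sum_right mult.commute)
    finally show ?thesis by (subst sum.swap)
  qed
  then have "(\<lambda>x. h (f x) (k x)) = (\<lambda>x. \<Sum>b\<in>Basis. \<Sum>c\<in>Basis. (f x \<bullet> b) *\<^sub>R (k x \<bullet> c) *\<^sub>R h b c)"
    by (intro ext)
  moreover have "polynomial_function \<dots>"
    using f k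
    by (intro polynomial_function_sum polynomial_function_mult polynomial_function_inner
        polynomial_function_const finite_Basis)
  ultimately show ?thesis by simp
qed

text \<open>
  A lift is required to be polynomial on all matrices, but is only prescribed through singular value
  decompositions. Since the entries of \<open>z\<close> may be permuted and change sign, only equivariant maps
  \<open>f\<close> can be lifted.
\<close>

definition lifts :: "('n::finite \<Rightarrow> 't::finite) \<Rightarrow> (complex^'t^'n \<Rightarrow> complex^'t^'n) \<Rightarrow>
    (real^'n \<Rightarrow> real^'n) \<Rightarrow> bool" where
  "lifts \<iota> F f \<longleftrightarrow> polynomial_function F \<and>
     (\<forall>U z V. unitary U \<longrightarrow> unitary V \<longrightarrow> F (svd_matrix \<iota> U z V) = svd_matrix \<iota> U (f z) V)"

definition liftable :: "('n::finite \<Rightarrow> 't::finite) \<Rightarrow> (real^'n \<Rightarrow> real^'n) \<Rightarrow> bool" where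
  "liftable \<iota> f \<longleftrightarrow> (\<exists>F. lifts \<iota> F f)"

lemma lifts_svd_matrix:
  "lifts \<iota> F f \<Longrightarrow> unitary U \<Longrightarrow> unitary V \<Longrightarrow> F (svd_matrix \<iota> U z V) = svd_matrix \<iota> U (f z) V"
  unfolding lifts_def by (elim conjE allE impE)

lemma lifts_real_diag: "lifts \<iota> F f \<Longrightarrow> F (real_diag \<iota> z) = real_diag \<iota> (f z)"
  using lifts_svd_matrix[OF _ unitary_1 unitary_1, of \<iota> F f z] by (simp add: svd_matrix_1)

lemma lifts_polynomial: "lifts \<iota> F f \<Longrightarrow> polynomial_function F"
  unfolding lifts_def by (elim conjE)

lemma liftable_id: "liftable \<iota> (\<lambda>z. z)"
  unfolding liftable_def lifts_def by (intro exI[of _ "\<lambda>z. z"]) simp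

lemma liftable_zero: "liftable \<iota> (\<lambda>z. 0)"
  unfolding liftable_def lifts_def
  by (intro exI[of _ "\<lambda>z. 0"]) (simp add: linear_0[OF linear_svd_matrix])

lemma liftable_add:
  assumes "liftable \<iota> f" "liftable \<iota> k"
  shows "liftable \<iota> (\<lambda>z. f z + k z)"
proof -
  obtain F K where "lifts \<iota> F f" "lifts \<iota> K k" using assms by (auto simp: liftable_def)
  then have "lifts \<iota> (\<lambda>Z. F Z + K Z) (\<lambda>z. f z + k z)"
    unfolding lifts_def by (auto intro: polynomial_function_add simp: linear_add[OF linear_svd_matrix])
  then show ?thesis unfolding liftable_def by blast
qed

lemma liftable_scaleR:
  assumes "liftable \<iota> f"
  shows "liftable \<iota> (\<lambda>z. c *\<^sub>R f z)"
proof -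
  obtain F where "lifts \<iota> F f" using assms by (auto simp: liftable_def)
  then have "lifts \<iota> (\<lambda>Z. c *\<^sub>R F Z) (\<lambda>z. c *\<^sub>R f z)"
    unfolding lifts_def by (auto intro: polynomial_function_cmul simp: linear_cmul[OF linear_svd_matrix])
  then show ?thesis unfolding liftable_def by blast
qed

lemma liftable_sum:
  assumes "finite A" "\<And>a. a \<in> A \<Longrightarrow> liftable \<iota> (f a)"
  shows "liftable \<iota> (\<lambda>z. \<Sum>a\<in>A. f a z)"
  using assms by (induction rule: finite_induct) (simp_all add: liftable_zero liftable_add)

lemma liftable_diff:
  assumes "liftable \<iota> f" "liftable \<iota> k"
  shows "liftable \<iota> (\<lambda>z. f z - k z)"
  using liftable_add[OF assms(1) liftable_scaleR[OF assms(2), of "-1"]] by simp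

text \<open>
  Invariant scalars are obtained as inner products of liftable maps, because the inner product of
  matrices is invariant under unitary factors.
\<close>

lemma liftable_inner_scaleR:
  assumes "liftable \<iota> f" "liftable \<iota> k" "liftable \<iota> h"
  shows "liftable \<iota> (\<lambda>z. (f z \<bullet> k z) *\<^sub>R h z)"
proof -
  obtain F K H where *: "lifts \<iota> F f" "lifts \<iota> K k" "lifts \<iota> H h"
    using assms by (auto simp: liftable_def)
  have "polynomial_function (\<lambda>Z. (F Z \<bullet> K Z) *\<^sub>R H Z)"
    using * unfolding lifts_def
    by (intro polynomial_function_mult polynomial_function_bilinear[OF bounded_bilinear_inner]) auto
  then have "lifts \<iota> (\<lambda>Z. (F Z \<bullet> K Z) *\<^sub>R H Z) (\<lambda>z. (f z \<bullet> k z) *\<^sub>R h z)"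
    using * unfolding lifts_def by (simp add: linear_cmul[OF linear_svd_matrix] inner_svd_matrix)
  then show ?thesis unfolding liftable_def by blast
qed

lemma liftable_triple:
  assumes "inj \<iota>" and "liftable \<iota> f" "liftable \<iota> k" "liftable \<iota> h"
  shows "liftable \<iota> (\<lambda>z. \<chi> i. f z $ i * k z $ i * h z $ i)"
proof -
  obtain F K H where *: "lifts \<iota> F f" "lifts \<iota> K k" "lifts \<iota> H h"
    using assms by (auto simp: liftable_def)
  have "polynomial_function (\<lambda>Z. adj (K Z))"
    using polynomial_function_compose[of K adj] * linear_adj polynomial_function_bounded_linear[of adj]
    by (auto simp: lifts_def o_def linear_linear)
  then have "polynomial_function (\<lambda>Z. F Z ** adj (K Z) ** H Z)"
    using * unfolding lifts_def
    by (intro polynomial_function_bilinear[OF bounded_bilinear_matrix_mult]) auto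
  moreover have "svd_matrix \<iota> U x V ** adj (svd_matrix \<iota> U y V) ** svd_matrix \<iota> U w V
      = svd_matrix \<iota> U (\<chi> i. x $ i * y $ i * w $ i) V" if "unitary U" "unitary V" for U V x y w
  proof -
    have "svd_matrix \<iota> U x V ** adj (svd_matrix \<iota> U y V) ** svd_matrix \<iota> U w V
       = U ** real_diag \<iota> x ** (adj V ** V) ** adj (real_diag \<iota> y) ** (adj U ** U) ** real_diag \<iota> w ** adj V"
      by (simp add: svd_matrix_real_diag adj_mult matrix_mul_assoc)
    also have "\<dots> = U ** (real_diag \<iota> x ** adj (real_diag \<iota> y) ** real_diag \<iota> w) ** adj V"
      using that by (simp add: unitary_def matrix_mul_assoc)
    finally show ?thesis by (simp add: real_diag_triple[OF assms(1)] svd_matrix_real_diag)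
  qed
  ultimately have "lifts \<iota> (\<lambda>Z. F Z ** adj (K Z) ** H Z) (\<lambda>z. \<chi> i. f z $ i * k z $ i * h z $ i)"
    using * unfolding lifts_def by simp
  then show ?thesis unfolding liftable_def by blast
qed

lemma liftable_odd_power:
  assumes "inj \<iota>"
  shows "liftable \<iota> (\<lambda>z. \<chi> i. z $ i ^ (2 * a + 1))"
proof (induction a)
  case (Suc a)
  from liftable_triple[OF assms this liftable_id liftable_id] show ?case
    by (simp add: power_add mult.assoc mult.commute)
qed (simp add: liftable_id)

lemma liftable_power_sum:
  fixes \<iota> :: "'n::finite \<Rightarrow> 't::finite"
  assumes "inj \<iota>" "liftable \<iota> f"
  shows "liftable \<iota> (\<lambda>z. (\<Sum>j\<in>UNIV. z $ j ^ (2 * a)) *\<^sub>R f z)"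
proof (cases a)
  case 0
  then show ?thesis using liftable_scaleR[OF assms(2)] by simp
next
  case (Suc b)
  have "(\<chi> i. z $ i ^ (2 * b + 1)) \<bullet> z = (\<Sum>j\<in>UNIV. z $ j ^ (2 * a))" for z :: "real^'n"
    by (simp add: inner_vec_def Suc mult.commute)
  with liftable_inner_scaleR[OF liftable_odd_power[OF assms(1), of b] liftable_id assms(2)]
  show ?thesis by simp
qed

text \<open>
  Symmetrizing a monomial amounts to summing over injective index functions. These sums reduce to
  power sums by induction on the number of indices: the value of a further index \<open>k\<close> may first be
  chosen freely, which splits off a power sum, and the choices that coincide with the value of an
  earlier index \<open>k'\<close> are subtracted; in them the exponent of \<open>k\<close> is added to that of \<open>k'\<close>. The index
  \<open>i\<close> is distinguished, since it selects the component of the vector.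
\<close>

lemma liftable_injective_sum:
  fixes \<iota> :: "'n::finite \<Rightarrow> 't::finite" and K :: "'n set"
  assumes "inj \<iota>" "i \<in> K"
  shows "liftable \<iota> (\<lambda>z. \<Sum>\<pi> \<in> K \<rightarrow>\<^sub>E (UNIV :: 'n set).
      (of_bool (inj_on \<pi> K) * (\<Prod>k\<in>K. z $ \<pi> k ^ (2 * a k)) * z $ \<pi> i) *\<^sub>R axis (\<pi> i) 1)"
proof -
  define E where "E K a z = (\<Sum>\<pi> \<in> K \<rightarrow>\<^sub>E (UNIV :: 'n set).
      (of_bool (inj_on \<pi> K) * (\<Prod>k\<in>K. z $ \<pi> k ^ (2 * a k)) * z $ \<pi> i) *\<^sub>R (axis (\<pi> i) 1 :: real^'n))"
    for K :: "'n set" and a :: "'n \<Rightarrow> nat" and z :: "real^'n"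
  have step: "E (insert k K) a z
      = (\<Sum>j\<in>UNIV. z $ j ^ (2 * a k)) *\<^sub>R E K a z - (\<Sum>k'\<in>K. E K (a(k' := a k' + a k)) z)"
    if K: "finite K" "k \<notin> K" "i \<in> K" for k K a z
  proof -
    define T where "T \<pi> = (of_bool (inj_on \<pi> K) * (\<Prod>k\<in>K. z $ \<pi> k ^ (2 * a k)) * z $ \<pi> i) *\<^sub>R (axis (\<pi> i) 1 :: real^'n)"
      for \<pi> :: "'n \<Rightarrow> 'n"
    have "k \<noteq> i" using K by auto
    have term_insert: "(of_bool (inj_on (\<pi>(k := j)) (insert k K)) *
          (\<Prod>k'\<in>insert k K. z $ (\<pi>(k := j)) k' ^ (2 * a k')) * z $ (\<pi>(k := j)) i) *\<^sub>R
          (axis ((\<pi>(k := j)) i) 1 :: real^'n)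
        = (z $ j ^ (2 * a k) * (1 - (\<Sum>k'\<in>K. of_bool (j = \<pi> k')))) *\<^sub>R T \<pi>" for \<pi> j
    proof -
      have prod: "(\<Prod>k'\<in>insert k K. z $ (\<pi>(k := j)) k' ^ (2 * a k'))
          = z $ j ^ (2 * a k) * (\<Prod>k'\<in>K. z $ \<pi> k' ^ (2 * a k'))"
      proof -
        have "(\<Prod>k'\<in>K. z $ (\<pi>(k := j)) k' ^ (2 * a k')) = (\<Prod>k'\<in>K. z $ \<pi> k' ^ (2 * a k'))"
          using K(2) by (intro prod.cong) auto
        then show ?thesis using K by simp
      qed
      have inj: "inj_on (\<pi>(k := j)) (insert k K) \<longleftrightarrow> inj_on \<pi> K \<and> j \<notin> \<pi> ` K"
      proof -
        have "(\<pi>(k := j)) ` K = \<pi> ` K" "inj_on (\<pi>(k := j)) K = inj_on \<pi> K"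
          using K(2) by (auto simp: image_iff inj_on_def)
        then show ?thesis using K(2) by simp
      qed
      have "of_bool (inj_on (\<pi>(k := j)) (insert k K))
          = of_bool (inj_on \<pi> K) * (1 - (\<Sum>k'\<in>K. of_bool (j = \<pi> k')) :: real)"
      proof (cases "inj_on \<pi> K")
        case True
        have "(\<Sum>k'\<in>K. of_bool (j = \<pi> k') :: real) = (\<Sum>l\<in>\<pi> ` K. of_bool (j = l))"
          by (simp add: sum.reindex[OF True])
        also have "\<dots> = of_bool (j \<in> \<pi> ` K)" using K(1) by (simp add: of_bool_def)
        finally show ?thesis unfolding inj using True by simp
      qed (simp only: inj, simp)
      then show ?thesis using \<open>k \<noteq> i\<close> unfolding prod T_def by simp
    qed
    have "E (insert k K) a z = (\<Sum>(j, \<pi>) \<in> UNIV \<times> (K \<rightarrow>\<^sub>E UNIV).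
        (z $ j ^ (2 * a k) * (1 - (\<Sum>k'\<in>K. of_bool (j = \<pi> k')))) *\<^sub>R T \<pi>)"
      unfolding E_def PiE_insert_eq
      by (subst sum.reindex[OF inj_combinator[OF K(2)]], rule sum.cong[OF refl])
         (simp only: o_def case_prod_unfold term_insert)
    also have "\<dots> = (\<Sum>\<pi> \<in> K \<rightarrow>\<^sub>E UNIV. \<Sum>j\<in>UNIV.
        (z $ j ^ (2 * a k) * (1 - (\<Sum>k'\<in>K. of_bool (j = \<pi> k')))) *\<^sub>R T \<pi>)"
      by (subst sum.swap) (simp add: sum.cartesian_product)
    also have "\<dots> = (\<Sum>\<pi> \<in> K \<rightarrow>\<^sub>E UNIV.
        (\<Sum>j\<in>UNIV. z $ j ^ (2 * a k)) *\<^sub>R T \<pi> - (\<Sum>k'\<in>K. z $ \<pi> k' ^ (2 * a k) *\<^sub>R T \<pi>))"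
    proof (intro sum.cong refl)
      fix \<pi> :: "'n \<Rightarrow> 'n"
      have "(\<Sum>j\<in>UNIV. z $ j ^ (2 * a k) * (\<Sum>k'\<in>K. of_bool (j = \<pi> k'))) = (\<Sum>k'\<in>K. z $ \<pi> k' ^ (2 * a k))"
        unfolding sum_distrib_left by (subst sum.swap) (simp add: of_bool_def if_distrib cong: if_cong)
      then have "(\<Sum>j\<in>UNIV. z $ j ^ (2 * a k) * (1 - (\<Sum>k'\<in>K. of_bool (j = \<pi> k'))))
          = (\<Sum>j\<in>UNIV. z $ j ^ (2 * a k)) - (\<Sum>k'\<in>K. z $ \<pi> k' ^ (2 * a k))"
        by (simp add: right_diff_distrib sum_subtractf)
      then show "(\<Sum>j\<in>UNIV. (z $ j ^ (2 * a k) * (1 - (\<Sum>k'\<in>K. of_bool (j = \<pi> k')))) *\<^sub>R T \<pi>)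
          = (\<Sum>j\<in>UNIV. z $ j ^ (2 * a k)) *\<^sub>R T \<pi> - (\<Sum>k'\<in>K. z $ \<pi> k' ^ (2 * a k) *\<^sub>R T \<pi>)"
        by (simp only: scaleR_left.sum[symmetric] scaleR_left_diff_distrib[symmetric])
    qed
    also have "\<dots> = (\<Sum>j\<in>UNIV. z $ j ^ (2 * a k)) *\<^sub>R E K a z
        - (\<Sum>k'\<in>K. \<Sum>\<pi> \<in> K \<rightarrow>\<^sub>E UNIV. z $ \<pi> k' ^ (2 * a k) *\<^sub>R T \<pi>)"
      by (subst sum.swap) (simp add: sum_subtractf E_def T_def scaleR_sum_right)
    also have "(\<Sum>k'\<in>K. \<Sum>\<pi> \<in> K \<rightarrow>\<^sub>E UNIV. z $ \<pi> k' ^ (2 * a k) *\<^sub>R T \<pi>)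
        = (\<Sum>k'\<in>K. E K (a(k' := a k' + a k)) z)"
      unfolding E_def
    proof (intro sum.cong refl)
      fix k' and \<pi> :: "'n \<Rightarrow> 'n" assume k': "k' \<in> K"
      have "(\<Prod>l\<in>K. z $ \<pi> l ^ (2 * (a(k' := a k' + a k)) l))
          = z $ \<pi> k' ^ (2 * a k) * (\<Prod>l\<in>K. z $ \<pi> l ^ (2 * a l))"
      proof -
        have "(\<Prod>l\<in>K - {k'}. z $ \<pi> l ^ (2 * (a(k' := a k' + a k)) l)) = (\<Prod>l\<in>K - {k'}. z $ \<pi> l ^ (2 * a l))"
          by (intro prod.cong) auto
        then show ?thesis
          using prod.remove[OF K(1) k', of "\<lambda>l. z $ \<pi> l ^ (2 * (a(k' := a k' + a k)) l)"]
            prod.remove[OF K(1) k', of "\<lambda>l. z $ \<pi> l ^ (2 * a l)"]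
          by (simp add: power_add distrib_left)
      qed
      then show "z $ \<pi> k' ^ (2 * a k) *\<^sub>R T \<pi> = (of_bool (inj_on \<pi> K) *
          (\<Prod>l\<in>K. z $ \<pi> l ^ (2 * (a(k' := a k' + a k)) l)) * z $ \<pi> i) *\<^sub>R axis (\<pi> i) 1"
        by (simp only: T_def scaleR_scaleR mult_ac)
    qed
    finally show ?thesis .
  qed
  have base: "E {i} a z = (\<chi> j. z $ j ^ (2 * a i + 1))" for a z
  proof -
    have "E {i} a z = (\<Sum>j\<in>UNIV. (z $ j ^ (2 * a i) * z $ j) *\<^sub>R axis j 1)"
      unfolding E_def
      by (rule sum.reindex_bij_witness[where i = "\<lambda>j. \<lambda>x\<in>{i}. j" and j = "\<lambda>\<pi>. \<pi> i"])
         (auto simp: fun_eq_iff PiE_def extensional_def restrict_def)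
    also have "\<dots> = (\<chi> j. z $ j ^ (2 * a i + 1))"
      by (simp add: vec_eq_iff axis_def if_distrib mult.commute cong: if_cong)
    finally show ?thesis .
  qed
  have "finite L \<Longrightarrow> i \<notin> L \<Longrightarrow> liftable \<iota> (E (insert i L) a)" for L a
  proof (induction L arbitrary: a rule: finite_induct)
    case empty
    then show ?case using liftable_odd_power[OF assms(1), of "a i"] by (simp add: base)
  next
    case (insert k L)
    then have "E (insert i (insert k L)) a = (\<lambda>z. (\<Sum>j\<in>UNIV. z $ j ^ (2 * a k)) *\<^sub>R E (insert i L) a z
        - (\<Sum>k'\<in>insert i L. E (insert i L) (a(k' := a k' + a k)) z))"
      using step[of "insert i L" k a] by (auto simp: insert_commute)
    then show ?case
      using insert by (simp only:) (intro liftable_diff liftable_power_sum assms(1) liftable_sum, auto)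
  qed
  from this[of "K - {i}" a] have "liftable \<iota> (E K a)"
    using assms(2) by (simp add: insert_absorb)
  then show ?thesis unfolding E_def[abs_def] .
qed


inductive monomial_sum :: "(real^'n::finite \<Rightarrow> real) \<Rightarrow> bool" where
  monomial: "monomial_sum (\<lambda>z. c * (\<Prod>k\<in>UNIV. z $ k ^ \<alpha> k))"
| add: "monomial_sum p \<Longrightarrow> monomial_sum q \<Longrightarrow> monomial_sum (\<lambda>z. p z + q z)"

lemma monomial_sum_mult:
  assumes "monomial_sum p" "monomial_sum q"
  shows "monomial_sum (\<lambda>z. p z * q z)"
  using assms
proof (induction p rule: monomial_sum.induct)
  case (monomial c \<alpha>)
  from \<open>monomial_sum q\<close> show ?case
  proof (induction q rule: monomial_sum.induct)
    case (monomial d \<beta>)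
    have "(\<lambda>z :: real^'a. c * (\<Prod>k\<in>UNIV. z $ k ^ \<alpha> k) * (d * (\<Prod>k\<in>UNIV. z $ k ^ \<beta> k)))
        = (\<lambda>z. (c * d) * (\<Prod>k\<in>UNIV. z $ k ^ (\<alpha> k + \<beta> k)))"
      by (simp add: fun_eq_iff power_add prod.distrib)
    then show ?case using monomial_sum.monomial[of "c * d" "\<lambda>k. \<alpha> k + \<beta> k"] by simp
  next
    case (add p q)
    then show ?case using monomial_sum.add[OF add.IH] by (simp add: distrib_left)
  qed
next
  case (add p1 p2)
  from monomial_sum.add[OF add.IH(1) add.IH(2)] add.prems show ?case
    by (simp add: distrib_right)
qed

lemma real_polynomial_function_monomial_sum:
  fixes p :: "real^'n::finite \<Rightarrow> real"
  assumes "real_polynomial_function p"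
  shows "monomial_sum p"
  using assms
proof induction
  case (linear f)
  have coord: "monomial_sum (\<lambda>z :: real^'n. c * z $ j)" for c and j :: 'n
  proof -
    have "(\<Prod>k\<in>UNIV. z $ k ^ (if k = j then 1 else 0)) = z $ j" for z :: "real^'n"
      by (simp add: if_distrib cong: if_cong)
    then show ?thesis using monomial[of c "\<lambda>k. if k = j then 1 else 0"] by simp
  qed
  have zero: "monomial_sum (\<lambda>z :: real^'n. 0)" using monomial[of 0] by simp
  have "monomial_sum (\<lambda>z :: real^'n. \<Sum>j\<in>A. f (axis j 1) * z $ j)" if "finite A" for A :: "'n set"
    using that by (induction rule: finite_induct) (simp_all add: zero monomial_sum.add coord)
  moreover have "f = (\<lambda>z. \<Sum>j\<in>UNIV. f (axis j 1) * z $ j)"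
  proof
    fix z
    have l: "linear f" using linear by (rule bounded_linear.linear)
    have "f z = f (\<Sum>j\<in>UNIV. z $ j *s axis j 1)" by (simp add: basis_expansion)
    also have "\<dots> = (\<Sum>j\<in>UNIV. f (z $ j *\<^sub>R axis j 1))"
      using l by (simp add: linear_sum scalar_mult_eq_scaleR)
    finally show "f z = (\<Sum>j\<in>UNIV. f (axis j 1) * z $ j)" using l by (simp add: linear_cmul mult.commute)
  qed
  ultimately show ?case by (metis finite)
next
  case (const c)
  show ?case using monomial[of c "\<lambda>_. 0"] by simp
qed (simp_all add: monomial_sum.add monomial_sum_mult)

lemma prod_power_of_bool:
  fixes x :: "'n::finite \<Rightarrow> real"
  shows "(\<Prod>k\<in>UNIV. x k ^ (a k + of_bool (k = i))) = (\<Prod>k\<in>UNIV. x k ^ a k) * x i"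
proof -
  have "x k ^ of_bool (k = i) = (if k = i then x i else 1)" for k by simp
  then show ?thesis by (simp add: power_add prod.distrib)
qed

text \<open>
  Changing the sign of the coordinate \<open>k0\<close> is an involution on the summands that reverses their sign.
\<close>

lemma sum_sign_flip:
  fixes i k0 :: "'n::finite"
  assumes "odd (\<alpha> k0 + of_bool (k0 = i))"
  shows "(\<Sum>s\<in>signs. s i * (\<Prod>k\<in>UNIV. s k ^ \<alpha> k)) = (0::real)"
proof -
  define \<beta> where "\<beta> k = \<alpha> k + of_bool (k = i)" for k
  define f where "f s = (\<Prod>k\<in>UNIV. s k ^ \<beta> k)" for s :: "'n \<Rightarrow> real"
  have f: "s i * (\<Prod>k\<in>UNIV. s k ^ \<alpha> k) = f s" for s :: "'n \<Rightarrow> real"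
    unfolding f_def \<beta>_def prod_power_of_bool by (rule mult.commute)
  have flip: "f (s(k0 := - s k0)) = - f s" for s
  proof -
    have "(\<Prod>k\<in>UNIV - {k0}. (s(k0 := - s k0)) k ^ \<beta> k) = (\<Prod>k\<in>UNIV - {k0}. s k ^ \<beta> k)"
      by (intro prod.cong) auto
    moreover have "(- s k0) ^ \<beta> k0 = - (s k0 ^ \<beta> k0)" using assms by (simp add: \<beta>_def)
    ultimately show ?thesis
      using prod.remove[of UNIV k0 "\<lambda>k. (s(k0 := - s k0)) k ^ \<beta> k"]
        prod.remove[of UNIV k0 "\<lambda>k. s k ^ \<beta> k"] by (simp add: f_def)
  qed
  have "(\<Sum>s\<in>signs. f s) = (\<Sum>s\<in>signs. f (s(k0 := - s k0)))"
    by (rule sum.reindex_bij_witness[where i = "\<lambda>s. s(k0 := - s k0)" and j = "\<lambda>s. s(k0 := - s k0)"])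
       (auto simp: fun_eq_iff)
  then have "(\<Sum>s\<in>signs. f s) = - (\<Sum>s\<in>signs. f s)" by (simp add: flip sum_negf)
  then show ?thesis by (simp add: f)
qed

text \<open>
  For a monomial, the sum over signs is zero unless the exponent of \<open>i\<close> is odd and the others are even.
  In this case the remaining sum over permutations is the one treated in \<open>liftable_injective_sum\<close>.
\<close>

lemma liftable_symmetrization:
  fixes \<iota> :: "'n::finite \<Rightarrow> 't::finite" and p :: "real^'n \<Rightarrow> real"
  assumes "inj \<iota>" "monomial_sum p"
  shows "liftable \<iota> (\<lambda>z. \<Sum>s\<in>signs. \<Sum>\<pi> | bij \<pi>. (s i * p (sperm s \<pi> z)) *\<^sub>R axis (\<pi> i) 1)"
  using assms(2)
proof induction
  case (monomial c \<alpha>)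
  define A where "A z = (\<Sum>\<pi> | bij \<pi>. (\<Prod>k\<in>UNIV. z $ \<pi> k ^ \<alpha> k) *\<^sub>R (axis (\<pi> i) 1 :: real^'n))" for z :: "real^'n"
  define \<sigma> where "\<sigma> = (\<Sum>s\<in>signs. s i * (\<Prod>k\<in>UNIV. s k ^ \<alpha> k))"
  have "(\<Sum>s\<in>signs. \<Sum>\<pi> | bij \<pi>. (s i * (c * (\<Prod>k\<in>UNIV. sperm s \<pi> z $ k ^ \<alpha> k))) *\<^sub>R axis (\<pi> i) 1)
      = (c * \<sigma>) *\<^sub>R A z" for z
  proof -
    have "(\<Sum>\<pi> | bij \<pi>. (s i * (c * (\<Prod>k\<in>UNIV. sperm s \<pi> z $ k ^ \<alpha> k))) *\<^sub>R axis (\<pi> i) 1)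
        = (c * (s i * (\<Prod>k\<in>UNIV. s k ^ \<alpha> k))) *\<^sub>R A z" for s
      unfolding A_def scaleR_sum_right
      by (intro sum.cong refl) (simp add: sperm_def power_mult_distrib prod.distrib mult_ac)
    then show ?thesis by (simp add: \<sigma>_def sum_distrib_left scaleR_left.sum)
  qed
  moreover have "liftable \<iota> (\<lambda>z. (c * \<sigma>) *\<^sub>R A z)"
  proof (cases "\<exists>k0. odd (\<alpha> k0 + of_bool (k0 = i))")
    case True
    then have "\<sigma> = 0" unfolding \<sigma>_def using sum_sign_flip by blast
    then show ?thesis by (simp add: liftable_zero)
  next
    case False
    define a where "a k = \<alpha> k div 2" for k
    have \<alpha>: "\<alpha> k = 2 * a k + of_bool (k = i)" for k
    proof -
      have "even (\<alpha> k + of_bool (k = i))" using False by blast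
      then show ?thesis unfolding a_def by (cases "k = i") auto
    qed
    have prod: "(\<Prod>k\<in>UNIV. z $ \<pi> k ^ \<alpha> k) = (\<Prod>k\<in>UNIV. z $ \<pi> k ^ (2 * a k)) * z $ \<pi> i"
      for z :: "real^'n" and \<pi>
      unfolding \<alpha> by (rule prod_power_of_bool)
    have "A z = (\<Sum>\<pi> \<in> UNIV \<rightarrow>\<^sub>E UNIV.
        (of_bool (inj_on \<pi> UNIV) * (\<Prod>k\<in>UNIV. z $ \<pi> k ^ (2 * a k)) * z $ \<pi> i) *\<^sub>R axis (\<pi> i) 1)" for z
    proof -
      have "bij \<pi> \<longleftrightarrow> inj \<pi>" for \<pi> :: "'n \<Rightarrow> 'n"
        using finite_UNIV_inj_surj[of \<pi>] by (auto simp: bij_def)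
      then show ?thesis unfolding A_def prod
        by (intro sum.mono_neutral_cong_left) auto
    qed
    then show ?thesis
      using liftable_scaleR[OF liftable_injective_sum[OF assms(1) UNIV_I[of i], of a]] by simp
  qed
  ultimately show ?case by simp
next
  case (add p q)
  from liftable_add[OF add.IH] show ?case
    by (simp add: distrib_left scaleR_add_left sum.distrib)
qed

lemma card_member_nonzero: "finite A \<Longrightarrow> a \<in> A \<Longrightarrow> card A \<noteq> 0"
  by auto

text \<open>
  An equivariant map equals its own average over the group, and this average is a sum of
  symmetrizations of its coordinate functions.
\<close>

theorem liftable_equivariant:
  fixes \<iota> :: "'n::finite \<Rightarrow> 't::finite" and f :: "real^'n \<Rightarrow> real^'n"
  assumes "inj \<iota>" and poly: "polynomial_function f"
    and equi: "\<And>g z. g \<in> signed_permutations \<Longrightarrow> f (g z) = g (f z)"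
  shows "liftable \<iota> f"
proof -
  define m where "m = real (card (signs :: ('n \<Rightarrow> real) set)) * real (card {\<pi> :: 'n \<Rightarrow> 'n. bij \<pi>})"
  have "(\<lambda>_. 1) \<in> (signs :: ('n \<Rightarrow> real) set)" by simp
  then have "card (signs :: ('n \<Rightarrow> real) set) \<noteq> 0"
    by (rule card_member_nonzero[OF finite_signs])
  moreover have "id \<in> {\<pi> :: 'n \<Rightarrow> 'n. bij \<pi>}" by simp
  then have "card {\<pi> :: 'n \<Rightarrow> 'n. bij \<pi>} \<noteq> 0"
    by (rule card_member_nonzero[OF finite])
  ultimately have m: "m \<noteq> 0" unfolding m_def by simp
  define B where "B i z = (\<Sum>s\<in>signs. \<Sum>\<pi> | bij \<pi>. (s i * f (sperm s \<pi> z) $ i) *\<^sub>R (axis (\<pi> i) 1 :: real^'n))" for i z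
  have "real_polynomial_function (\<lambda>z. f z $ i)" for i
  proof -
    have "(\<lambda>z. f z $ i) = (\<lambda>z. f z \<bullet> axis i 1)" by (simp add: inner_axis)
    then show ?thesis using polynomial_function_inner[OF poly, of "axis i 1"] by (simp add: real_polynomial_function_eq)
  qed
  then have "liftable \<iota> (B i)" for i
    unfolding B_def[abs_def]
    by (intro liftable_symmetrization[OF assms(1)] real_polynomial_function_monomial_sum)
  then have "liftable \<iota> (\<lambda>z. (1 / m) *\<^sub>R (\<Sum>i\<in>UNIV. B i z))"
    by (intro liftable_scaleR liftable_sum) auto
  moreover have "(\<Sum>i\<in>UNIV. B i z) = m *\<^sub>R f z" for z
  proof -
    have "(\<Sum>i\<in>UNIV. (s i * f (sperm s \<pi> z) $ i) *\<^sub>R (axis (\<pi> i) 1 :: real^'n)) = f z"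
      if s: "s \<in> signs" and \<pi>: "bij \<pi>" for s :: "'n \<Rightarrow> real" and \<pi>
    proof -
      have "sperm s \<pi> \<in> signed_permutations" unfolding signed_permutations_eq using s \<pi> by blast
      then have "f (sperm s \<pi> z) = sperm s \<pi> (f z)" by (rule equi)
      then have "s i * f (sperm s \<pi> z) $ i = f z $ \<pi> i" for i
      proof -
        have "s i = -1 \<or> s i = 1" using s by blast
        then show ?thesis using \<open>f (sperm s \<pi> z) = sperm s \<pi> (f z)\<close> by (auto simp: sperm_def)
      qed
      then have "(\<Sum>i\<in>UNIV. (s i * f (sperm s \<pi> z) $ i) *\<^sub>R (axis (\<pi> i) 1 :: real^'n))
          = (\<Sum>i\<in>UNIV. (f z $ \<pi> i) *\<^sub>R axis (\<pi> i) 1)" by simp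
      also have "\<dots> = (\<Sum>i\<in>UNIV. (f z $ i) *\<^sub>R axis i 1)"
        using sum.reindex_bij_betw[OF \<pi>, of "\<lambda>i. (f z $ i) *\<^sub>R (axis i 1 :: real^'n)"] by simp
      also have "\<dots> = f z" using basis_expansion[of "f z"] by (simp add: scalar_mult_eq_scaleR)
      finally show ?thesis .
    qed
    then have "(\<Sum>s\<in>signs. \<Sum>\<pi> | bij \<pi>. \<Sum>i\<in>UNIV. (s i * f (sperm s \<pi> z) $ i) *\<^sub>R (axis (\<pi> i) 1 :: real^'n))
        = (\<Sum>s\<in>(signs :: ('n \<Rightarrow> real) set). \<Sum>\<pi> | bij (\<pi> :: 'n \<Rightarrow> 'n). f z)"
      by (intro sum.cong refl) simp
    also have "\<dots> = m *\<^sub>R f z" unfolding m_def sum_constant_scaleR by (simp only: scaleR_scaleR)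
    moreover have "(\<Sum>i\<in>UNIV. B i z) = (\<Sum>s\<in>signs. \<Sum>\<pi> | bij \<pi>. \<Sum>i\<in>UNIV. (s i * f (sperm s \<pi> z) $ i) *\<^sub>R axis (\<pi> i) 1)"
      unfolding B_def by (subst sum.swap, rule sum.cong[OF refl], subst sum.swap) simp
    ultimately show ?thesis by simp
  qed
  ultimately show ?thesis using m by simp
qed

section \<open>Hermitian matrices and existence of singular value decompositions\<close>

definition sform :: "complex^'n^'n \<Rightarrow> complex^'n \<Rightarrow> complex^'n \<Rightarrow> complex" where
  "sform A u w = (\<Sum>i\<in>UNIV. \<Sum>j\<in>UNIV. cnj (u $ i) * A $ i $ j * w $ j)"

lemma sform_add: "sform A (u + v) w = sform A u w + sform A v w" "sform A u (w + v) = sform A u w + sform A u v"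
  by (simp_all add: sform_def distrib_left distrib_right sum.distrib)

lemma sform_axis: "sform A (axis i a) (axis j b) = cnj a * A $ i $ j * b"
proof -
  have "sform A (axis i a) (axis j b)
      = (\<Sum>k\<in>UNIV. if k = i then \<Sum>l\<in>UNIV. if l = j then cnj a * A $ i $ j * b else 0 else 0)"
    unfolding sform_def by (intro sum.cong refl) (simp add: axis_def if_distrib[of "\<lambda>u. _ * u"] cong: if_cong)
  then show ?thesis by simp
qed

lemma sform_scaleR: "sform A (r *\<^sub>R u) (r *\<^sub>R w) = of_real (r\<^sup>2) * sform A u w"
  by (simp add: sform_def sum_distrib_left scaleR_conv_of_real[where 'a = complex] power2_eq_square mult_ac)

text \<open>
  Polarization, with the vectors \<open>e\<^sub>i\<close>, \<open>e\<^sub>i + e\<^sub>j\<close> and \<open>e\<^sub>i + \<i> e\<^sub>j\<close>.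
\<close>

lemma hermitian_if_real_form:
  fixes A :: "complex^'n^'n"
  assumes unit: "\<And>w. norm w = 1 \<Longrightarrow> Im (sform A w w) = 0"
  shows "adj A = A"
proof -
  have real: "Im (sform A w w) = 0" for w
  proof (cases "w = 0")
    case False
    have "Im (sform A ((1 / norm w) *\<^sub>R w) ((1 / norm w) *\<^sub>R w)) = 0"
      using False by (intro unit) simp
    then show ?thesis using False by (simp add: sform_scaleR)
  qed (simp add: sform_def)
  have "cnj (A $ j $ i) = A $ i $ j" for i j
  proof -
    have diag: "Im (A $ i $ i) = 0" for i using real[of "axis i 1"] by (simp add: sform_axis)
    have "Im (A $ i $ j + A $ j $ i) = 0"
      using real[of "axis i 1 + axis j 1"] by (simp add: sform_add sform_axis diag)
    moreover have "Re (A $ i $ j - A $ j $ i) = 0"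
      using real[of "axis i 1 + axis j \<i>"] by (simp add: sform_add sform_axis diag)
    ultimately show ?thesis by (simp add: complex_eq_iff)
  qed
  then show ?thesis by (simp add: vec_eq_iff)
qed

text \<open>
  The multiple \<open>c w w\<^sup>*\<close> of the projection to the line of \<open>w\<close>.
\<close>

definition souter :: "complex \<Rightarrow> complex^'n \<Rightarrow> complex^'n^'n" where
  "souter c w = (\<chi> i j. c * w $ i * cnj (w $ j))"

lemma inner_souter: "souter c w \<bullet> A = Re (c * cnj (sform A w w))"
proof -
  have "souter c w \<bullet> A = (\<Sum>i\<in>UNIV. \<Sum>j\<in>UNIV. Re (c * cnj (cnj (w $ i) * A $ i $ j * w $ j)))"
    by (simp add: inner_vec_def souter_def inner_complex_def algebra_simps)
  also have "\<dots> = Re (c * cnj (sform A w w))"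
    by (simp only: sform_def sum_distrib_left cnj_sum Re_sum)
  finally show ?thesis .
qed

text \<open>
  For a unit vector \<open>w\<close> and \<open>\<bar>\<omega>\<bar> = 1\<close> this is the unitary map that multiplies \<open>w\<close> by \<open>\<omega>\<close> and fixes
  its orthogonal complement. These maps replace general one-parameter groups of unitary matrices:
  they suffice to test Hermitian symmetry.
\<close>

definition phase_shift :: "complex \<Rightarrow> complex^'n \<Rightarrow> complex^'n^'n" where
  "phase_shift \<omega> w = mat 1 + souter (\<omega> - 1) w"

lemma unitary_phase_shift:
  assumes "cmod \<omega> = 1" "norm w = 1"
  shows "unitary (phase_shift \<omega> w)"
proof -
  have unit: "(\<Sum>k\<in>UNIV. cnj (w $ k) * w $ k) = 1"
  proof -
    have "(\<Sum>k\<in>UNIV. cnj (w $ k) * w $ k) = of_real (\<Sum>k\<in>UNIV. (cmod (w $ k))\<^sup>2)"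
      by (simp add: complex_norm_square mult.commute del: of_real_power)
    also have "(\<Sum>k\<in>UNIV. (cmod (w $ k))\<^sup>2) = (norm w)\<^sup>2"
      by (simp add: norm_vec_def L2_set_def sum_nonneg)
    finally show ?thesis using assms by simp
  qed
  have mult: "souter c w ** souter d w = souter (c * d) w" for c d
  proof -
    have "(souter c w ** souter d w) $ i $ j = souter (c * d) w $ i $ j" for i j
    proof -
      have "(souter c w ** souter d w) $ i $ j
          = (\<Sum>k\<in>UNIV. (c * d * w $ i * cnj (w $ j)) * (cnj (w $ k) * w $ k))"
        unfolding souter_def matrix_matrix_mult_def by (simp add: mult_ac)
      also have "\<dots> = (c * d * w $ i * cnj (w $ j)) * (\<Sum>k\<in>UNIV. cnj (w $ k) * w $ k)"
        by (simp only: sum_distrib_left)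
      also have "\<dots> = souter (c * d) w $ i $ j"
        unfolding unit by (simp add: souter_def)
      finally show ?thesis .
    qed
    then show ?thesis by (simp add: vec_eq_iff)
  qed
  have adj: "adj (phase_shift \<omega> w) = mat 1 + souter (cnj \<omega> - 1) w"
    by (simp add: phase_shift_def vec_eq_iff souter_def mat_def mult_ac)
  have add: "souter c w + souter d w = souter (c + d) w" for c d
    by (simp add: vec_eq_iff souter_def distrib_right)
  have "phase_shift \<omega> w ** adj (phase_shift \<omega> w)
      = mat 1 + souter ((\<omega> - 1) + (cnj \<omega> - 1) + (\<omega> - 1) * (cnj \<omega> - 1)) w"
  proof -
    have "phase_shift \<omega> w ** adj (phase_shift \<omega> w) = mat 1 +
        (souter (\<omega> - 1) w + souter (cnj \<omega> - 1) w + souter ((\<omega> - 1) * (cnj \<omega> - 1)) w)"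
      unfolding adj by (simp add: phase_shift_def matrix_add_ldistrib matrix_add_mult_distrib mult add_ac)
    then show ?thesis by (simp only: add)
  qed
  also have "(\<omega> - 1) + (cnj \<omega> - 1) + (\<omega> - 1) * (cnj \<omega> - 1) = \<omega> * cnj \<omega> - 1"
    by (simp add: algebra_simps)
  also have "\<omega> * cnj \<omega> = 1" using complex_norm_square[of \<omega>] assms(1) by simp
  finally show ?thesis by (simp add: unitary_iff souter_def vec_eq_iff)
qed

lemma inner_phase_shift:
  "(phase_shift \<omega> w ** X) \<bullet> Y = X \<bullet> Y + Re ((\<omega> - 1) * cnj (sform (Y ** adj X) w w))"
  by (simp add: phase_shift_def matrix_add_mult_distrib inner_add_left inner_mult_right inner_souter)

lemma phase_curve:
  "((\<lambda>t. phase_shift (cis t) w) has_vector_derivative souter \<i> w) (at 0)"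
proof -
  have eq: "phase_shift (cis t) w = mat 1 + (cos t - 1) *\<^sub>R souter 1 w + sin t *\<^sub>R souter \<i> w" for t
    by (simp add: phase_shift_def vec_eq_iff souter_def complex_eq_iff algebra_simps)
  show ?thesis unfolding eq
    by (auto intro!: derivative_eq_intros simp: has_vector_derivative_def)
qed

text \<open>
  Testing maximality on phase shifts shows that the form \<open>a\<close> of \<open>Y X\<^sup>*\<close> at a unit vector satisfies
  \<open>Re (\<omega> a\<^sup>*) \<le> Re a\<close> for all \<open>\<omega>\<close> of modulus one; the choice \<open>\<omega> = sgn a\<close> shows that \<open>a\<close> is real.
\<close>

lemma hermitian_if_maximal:
  assumes "\<And>H. unitary H \<Longrightarrow> (H ** X) \<bullet> Y \<le> X \<bullet> Y"
  shows "adj (Y ** adj X) = Y ** adj X"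
proof (rule hermitian_if_real_form)
  fix w :: "complex^'a" assume w: "norm w = 1"
  define a where "a = sform (Y ** adj X) w w"
  have le: "Re (\<omega> * cnj a) \<le> Re a" if "cmod \<omega> = 1" for \<omega>
    using assms[OF unitary_phase_shift[OF that w]]
    by (simp add: inner_phase_shift a_def[symmetric] algebra_simps)
  show "Im (sform (Y ** adj X) w w) = 0"
  proof (cases "a = 0")
    case False
    have "cmod (sgn a) = 1" using False by (simp add: norm_sgn)
    then have "Re (sgn a * cnj a) \<le> Re a" by (rule le)
    moreover have "sgn a * cnj a = of_real (cmod a)"
    proof -
      have "a * cnj a = of_real (cmod a) * of_real (cmod a)"
        using complex_norm_square[of a] by (simp add: power2_eq_square)
      then show ?thesis using False by (simp add: sgn_eq)
    qed
    ultimately have "cmod a \<le> Re a" by simp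
    then have "(cmod a)\<^sup>2 \<le> (Re a)\<^sup>2" by (intro power_mono) auto
    then have "(Im a)\<^sup>2 \<le> 0" by (simp add: cmod_power2)
    then show ?thesis by (simp add: a_def)
  qed (simp add: a_def[symmetric])
qed

definition regular :: "real^'n \<Rightarrow> bool" where
  "regular y \<longleftrightarrow> (\<forall>i. y $ i \<noteq> 0) \<and> (\<forall>i j. i \<noteq> j \<longrightarrow> (y $ i)\<^sup>2 \<noteq> (y $ j)\<^sup>2)"

lemma regularD:
  assumes "regular y"
  shows "y $ i \<noteq> 0" and "i \<noteq> j \<Longrightarrow> (y $ i)\<^sup>2 \<noteq> (y $ j)\<^sup>2"
  using assms unfolding regular_def by (rule conjE, simp only: not_False_eq_True)+

text \<open>
  The two Hermitian conditions relate the entries \<open>(i, j)\<close> and \<open>(j, i)\<close> of \<open>X\<close> by factors \<open>y\<^sub>j / y\<^sub>i\<close>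
  and \<open>y\<^sub>i / y\<^sub>j\<close> respectively, which are different for \<open>i \<noteq> j\<close>. The statement is used twice: for
  critical points on \<open>M\<close>, and for the existence of singular value decompositions.
\<close>

lemma real_diag_if_hermitian:
  fixes \<iota> :: "'n::finite \<Rightarrow> 't::finite" and X :: "complex^'t^'n"
  assumes "inj \<iota>" "regular y"
    and left: "adj (X ** adj (real_diag \<iota> y)) = X ** adj (real_diag \<iota> y)"
    and right: "adj (adj X ** real_diag \<iota> y) = adj X ** real_diag \<iota> y"
  obtains x where "X = real_diag \<iota> x"
proof -
  have l: "(X ** adj (real_diag \<iota> y)) $ i $ j = X $ i $ \<iota> j * of_real (y $ j)" for i j
  proof -
    have "(X ** adj (real_diag \<iota> y)) $ i $ j = (\<Sum>k\<in>UNIV. X $ i $ k * cnj (real_diag \<iota> y $ j $ k))"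
      by (simp add: matrix_matrix_mult_def)
    also have "\<dots> = (\<Sum>k\<in>UNIV. if k = \<iota> j then X $ i $ \<iota> j * of_real (y $ j) else 0)"
      by (intro sum.cong refl) (simp add: real_diag_nth)
    finally show ?thesis by simp
  qed
  have r: "(adj X ** real_diag \<iota> y) $ a $ b = (\<Sum>k\<in>UNIV. if b = \<iota> k then cnj (X $ k $ a) * of_real (y $ k) else 0)" for a b
  proof -
    have "(adj X ** real_diag \<iota> y) $ a $ b = (\<Sum>k\<in>UNIV. cnj (X $ k $ a) * real_diag \<iota> y $ k $ b)"
      by (simp add: matrix_matrix_mult_def)
    also have "\<dots> = (\<Sum>k\<in>UNIV. if b = \<iota> k then cnj (X $ k $ a) * of_real (y $ k) else 0)"
      by (intro sum.cong refl) (simp add: real_diag_nth)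
    finally show ?thesis .
  qed
  have r1: "(adj X ** real_diag \<iota> y) $ a $ \<iota> j = cnj (X $ j $ a) * of_real (y $ j)" for a j
    unfolding r using assms(1) by (simp add: inj_eq)
  have r0: "(adj X ** real_diag \<iota> y) $ a $ b = 0" if "b \<notin> range \<iota>" for a b
    unfolding r using that by (intro sum.neutral) auto
  have y: "y $ i \<noteq> 0" for i using assms(2) by (simp add: regular_def)
  have L: "X $ i $ \<iota> j * of_real (y $ j) = cnj (X $ j $ \<iota> i) * of_real (y $ i)" for i j
    using arg_cong[OF left, of "\<lambda>A. A $ i $ j"] by (simp add: l)
  have R: "cnj (X $ j $ \<iota> i) * of_real (y $ j) = X $ i $ \<iota> j * of_real (y $ i)" for i j
    using arg_cong[OF right, of "\<lambda>A. A $ \<iota> i $ \<iota> j"] by (simp add: r1)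
  have out: "X $ j $ a = 0" if "a \<notin> range \<iota>" for j a
  proof -
    have "cnj (X $ j $ a) * of_real (y $ j) = 0"
      using arg_cong[OF right, of "\<lambda>A. A $ a $ \<iota> j"] by (simp add: r1 r0[OF that])
    then show ?thesis using y[of j] by simp
  qed
  have off: "X $ i $ \<iota> j = 0" if "i \<noteq> j" for i j
  proof -
    have "X $ i $ \<iota> j * of_real (y $ j) * of_real (y $ j) = X $ i $ \<iota> j * of_real (y $ i) * of_real (y $ i)"
    proof -
      have "X $ i $ \<iota> j * of_real (y $ j) * of_real (y $ j)
          = cnj (X $ j $ \<iota> i) * of_real (y $ j) * of_real (y $ i)"
        unfolding L[of i j] by (simp only: mult_ac)
      then show ?thesis unfolding R[of j i] by simp
    qed
    then have "X $ i $ \<iota> j * of_real ((y $ j)\<^sup>2 - (y $ i)\<^sup>2) = 0"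
      by (simp add: power2_eq_square algebra_simps)
    moreover have "(y $ j)\<^sup>2 \<noteq> (y $ i)\<^sup>2" using regularD(2)[OF assms(2), of j i] that by simp
    ultimately show ?thesis by (metis eq_iff_diff_eq_0 mult_eq_0_iff of_real_eq_0_iff)
  qed
  have diag: "X $ i $ \<iota> i = of_real (Re (X $ i $ \<iota> i))" for i
    using L[of i i] y[of i] by (simp add: complex_eq_iff)
  have "X = real_diag \<iota> (\<chi> i. Re (X $ i $ \<iota> i))"
  proof -
    have entry: "X $ i $ a = real_diag \<iota> (\<chi> i. Re (X $ i $ \<iota> i)) $ i $ a" for i a
    proof (cases "a \<in> range \<iota>")
      case True
      then obtain j where "a = \<iota> j" by blast
      then show ?thesis using off[of i j] diag[of i] assms(1) by (cases "i = j") (auto simp: real_diag_nth inj_eq)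
    next
      case False
      then have "a \<noteq> \<iota> i" by blast
      then show ?thesis using out[OF False] by (simp add: real_diag_nth)
    qed
    show ?thesis unfolding vec_eq_iff by (intro allI entry)
  qed
  then show thesis by (rule that)
qed

lemma regular_exists: "\<exists>c :: real^'n::finite. regular c"
proof -
  obtain h :: "'n \<Rightarrow> nat" where h: "inj h"
    using finite_imp_inj_to_nat_seg[of "UNIV :: 'n set"] by auto
  have "(real (Suc (h i)))\<^sup>2 \<noteq> (real (Suc (h j)))\<^sup>2" if "i \<noteq> j" for i j
  proof -
    have "h i \<noteq> h j" using h that by (simp add: inj_eq)
    then show ?thesis by (metis Suc_inject of_nat_eq_iff power2_eq_iff_nonneg of_nat_0_le_iff)
  qed
  then have "regular (\<chi> i. real (Suc (h i)))" by (auto simp: regular_def)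
  then show ?thesis by blast
qed

lemma compact_unitary: "compact {U :: complex^'n^'n. unitary U}"
proof -
  have "norm U \<le> sqrt (real CARD('n))" if "unitary U" for U :: "complex^'n^'n"
  proof -
    have "U \<bullet> U = (mat 1 :: complex^'n^'n) \<bullet> mat 1"
      using inner_unitary_left[OF that, of "mat 1" "mat 1"] by simp
    also have "\<dots> = real CARD('n)"
      unfolding inner_matrix adj_mat_1 matrix_mul_lid by (simp add: trace_def mat_def)
    finally show ?thesis by (simp add: norm_eq_sqrt_inner)
  qed
  then have "bounded {U :: complex^'n^'n. unitary U}" unfolding bounded_iff by blast
  moreover have "closed {U :: complex^'n^'n. unitary U}"
    unfolding unitary_iff
  proof (rule closed_Collect_eq)
    have "continuous_on UNIV (adj :: complex^'n^'n \<Rightarrow> _)"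
      using linear_adj linear_linear linear_continuous_on by blast
    then show "continuous_on UNIV (\<lambda>U :: complex^'n^'n. U ** adj U)"
      using bounded_bilinear.continuous_on[OF bounded_bilinear_matrix_mult continuous_on_id] by blast
  qed simp
  ultimately show ?thesis by (simp add: compact_eq_bounded_closed)
qed

text \<open>
  By compactness there are unitary \<open>U\<close> and \<open>V\<close> for which \<open>U D V\<^sup>*\<close> has maximal inner product with
  \<open>Z\<close>, where \<open>D\<close> is a fixed diagonal matrix with distinct nonzero squares on its diagonal. Maximality
  makes \<open>B D\<^sup>*\<close> and \<open>B\<^sup>* D\<close> Hermitian for \<open>B = U\<^sup>* Z V\<close>, and so \<open>B\<close> is real and diagonal.
\<close>

theorem svd_exists:
  fixes \<iota> :: "'n::finite \<Rightarrow> 't::finite" and Z :: "complex^'t^'n"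
  assumes "inj \<iota>"
  obtains U z V where "unitary U" "unitary V" "Z = svd_matrix \<iota> U z V"
proof -
  obtain c :: "real^'n" where c: "regular c" using regular_exists by blast
  let ?C = "{U :: complex^'n^'n. unitary U} \<times> {V :: complex^'t^'t. unitary V}"
  let ?f = "\<lambda>w. svd_matrix \<iota> (fst w) c (snd w) \<bullet> Z"
  have cC: "compact ?C" by (intro compact_Times compact_unitary)
  have neC: "?C \<noteq> {}"
    by (rule notI, drule equals0D[of _ "(mat 1, mat 1)"]) (simp add: unitary_1)
  have "continuous_on UNIV (adj :: complex^'t^'t \<Rightarrow> _)"
    using linear_adj linear_linear linear_continuous_on by blast
  then have "continuous_on ?C (\<lambda>w. adj (snd w))"
    by (rule continuous_on_compose2[OF _ continuous_on_snd[OF continuous_on_id]]) simp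
  then have cf: "continuous_on ?C ?f"
    unfolding svd_matrix_real_diag
    by (intro continuous_on_inner bounded_bilinear.continuous_on[OF bounded_bilinear_matrix_mult]
        continuous_on_fst continuous_on_id continuous_on_const)
  obtain w where w: "w \<in> ?C" "\<forall>w'\<in>?C. ?f w' \<le> ?f w"
    using continuous_attains_sup[OF cC neC cf] by (rule bexE)
  define U V where "U = fst w" and "V = snd w"
  have UV: "unitary U" "unitary V" using w(1) by (auto simp: U_def V_def)
  have max: "svd_matrix \<iota> U' c V' \<bullet> Z \<le> svd_matrix \<iota> U c V \<bullet> Z" if "unitary U'" "unitary V'" for U' V'
    using bspec[OF w(2), of "(U', V')"] that by (simp add: U_def V_def)
  define D B where "D = (real_diag \<iota> c :: complex^'t^'n)" and "B = adj U ** Z ** V"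
  have move: "svd_matrix \<iota> (U ** H) c (V ** K) \<bullet> Z = (H ** D ** adj K) \<bullet> B" for H K
  proof -
    have "svd_matrix \<iota> (U ** H) c (V ** K) = U ** (H ** D ** adj K) ** adj V"
      by (simp add: svd_matrix_real_diag D_def adj_mult matrix_mul_assoc)
    then show ?thesis
      using inner_mult_right[of "U ** (H ** D ** adj K)" "adj V" Z] inner_mult_left[of U "H ** D ** adj K" "Z ** V"]
      by (simp only: adj_adj B_def matrix_mul_assoc)
  qed
  have max': "(H ** D ** adj K) \<bullet> B \<le> D \<bullet> B" if "unitary H" "unitary K" for H K
    using max[OF unitary_mult[OF UV(1) that(1)] unitary_mult[OF UV(2) that(2)]]
      move[of H K] move[of "mat 1" "mat 1"] by simp
  have left: "adj (B ** adj D) = B ** adj D"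
    by (rule hermitian_if_maximal) (use max'[OF _ unitary_1] in simp)
  have right: "adj (adj B ** adj (adj D)) = adj B ** adj (adj D)"
  proof (rule hermitian_if_maximal)
    fix H :: "complex^'t^'t" assume "unitary H"
    from max'[OF unitary_1 this] have "adj (D ** adj H) \<bullet> adj B \<le> adj D \<bullet> adj B"
      by (simp add: inner_adj)
    then show "(H ** adj D) \<bullet> adj B \<le> adj D \<bullet> adj B" by (simp add: adj_mult)
  qed
  obtain z where z: "B = real_diag \<iota> z"
    using real_diag_if_hermitian[OF assms c left[unfolded D_def]] right unfolding D_def by auto
  have "Z = U ** B ** adj V"
    using UV by (simp add: B_def matrix_mul_assoc unitary_cancel)
       (simp add: unitary_def)
  then have "Z = svd_matrix \<iota> U z V" by (simp add: z svd_matrix_real_diag)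
  then show thesis by (rule that[OF UV])
qed

section \<open>Uniqueness and stability of singular values\<close>

text \<open>
  Up to the factor \<open>z\<close>, which makes the map equivariant rather than invariant, this is an invariant
  polynomial that vanishes exactly on the orbit of \<open>x\<close>. Its lift recognises the matrices with singular
  values \<open>x\<close>. At \<open>z = 0\<close> the factor vanishes too, and the proofs below treat this case by comparing
  norms.
\<close>

definition orbit_map :: "real^'n::finite \<Rightarrow> real^'n \<Rightarrow> real^'n" where
  "orbit_map x z = (\<Prod>g\<in>signed_permutations. (norm (z - g x))\<^sup>2) *\<^sub>R z"

lemma orbit_map_self: "orbit_map x x = 0"
proof -
  have "(\<Prod>g\<in>signed_permutations. (norm (x - g x))\<^sup>2) = 0"
    using signed_perms.finite_group signed_perms.id_closed
    by (intro prod_zero bexI[of _ id]) simp_all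
  then show ?thesis by (simp add: orbit_map_def)
qed

lemma liftable_orbit_map:
  fixes \<iota> :: "'n::finite \<Rightarrow> 't::finite"
  assumes "inj \<iota>"
  shows "liftable \<iota> (orbit_map x)"
proof (rule liftable_equivariant[OF assms])
  have "real_polynomial_function (\<lambda>z. (norm (z - g x))\<^sup>2)" for g :: "real^'n \<Rightarrow> real^'n"
  proof -
    have "polynomial_function (\<lambda>z. z - g x)"
      by (intro polynomial_function_diff polynomial_function_id polynomial_function_const)
    then show ?thesis
      using polynomial_function_bilinear[OF bounded_bilinear_inner, of "\<lambda>z. z - g x" "\<lambda>z. z - g x"]
      by (simp add: power2_norm_eq_inner real_polynomial_function_eq)
  qed
  then have "real_polynomial_function (\<lambda>z. \<Prod>g\<in>signed_permutations. (norm (z - g x))\<^sup>2)"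
    by (intro real_polynomial_function_prod signed_perms.finite_group)
  then show "polynomial_function (orbit_map x)"
    unfolding orbit_map_def[abs_def] real_polynomial_function_eq
    by (intro polynomial_function_mult polynomial_function_id)
next
  fix h :: "real^'n \<Rightarrow> real^'n" and z assume h: "h \<in> signed_permutations"
  have "(\<Prod>g\<in>signed_permutations. (norm (h z - g x))\<^sup>2) = (\<Prod>g\<in>signed_permutations. (norm (z - g x))\<^sup>2)"
  proof (rule prod.reindex_bij_witness[where i = "\<lambda>g. h \<circ> g" and j = "\<lambda>g. inv h \<circ> g"])
    fix g :: "real^'n \<Rightarrow> real^'n" assume g: "g \<in> signed_permutations"
    show "h \<circ> (inv h \<circ> g) = g" "inv h \<circ> (h \<circ> g) = g" using h by (simp_all add: fun_eq_iff)
    show "inv h \<circ> g \<in> signed_permutations" "h \<circ> g \<in> signed_permutations"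
      using g h signed_perms.comp_closed signed_perms.inv_closed by blast+
    have "norm (h z - g x) = norm (h (z - (inv h \<circ> g) x))"
      using h linear_diff[OF signed_perms.linear_group[OF h]] by simp
    also have "\<dots> = norm (z - (inv h \<circ> g) x)"
      using orthogonal_transformation_norm[OF signed_perms.isometry[OF h]] .
    finally show "(norm (z - (inv h \<circ> g) x))\<^sup>2 = (norm (h z - g x))\<^sup>2" by simp
  qed
  then show "orbit_map x (h z) = h (orbit_map x z)"
    using signed_perms.linear_group[OF h] by (simp add: orbit_map_def linear_cmul)
qed

lemma svd_matrix_eq_real_diag:
  fixes \<iota> :: "'n::finite \<Rightarrow> 't::finite"
  assumes "inj \<iota>" "unitary U" "unitary V" "svd_matrix \<iota> U z V = real_diag \<iota> x"
  shows "\<exists>g\<in>signed_permutations. z = g x"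
proof -
  obtain F where F: "lifts \<iota> F (orbit_map x)"
    using liftable_orbit_map[OF assms(1)] unfolding liftable_def by blast
  have "F (svd_matrix \<iota> U z V) = svd_matrix \<iota> U (orbit_map x z) V"
    using F assms(2,3) by (rule lifts_svd_matrix)
  moreover have "F (real_diag \<iota> x) = real_diag \<iota> (orbit_map x x)"
    using F by (rule lifts_real_diag)
  ultimately have "svd_matrix \<iota> U (orbit_map x z) V = 0"
    using assms(4) by (simp add: orbit_map_self linear_0[OF linear_real_diag])
  then have "norm (orbit_map x z) = 0"
    using norm_svd_matrix[OF assms(2,3), of \<iota> "orbit_map x z"] by simp
  then consider "z = 0" | g where "g \<in> signed_permutations" "z = g x"
    using prod_zero_iff[OF signed_perms.finite_group, of "\<lambda>g. (norm (z - g x))\<^sup>2"]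
    by (auto simp: orbit_map_def)
  then show ?thesis
  proof cases
    case 1
    have "norm x = norm z"
      using norm_svd_matrix[OF assms(2,3), of \<iota> z] norm_svd_matrix[OF unitary_1 unitary_1, of \<iota> x] assms(4)
      by (simp add: svd_matrix_1)
    then have "z = id x" using 1 by simp
    then show ?thesis using signed_perms.id_closed by blast
  qed blast
qed

text \<open>
  The lift of \<open>orbit_map x\<close> is continuous and vanishes at \<open>diag x\<close>, so that the singular values \<open>z\<close> of a
  nearby matrix make \<open>orbit_map x z\<close> small. Hence \<open>z\<close> is close to a point of the orbit of \<open>x\<close>, and a
  signed permutation brings it close to \<open>x\<close>.
\<close>

lemma svd_near_real_diag:
  fixes \<iota> :: "'n::finite \<Rightarrow> 't::finite"
  assumes "inj \<iota>" "\<epsilon> > 0"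
  obtains \<delta> where "\<delta> > 0" "\<And>Z. dist Z (real_diag \<iota> x) < \<delta> \<Longrightarrow>
      \<exists>U z V. unitary U \<and> unitary V \<and> Z = svd_matrix \<iota> U z V \<and> dist z x < \<epsilon>"
proof -
  obtain F where F: "lifts \<iota> F (orbit_map x)"
    using liftable_orbit_map[OF assms(1)] unfolding liftable_def by blast
  note poly = lifts_polynomial[OF F] and F_svd = lifts_svd_matrix[OF F]
  let ?X = "real_diag \<iota> x :: complex^'t^'n"
  have FX: "F ?X = 0"
    by (simp add: lifts_real_diag[OF F] orbit_map_self linear_0[OF linear_real_diag])
  define m where "m = card (signed_permutations :: (real^'n \<Rightarrow> real^'n) set)"
  \<comment> \<open>a lower bound for \<open>norm (orbit_map x z)\<close> when \<open>z\<close> has norm at least half that of \<open>x\<close>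
    and distance at least \<open>\<epsilon>\<close> from the orbit\<close>
  define \<eta> where "\<eta> = (\<epsilon>\<^sup>2) ^ m * (norm x / 2)"
  have orbit: "\<exists>g\<in>signed_permutations. dist z (g x) < \<epsilon>"
    if "x = 0 \<Longrightarrow> norm z < \<epsilon>" "x \<noteq> 0 \<Longrightarrow> norm z > norm x / 2 \<and> norm (orbit_map x z) < \<eta>" for z
  proof (cases "x = 0")
    case True
    then show ?thesis using that(1) signed_perms.id_closed by (intro bexI[of _ id]) auto
  next
    case False
    show ?thesis
    proof (rule ccontr)
      assume "\<not> ?thesis"
      then have far: "\<epsilon> \<le> norm (z - g x)" if "g \<in> signed_permutations" for g
        using that by (auto simp: dist_norm not_less)
      have "(\<epsilon>\<^sup>2) ^ m = (\<Prod>g\<in>(signed_permutations :: (real^'n \<Rightarrow> real^'n) set). \<epsilon>\<^sup>2)"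
        by (simp add: m_def)
      also have "\<dots> \<le> (\<Prod>g\<in>signed_permutations. (norm (z - g x))\<^sup>2)"
        using far assms(2) by (intro prod_mono conjI power_mono) auto
      finally have "(\<epsilon>\<^sup>2) ^ m * (norm x / 2) \<le> (\<Prod>g\<in>signed_permutations. (norm (z - g x))\<^sup>2) * norm z"
        using that(2)[OF False] by (intro mult_mono prod_nonneg) auto
      also have "\<dots> = norm (orbit_map x z)" by (simp add: orbit_map_def abs_of_nonneg prod_nonneg)
      finally show False using that(2)[OF False] by (simp add: \<eta>_def)
    qed
  qed
  have "\<exists>\<delta>>0. \<forall>Z. dist Z ?X < \<delta> \<longrightarrow>
      (x = 0 \<longrightarrow> norm Z < \<epsilon>) \<and> (x \<noteq> 0 \<longrightarrow> norm Z > norm x / 2 \<and> norm (F Z) < \<eta>)"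
  proof (cases "x = 0")
    case True
    then show ?thesis
      using assms(2) by (intro exI[of _ \<epsilon>]) (simp add: linear_0[OF linear_real_diag])
  next
    case False
    then have "\<eta> > 0" using assms(2) by (simp add: \<eta>_def)
    then obtain d where d: "d > 0" "\<And>Z. dist Z ?X < d \<Longrightarrow> dist (F Z) (F ?X) < \<eta>"
      using isCont_polynomial[OF poly, of ?X] unfolding continuous_at_eps_delta by blast
    have nX: "norm ?X = norm x"
      using norm_svd_matrix[OF unitary_1 unitary_1, of \<iota> x] by (simp add: svd_matrix_1)
    show ?thesis
    proof (intro exI[of _ "min d (norm x / 2)"] conjI allI impI)
      fix Z assume Z: "dist Z ?X < min d (norm x / 2)"
      have "norm ?X - norm Z \<le> dist Z ?X"
        using norm_triangle_ineq2[of ?X Z] by (simp add: dist_norm norm_minus_commute)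
      then show "norm x / 2 < norm Z" using Z nX by simp
      show "norm (F Z) < \<eta>" using d(2)[of Z] Z FX by simp
    qed (use d(1) False in auto)
  qed
  then obtain \<delta> where \<delta>: "\<delta> > 0" "\<And>Z. dist Z ?X < \<delta> \<Longrightarrow> x = 0 \<Longrightarrow> norm Z < \<epsilon>"
    "\<And>Z. dist Z ?X < \<delta> \<Longrightarrow> x \<noteq> 0 \<Longrightarrow> norm Z > norm x / 2 \<and> norm (F Z) < \<eta>" by blast
  show thesis
  proof (rule that[OF \<delta>(1)])
    fix Z assume Z: "dist Z ?X < \<delta>"
    obtain U z V where svd: "unitary U" "unitary V" "Z = svd_matrix \<iota> U z V"
      using svd_exists[OF assms(1)] by metis
    have "norm Z = norm z" "norm (F Z) = norm (orbit_map x z)"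
      using svd by (simp_all add: F_svd norm_svd_matrix)
    then obtain g where g: "g \<in> signed_permutations" "dist z (g x) < \<epsilon>"
      using orbit[of z] \<delta>(2,3)[OF Z] by auto
    obtain U' V' where UV: "unitary U'" "unitary V'" "\<And>z. svd_matrix \<iota> U (g z) V = svd_matrix \<iota> U' z V'"
      using svd_matrix_signed_permutation[OF assms(1) g(1) svd(1,2)] by metis
    have "Z = svd_matrix \<iota> U' (inv g z) V'" using svd(3) UV(3)[of "inv g z"] g(1) by simp
    moreover have "dist (inv g z) x < \<epsilon>"
    proof -
      have "norm (inv g z - x) = norm (g (inv g z - x))"
        using orthogonal_transformation_norm[OF signed_perms.isometry[OF g(1)]] by metis
      also have "\<dots> = norm (z - g x)"
        using g(1) linear_diff[OF signed_perms.linear_group[OF g(1)]] by simp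
      finally show ?thesis using g(2) by (simp add: dist_norm)
    qed
    ultimately show "\<exists>U z V. unitary U \<and> unitary V \<and> Z = svd_matrix \<iota> U z V \<and> dist z x < \<epsilon>"
      using UV(1,2) by blast
  qed
qed

section \<open>Matrices with distinct nonzero singular values\<close>

text \<open>
  On the line through \<open>b\<close> and a point \<open>a\<close> with \<open>p a \<noteq> 0\<close> the polynomial has finitely many zeros.
\<close>

lemma real_polynomial_nonzero_dense:
  fixes p :: "'a::euclidean_space \<Rightarrow> real"
  assumes p: "real_polynomial_function p" "p a \<noteq> 0" and W: "open W" "b \<in> W"
  obtains z where "z \<in> W" "p z \<noteq> 0"
proof -
  define l where "l t = b + t *\<^sub>R (a - b)" for t :: real
  have "polynomial_function l"
    unfolding l_def[abs_def]
    by (intro polynomial_function_add polynomial_function_const polynomial_function_mult)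
       (simp add: real_polynomial_function_eq[symmetric] real_polynomial_function.intros(1) bounded_linear_ident)
  then have "real_polynomial_function (p \<circ> l)" using p(1) by (rule real_polynomial_function_compose)
  then obtain c n where cn: "p \<circ> l = (\<lambda>t. \<Sum>i\<le>n. c i * t ^ i)"
    using real_polynomial_function_imp_sum by blast
  have "(p \<circ> l) 1 \<noteq> 0" using p(2) by (simp add: l_def)
  then have "\<exists>i\<le>n. c i \<noteq> 0" unfolding cn by (metis (no_types, lifting) atMost_iff mult_zero_left sum.neutral)
  then have fin: "finite {t. (p \<circ> l) t = 0}"
    unfolding cn by (subst polyfun_finite_roots)
  have "isCont l 0" unfolding l_def[abs_def] by (intro continuous_intros)
  moreover have "l 0 = b" by (simp add: l_def)
  ultimately have "eventually (\<lambda>t. l t \<in> W) (at 0)"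
    using W by (auto simp: isCont_def dest: topological_tendstoD)
  moreover have "eventually (\<lambda>t. (p \<circ> l) t \<noteq> 0) (at 0)"
    using islimpt_finite[OF fin, of 0] by (simp add: islimpt_iff_eventually)
  ultimately have "eventually (\<lambda>t. l t \<in> W \<and> (p \<circ> l) t \<noteq> 0) (at 0)" by (rule eventually_conj)
  then obtain t where "l t \<in> W" "(p \<circ> l) t \<noteq> 0"
    using eventually_happens trivial_limit_at by blast
  then show thesis by (intro that[of "l t"]) simp_all
qed

definition disc :: "real^'n::finite \<Rightarrow> real" where
  "disc z = (\<Prod>i\<in>UNIV. (z $ i)\<^sup>2) * (\<Prod>i\<in>UNIV. \<Prod>j\<in>UNIV. if i = j then 1 else (z $ i)\<^sup>2 - (z $ j)\<^sup>2)"

lemma disc_nonzero_iff: "disc z \<noteq> 0 \<longleftrightarrow> regular z"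
  unfolding disc_def regular_def by (auto simp: prod_zero_iff)

lemma disc_sperm:
  assumes "bij \<pi>" "\<forall>i. s i \<in> {-1, 1}"
  shows "disc (sperm s \<pi> z) = disc z"
proof -
  have sq: "(sperm s \<pi> z $ i)\<^sup>2 = (z $ \<pi> i)\<^sup>2" for i
  proof -
    have "(s i)\<^sup>2 = 1" using spec[OF assms(2), of i] by auto
    then show ?thesis by (simp add: sperm_def power_mult_distrib)
  qed
  define h where "h i j = (if i = j then 1 else (z $ i)\<^sup>2 - (z $ j)\<^sup>2)" for i j
  have "(if i = j then 1 else (z $ \<pi> i)\<^sup>2 - (z $ \<pi> j)\<^sup>2) = h (\<pi> i) (\<pi> j)" for i j
    using bij_is_inj[OF assms(1)] by (simp add: h_def inj_eq)
  then have "disc (sperm s \<pi> z) = (\<Prod>i\<in>UNIV. (z $ \<pi> i)\<^sup>2) * (\<Prod>i\<in>UNIV. \<Prod>j\<in>UNIV. h (\<pi> i) (\<pi> j))"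
    by (simp only: disc_def sq)
  also have "(\<Prod>i\<in>UNIV. \<Prod>j\<in>UNIV. h (\<pi> i) (\<pi> j)) = (\<Prod>i\<in>UNIV. \<Prod>j\<in>UNIV. h i j)"
    unfolding prod.reindex_bij_betw[OF assms(1), of "h _"] by (rule prod.reindex_bij_betw[OF assms(1)])
  also have "(\<Prod>i\<in>UNIV. (z $ \<pi> i)\<^sup>2) = (\<Prod>i\<in>UNIV. (z $ i)\<^sup>2)"
    by (rule prod.reindex_bij_betw[OF assms(1)])
  finally show ?thesis by (simp add: disc_def h_def)
qed

lemma real_polynomial_disc: "real_polynomial_function disc"
proof -
  have c: "real_polynomial_function (\<lambda>z :: real^'n. (z $ i)\<^sup>2)" for i
    by (intro real_polynomial_function_power real_polynomial_function.intros(1) bounded_linear_vec_nth)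
  have "real_polynomial_function (\<lambda>z :: real^'n. if i = j then 1 else (z $ i)\<^sup>2 - (z $ j)\<^sup>2)" for i j
    by (cases "i = j") (simp_all add: c real_polynomial_function.intros(2) real_polynomial_function_diff)
  then show ?thesis
    unfolding disc_def[abs_def]
    by (intro real_polynomial_function.intros(4) real_polynomial_function_prod c finite)
qed

lemma open_disc_nonzero: "open {z :: real^'n::finite. disc z \<noteq> 0}"
  using real_polynomial_disc continuous_real_polymonial_function
  by (intro open_Collect_neq continuous_at_imp_continuous_on continuous_on_const) auto

text \<open>
  Lifting \<open>disc z\<close> times \<open>z\<close> and pairing with the argument gives \<open>disc z\<close> times \<open>z \<bullet> z\<close>, and
  \<open>z = 0\<close> is not regular.
\<close>

lemma generic_polynomial:
  fixes \<iota> :: "'n::finite \<Rightarrow> 't::finite"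
  assumes "inj \<iota>"
  obtains p :: "complex^'t^'n \<Rightarrow> real" where "real_polynomial_function p"
    "\<And>U z V. unitary U \<Longrightarrow> unitary V \<Longrightarrow> p (svd_matrix \<iota> U z V) \<noteq> 0 \<longleftrightarrow> regular z"
proof -
  have "liftable \<iota> (\<lambda>z. disc z *\<^sub>R z)"
  proof (rule liftable_equivariant[OF assms])
    show "polynomial_function (\<lambda>z. disc z *\<^sub>R z)"
      using real_polynomial_disc unfolding real_polynomial_function_eq
      by (intro polynomial_function_mult polynomial_function_id)
    fix g :: "real^'n \<Rightarrow> real^'n" and z assume g: "g \<in> signed_permutations"
    then have "disc (g z) = disc z" unfolding signed_permutations_eq using disc_sperm by blast
    then show "disc (g z) *\<^sub>R g z = g (disc z *\<^sub>R z)"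
      using signed_perms.linear_group[OF g] by (simp add: linear_cmul)
  qed
  then obtain F where F: "lifts \<iota> F (\<lambda>z. disc z *\<^sub>R z)" unfolding liftable_def by blast
  show thesis
  proof
    show "real_polynomial_function (\<lambda>Z. F Z \<bullet> Z)"
      unfolding real_polynomial_function_eq
      using lifts_polynomial[OF F]
      by (intro polynomial_function_bilinear[OF bounded_bilinear_inner] polynomial_function_id)
    fix U :: "complex^'n^'n" and z and V :: "complex^'t^'t" assume UV: "unitary U" "unitary V"
    have "F (svd_matrix \<iota> U z V) \<bullet> svd_matrix \<iota> U z V = disc z * (z \<bullet> z)"
      using UV by (simp add: lifts_svd_matrix[OF F] inner_svd_matrix)
    moreover have "z \<noteq> 0" if "regular z"
      using regularD(1)[OF that] by (metis zero_index)
    ultimately show "F (svd_matrix \<iota> U z V) \<bullet> svd_matrix \<iota> U z V \<noteq> 0 \<longleftrightarrow> regular z"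
      using disc_nonzero_iff[of z] by auto
  qed
qed

section \<open>Transport of critical points along isometries\<close>

lemma tubular_map_exists:
  assumes "x \<in> smooth_points S"
  obtains G where "tubular S x G"
proof -
  have trivial: "isometry_group {id :: 'a \<Rightarrow> 'a}"
    by unfold_locales (auto simp: orthogonal_transformation_def linear_id)
  show thesis
  proof (rule isometry_group.equivariant_tubular_map[OF trivial assms])
    show "g z \<in> S" if "g \<in> {id}" "z \<in> S" for g :: "'a \<Rightarrow> 'a" and z using that by simp
    fix G assume "tubular S x G"
    then show thesis by (rule that)
  qed
qed

text \<open>
  In terms of tubular maps, smoothness is transported by conjugating with the isometry.
\<close>

lemma smooth_points_isometry:
  assumes \<gamma>: "orthogonal_transformation \<gamma>" "\<And>z. \<gamma> z \<in> S \<longleftrightarrow> z \<in> S" and x: "x \<in> smooth_points S"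
  shows "\<gamma> x \<in> smooth_points S"
proof -
  have mem: "\<gamma> x \<in> S" using \<gamma>(2) x by (simp add: smooth_points_def)
  obtain G where G: "tubular S x G" using tubular_map_exists[OF x] .
  obtain \<delta> where \<delta>: "\<delta> > 0" "\<And>z. z \<in> ball x \<delta> \<Longrightarrow> G z = 0 \<Longrightarrow> z \<in> S"
    "\<And>z. z \<in> ball x \<delta> \<Longrightarrow> norm (G (z - G z)) \<le> norm (G z) / 4"
    using G unfolding tubular_def by blast
  have bij: "bij \<gamma>" using \<gamma>(1) by (rule orthogonal_transformation_bij)
  have inv: "orthogonal_transformation (inv \<gamma>)" using \<gamma>(1) by (rule orthogonal_transformation_inv)
  have [simp]: "inv \<gamma> (\<gamma> z) = z" "\<gamma> (inv \<gamma> z) = z" for z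
    using bij by (simp_all add: bij_is_inj bij_is_surj surj_f_inv_f)
  have lin: "linear \<gamma>" "linear (inv \<gamma>)" using \<gamma>(1) inv orthogonal_transformation_linear by blast+
  have norm: "norm (\<gamma> v) = norm v" "norm (inv \<gamma> v) = norm v" for v
    using orthogonal_transformation_norm \<gamma>(1) inv by blast+
  have "tubular S (\<gamma> x) (\<gamma> \<circ> G \<circ> inv \<gamma>)"
    unfolding tubular_def
  proof (intro conjI exI[of _ \<delta>] ballI impI)
    have "polynomial_function \<gamma>" "polynomial_function (inv \<gamma>)"
      using lin by (simp_all add: polynomial_function_bounded_linear linear_linear)
    then show "polynomial_function (\<gamma> \<circ> G \<circ> inv \<gamma>)"
      using G unfolding tubular_def by (intro polynomial_function_compose) auto
    show "(\<gamma> \<circ> G \<circ> inv \<gamma>) z = 0" if "z \<in> S" for z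
    proof -
      have "inv \<gamma> z \<in> S" using \<gamma>(2)[of "inv \<gamma> z"] that by simp
      then show ?thesis using G linear_0[OF lin(1)] unfolding tubular_def by simp
    qed
    show "\<delta> > 0" by fact
    fix z assume "z \<in> ball (\<gamma> x) \<delta>"
    then have z: "inv \<gamma> z \<in> ball x \<delta>"
      using norm(2)[of "\<gamma> x - z"] by (simp add: dist_norm linear_diff[OF lin(2)])
    show "z \<in> S" if "(\<gamma> \<circ> G \<circ> inv \<gamma>) z = 0"
    proof -
      have "norm (G (inv \<gamma> z)) = 0" using that norm(1)[of "G (inv \<gamma> z)"] by simp
      then have "inv \<gamma> z \<in> S" using \<delta>(2)[OF z] by simp
      then show ?thesis using \<gamma>(2)[of "inv \<gamma> z"] by simp
    qed
    show "norm ((\<gamma> \<circ> G \<circ> inv \<gamma>) (z - (\<gamma> \<circ> G \<circ> inv \<gamma>) z)) \<le> norm ((\<gamma> \<circ> G \<circ> inv \<gamma>) z) / 4"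
      using \<delta>(3)[OF z] by (simp add: norm linear_diff[OF lin(2)])
  qed
  with mem show ?thesis by (rule tubular_imp_smooth)
qed

lemma HD_critical_inner:
  "HD_critical M Y = {X \<in> smooth_points M. \<forall>A\<in>tangent_space M X. (Y - X) \<bullet> A = 0}"
  by (simp add: HD_critical_def inner_matrix)

lemma HD_critical_isometry_subset:
  assumes \<gamma>: "orthogonal_transformation \<gamma>" "\<And>Z. \<gamma> Z \<in> M \<longleftrightarrow> Z \<in> M" and X: "X \<in> HD_critical M Y"
  shows "\<gamma> X \<in> HD_critical M (\<gamma> Y)"
proof -
  have bij: "bij \<gamma>" using \<gamma>(1) by (rule orthogonal_transformation_bij)
  have inv: "orthogonal_transformation (inv \<gamma>)" using \<gamma>(1) by (rule orthogonal_transformation_inv)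
  have [simp]: "inv \<gamma> (\<gamma> z) = z" "\<gamma> (inv \<gamma> z) = z" for z
    using bij by (simp_all add: bij_is_inj bij_is_surj surj_f_inv_f)
  have lin: "linear \<gamma>" "linear (inv \<gamma>)" using \<gamma>(1) inv orthogonal_transformation_linear by blast+
  have "(\<gamma> Y - \<gamma> X) \<bullet> A = 0" if A: "A \<in> tangent_space M (\<gamma> X)" for A
  proof -
    have "inv \<gamma> A \<in> tangent_space M (inv \<gamma> (\<gamma> X))"
      by (rule tangent_space_linear_image[OF lin(2) _ A]) (use \<gamma>(2)[of "inv \<gamma> _"] in simp)
    then have "(Y - X) \<bullet> inv \<gamma> A = 0" using X by (simp add: HD_critical_inner)
    moreover have "\<gamma> (Y - X) \<bullet> \<gamma> (inv \<gamma> A) = (Y - X) \<bullet> inv \<gamma> A"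
      using \<gamma>(1) unfolding orthogonal_transformation_def by blast
    ultimately show ?thesis by (simp add: linear_diff[OF lin(1)])
  qed
  moreover have "\<gamma> X \<in> smooth_points M"
    by (rule smooth_points_isometry[OF \<gamma>]) (use X in \<open>simp_all add: HD_critical_inner\<close>)
  ultimately show ?thesis by (simp add: HD_critical_inner)
qed

section \<open>Sets given by their singular values\<close>

locale singular_value_set =
  fixes \<iota> :: "'n::finite \<Rightarrow> 't::finite" and S :: "(real^'n) set" and M :: "(complex^'t^'n) set"
  assumes inj_\<iota>: "inj \<iota>" and symmetric: "absolutely_symmetric S" and M_eq: "M = sigma_inv \<iota> S"
begin

lemma S_invariant: "g \<in> signed_permutations \<Longrightarrow> z \<in> S \<Longrightarrow> g z \<in> S"
  using symmetric unfolding absolutely_symmetric_def by blast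

text \<open>
  Membership in \<open>M\<close> can be tested on any singular value decomposition, since \<open>S\<close> is invariant under
  signed permutations.
\<close>

lemma svd_in_M_iff:
  assumes "unitary U" "unitary V"
  shows "svd_matrix \<iota> U z V \<in> M \<longleftrightarrow> z \<in> S"
proof
  assume "svd_matrix \<iota> U z V \<in> M"
  then obtain U' x V' where x: "unitary U'" "x \<in> S" "unitary V'" "svd_matrix \<iota> U z V = svd_matrix \<iota> U' x V'"
    unfolding M_eq sigma_inv_def by blast
  have "svd_matrix \<iota> (adj U' ** U) z (adj V' ** V) = svd_matrix \<iota> (adj U' ** U') x (adj V' ** V')"
    unfolding mult_svd_matrix[symmetric] x(4) ..
  also have "\<dots> = real_diag \<iota> x" using x(1,3) by (simp add: unitary_def svd_matrix_1)
  finally have "\<exists>g\<in>signed_permutations. z = g x"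
    by (rule svd_matrix_eq_real_diag[OF inj_\<iota> unitary_mult[OF unitary_adj[OF x(1)] assms(1)]
          unitary_mult[OF unitary_adj[OF x(3)] assms(2)]])
  then show "z \<in> S" using S_invariant x(2) by blast
next
  assume "z \<in> S"
  then show "svd_matrix \<iota> U z V \<in> M" unfolding M_eq sigma_inv_def using assms by blast
qed

lemma real_diag_in_M_iff: "real_diag \<iota> z \<in> M \<longleftrightarrow> z \<in> S"
  using svd_in_M_iff[OF unitary_1 unitary_1] by (simp add: svd_matrix_1)

lemma unitary_mult_in_M:
  assumes "unitary U" "unitary V" "Z \<in> M"
  shows "U ** Z ** adj V \<in> M"
proof -
  obtain U' x V' where x: "unitary U'" "x \<in> S" "unitary V'" "Z = svd_matrix \<iota> U' x V'"
    using assms(3) unfolding M_eq sigma_inv_def by blast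
  show ?thesis
    unfolding x(4) mult_svd_matrix
    using svd_in_M_iff[OF unitary_mult[OF assms(1) x(1)] unitary_mult[OF assms(2) x(3)]] x(2) by simp
qed

lemma unitary_mult_in_M_iff:
  assumes "unitary U" "unitary V"
  shows "U ** Z ** adj V \<in> M \<longleftrightarrow> Z \<in> M"
proof
  assume "U ** Z ** adj V \<in> M"
  then have "adj U ** (U ** Z ** adj V) ** adj (adj V) \<in> M"
    by (rule unitary_mult_in_M[OF unitary_adj[OF assms(1)] unitary_adj[OF assms(2)]])
  moreover have "adj U ** (U ** Z ** adj V) ** adj (adj V) = (adj U ** U) ** Z ** (adj V ** V)"
    by (simp add: matrix_mul_assoc)
  ultimately show "Z \<in> M" using assms by (simp add: unitary_def)
qed (rule unitary_mult_in_M[OF assms])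

text \<open>
  Conjugation by diagonal sign matrices, combined with complex conjugation if \<open>b\<close> holds. The left sign
  matrix is determined by the right one along \<open>\<iota>\<close>, so that real diagonal matrices are fixed; they are
  the only common fixed points.
\<close>

definition flip :: "bool \<Rightarrow> ('t \<Rightarrow> real) \<Rightarrow> complex^'t^'n \<Rightarrow> complex^'t^'n" where
  "flip b s Z = (\<chi> i a. of_real (s (\<iota> i) * s a) * (if b then cnj (Z $ i $ a) else Z $ i $ a))"

definition flips :: "(complex^'t^'n \<Rightarrow> complex^'t^'n) set" where
  "flips = (\<lambda>(b, s). flip b s) ` (UNIV \<times> signs)"

lemma flip_flip: "flip b s (flip b' s' Z) = flip (b \<noteq> b') (\<lambda>a. s a * s' a) Z"
  by (auto simp: flip_def vec_eq_iff)

lemma sign_square: "s \<in> signs \<Longrightarrow> s a * s a = 1"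
proof -
  assume "s \<in> signs"
  then have "s a = -1 \<or> s a = 1" by blast
  then show ?thesis by auto
qed

lemma isometry_group_flips: "isometry_group flips"
proof
  show "finite flips"
    unfolding flips_def by (intro finite_imageI finite_cartesian_product finite finite_signs)
  have "flip False (\<lambda>_. 1) = id" by (rule ext) (simp add: flip_def vec_eq_iff)
  then show "id \<in> flips"
    unfolding flips_def by (intro image_eqI[of _ _ "(False, \<lambda>_. 1)"]) auto
next
  fix g assume "g \<in> flips"
  then obtain b s where g: "g = flip b s" "s \<in> signs" unfolding flips_def by auto
  have sq: "s a * s a = 1" for a using sign_square[OF g(2)] .
  have gg: "g (g Z) = Z" for Z
    unfolding g(1) flip_flip by (simp add: flip_def vec_eq_iff sq)
  then have "inv g = g" by (intro inv_equality)
  then show "inv g \<in> flips" using \<open>g \<in> flips\<close> by simp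
  have "linear g" by (simp add: g(1) linear_iff flip_def vec_eq_iff algebra_simps)
  moreover have "g Z \<bullet> g Z' = Z \<bullet> Z'" for Z Z'
  proof -
    have "g Z $ i $ a \<bullet> g Z' $ i $ a = Z $ i $ a \<bullet> Z' $ i $ a" for i a
    proof -
      have "g Z $ i $ a \<bullet> g Z' $ i $ a = ((s (\<iota> i) * s (\<iota> i)) * (s a * s a)) * (Z $ i $ a \<bullet> Z' $ i $ a)"
        by (simp add: g(1) flip_def inner_complex_def algebra_simps)
      then show ?thesis by (simp add: sq)
    qed
    then show ?thesis unfolding inner_vec_def by simp
  qed
  ultimately show "orthogonal_transformation g" by (simp add: orthogonal_transformation_def)
  fix h assume "h \<in> flips"
  then obtain b' s' where h: "h = flip b' s'" "s' \<in> signs" unfolding flips_def by auto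
  have "g \<circ> h = flip (b \<noteq> b') (\<lambda>a. s a * s' a)" by (rule ext) (simp add: g(1) h(1) flip_flip)
  moreover have "(\<lambda>a. s a * s' a) \<in> signs"
  proof -
    have "s a * s' a = -1 \<or> s a * s' a = 1" for a
    proof -
      have "s a = -1 \<or> s a = 1" "s' a = -1 \<or> s' a = 1" using g(2) h(2) by blast+
      then show ?thesis by auto
    qed
    then show ?thesis by simp
  qed
  ultimately show "g \<circ> h \<in> flips"
    unfolding flips_def by (intro image_eqI[of _ _ "(b \<noteq> b', \<lambda>a. s a * s' a)"]) auto
qed

sublocale flips: isometry_group flips
  by (rule isometry_group_flips)

lemma flip_real_diag: assumes "g \<in> flips" shows "g (real_diag \<iota> z) = real_diag \<iota> z"
proof -
  obtain b s where g: "g = flip b s" "s \<in> signs" using assms unfolding flips_def by auto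
  have "complex_of_real (s a) * complex_of_real (s a) = 1" for a
    using sign_square[OF g(2), of a] by (metis of_real_1 of_real_mult)
  then show ?thesis by (simp add: g(1) flip_def vec_eq_iff real_diag_nth)
qed

lemma real_diag_if_flip_invariant:
  assumes "\<And>g. g \<in> flips \<Longrightarrow> g Z = Z"
  obtains z where "Z = real_diag \<iota> z"
proof -
  have fix_flip: "flip b s Z = Z" if "s \<in> signs" for b s
    using assms[of "flip b s"] that unfolding flips_def by (metis (no_types, lifting) UNIV_I SigmaI case_prod_conv image_eqI)
  have real: "cnj (Z $ i $ a) = Z $ i $ a" for i a
    using arg_cong[OF fix_flip[of "\<lambda>_. 1" True], of "\<lambda>Z. Z $ i $ a"] by (simp add: flip_def)
  have off: "Z $ i $ a = 0" if "a \<noteq> \<iota> i" for i a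
    using arg_cong[OF fix_flip[of "\<lambda>b. if b = a then -1 else 1" False], of "\<lambda>Z. Z $ i $ a"] that
    by (simp add: flip_def)
  have entry: "Z $ i $ a = real_diag \<iota> (\<chi> i. Re (Z $ i $ \<iota> i)) $ i $ a" for i a
    using off[of a i] real[of i "\<iota> i"] by (auto simp: real_diag_nth complex_eq_iff)
  have "Z = real_diag \<iota> (\<chi> i. Re (Z $ i $ \<iota> i))"
    unfolding vec_eq_iff by (intro allI entry)
  then show thesis by (rule that)
qed

lemma M_flip_invariant: assumes "g \<in> flips" "Z \<in> M" shows "g Z \<in> M"
proof -
  obtain b s where g: "g = flip b s" "s \<in> signs" using assms unfolding flips_def by auto
  have sq: "complex_of_real (s a) * cnj (complex_of_real (s a)) = 1" for a
    using sign_square[OF g(2), of a] by (metis complex_cnj_complex_of_real of_real_1 of_real_mult)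
  define conj where "conj A = (\<chi> i j. cnj (A $ i $ j))" for A :: "complex^'t^'n"
  have M_conj: "conj Z \<in> M" if "Z \<in> M" for Z
  proof -
    obtain U x V where x: "unitary U" "x \<in> S" "unitary V" "Z = svd_matrix \<iota> U x V"
      using \<open>Z \<in> M\<close> unfolding M_eq sigma_inv_def by blast
    define U' V' where "U' = (\<chi> i j. cnj (U $ i $ j))" and "V' = (\<chi> i j. cnj (V $ i $ j))"
    have "U' ** adj U' = (\<chi> i j. cnj ((U ** adj U) $ i $ j))" "V' ** adj V' = (\<chi> i j. cnj ((V ** adj V) $ i $ j))"
      by (simp_all add: U'_def V'_def vec_eq_iff matrix_matrix_mult_def)
    then have "unitary U'" "unitary V'"
      using x(1,3) by (simp_all add: unitary_iff vec_eq_iff mat_def)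
    moreover have "cnj (real_diag \<iota> x $ i $ a) = real_diag \<iota> x $ i $ a" for i a
      by (simp add: real_diag_nth)
    then have "conj Z = svd_matrix \<iota> U' x V'"
      by (simp add: x(4) conj_def svd_matrix_real_diag U'_def V'_def vec_eq_iff matrix_matrix_mult_def)
    ultimately show ?thesis using svd_in_M_iff x(2) by simp
  qed
  have "g Z = mono_matrix (\<lambda>i. of_real (s (\<iota> i))) id ** (if b then conj Z else Z) ** adj (mono_matrix (\<lambda>a. of_real (s a)) id)"
    by (simp add: vec_eq_iff g(1) flip_def mult_adj_mono_matrix mono_matrix_mult conj_def mult_ac)
  moreover have "unitary (mono_matrix (\<lambda>i. complex_of_real (s (\<iota> i))) id)" "unitary (mono_matrix (\<lambda>a. complex_of_real (s a)) id)"
    by (intro unitary_mono_matrix; simp only: sq inj_on_id)+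
  ultimately show ?thesis using unitary_mult_in_M M_conj assms(2) by simp
qed


section \<open>Smoothness and tangent vectors at real diagonal matrices\<close>

lemma has_derivative_real_diag: "(real_diag \<iota> has_derivative real_diag \<iota>) (at x)"
  using linear_real_diag[of \<iota>] by (intro bounded_linear_imp_has_derivative) (simp add: linear_linear)

text \<open>
  A tubular map of \<open>S\<close> that is equivariant under signed permutations lifts to a tubular map of \<open>M\<close>: all
  its properties at \<open>U diag z V\<^sup>*\<close> are properties of \<open>G\<close> at \<open>z\<close>, and near \<open>diag x\<close> one may take \<open>z\<close>
  near \<open>x\<close>. The lift vanishes on \<open>M\<close>, so that its derivative annihilates tangent vectors of \<open>M\<close>; on
  diagonal ones it is the derivative of \<open>G\<close>, whose kernel consists of tangent vectors of \<open>S\<close>.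
\<close>

lemma smooth_lift:
  assumes x: "x \<in> smooth_points S"
  shows "real_diag \<iota> x \<in> smooth_points M"
    and "real_diag \<iota> w \<in> tangent_space M (real_diag \<iota> x) \<Longrightarrow> w \<in> tangent_space S x"
proof -
  let ?X = "real_diag \<iota> x"
  obtain G D where G: "tubular S x G" "\<And>g z. g \<in> signed_permutations \<Longrightarrow> G (g z) = g (G z)"
    and D: "(G has_derivative D) (at x)" "\<And>v. D v = 0 \<Longrightarrow> v \<in> tangent_space S x"
  proof (rule signed_perms.equivariant_tubular_map[OF x])
    show "g z \<in> S" if "g \<in> signed_permutations" "z \<in> S" for g z using that by (rule S_invariant)
  qed (rule that)
  have "liftable \<iota> G"
    using G unfolding tubular_def by (intro liftable_equivariant[OF inj_\<iota>]) blast+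
  then obtain F where F: "lifts \<iota> F G" unfolding liftable_def by blast
  have G0: "G z = 0" if "z \<in> S" for z using G(1) that unfolding tubular_def by blast
  have F0: "F Z = 0" if Z: "Z \<in> M" for Z
  proof -
    obtain U z V where z: "unitary U" "z \<in> S" "unitary V" "Z = svd_matrix \<iota> U z V"
      using Z unfolding M_eq sigma_inv_def by blast
    then show ?thesis
      by (simp add: lifts_svd_matrix[OF F] G0 linear_0[OF linear_svd_matrix])
  qed
  obtain \<delta>0 where \<delta>0: "\<delta>0 > 0" "\<And>z. z \<in> ball x \<delta>0 \<Longrightarrow> G z = 0 \<Longrightarrow> z \<in> S"
    "\<And>z. z \<in> ball x \<delta>0 \<Longrightarrow> norm (G (z - G z)) \<le> norm (G z) / 4"
    using G(1) unfolding tubular_def by blast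
  obtain \<delta> where \<delta>: "\<delta> > 0" "\<And>Z. dist Z ?X < \<delta> \<Longrightarrow>
      \<exists>U z V. unitary U \<and> unitary V \<and> Z = svd_matrix \<iota> U z V \<and> dist z x < \<delta>0"
    using svd_near_real_diag[OF inj_\<iota> \<delta>0(1), of x] by blast
  have "(F Z = 0 \<longrightarrow> Z \<in> M) \<and> norm (F (Z - F Z)) \<le> norm (F Z) / 4" if Z: "Z \<in> ball ?X \<delta>" for Z
  proof -
    obtain U z V where z: "unitary U" "unitary V" "Z = svd_matrix \<iota> U z V" "dist z x < \<delta>0"
      using \<delta>(2)[of Z] Z by (auto simp: dist_commute)
    have zb: "z \<in> ball x \<delta>0" using z(4) by (simp add: dist_commute)
    have FZ: "F Z = svd_matrix \<iota> U (G z) V"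
      unfolding z(3) by (rule lifts_svd_matrix[OF F z(1,2)])
    have "Z - F Z = svd_matrix \<iota> U (z - G z) V"
      by (simp only: FZ z(3)[symmetric] linear_diff[OF linear_svd_matrix])
    then have "F (Z - F Z) = svd_matrix \<iota> U (G (z - G z)) V"
      by (simp only: lifts_svd_matrix[OF F z(1,2)])
    then have le: "norm (F (Z - F Z)) \<le> norm (F Z) / 4"
      using \<delta>0(3)[OF zb] by (simp add: FZ norm_svd_matrix[OF z(1,2)])
    have "Z \<in> M" if "F Z = 0"
    proof -
      have "norm (G z) = 0" using that norm_svd_matrix[OF z(1,2), of \<iota> "G z"] by (simp add: FZ)
      then have "z \<in> S" using \<delta>0(2)[OF zb] by simp
      then show ?thesis using svd_in_M_iff[OF z(1,2)] z(3) by simp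
    qed
    with le show ?thesis by blast
  qed
  then have "tubular M ?X F"
    unfolding tubular_def using lifts_polynomial[OF F] F0 \<delta>(1) by blast
  moreover have "?X \<in> M" using x real_diag_in_M_iff by (simp add: smooth_points_def)
  ultimately show "?X \<in> smooth_points M" by (intro tubular_imp_smooth)
  assume w: "real_diag \<iota> w \<in> tangent_space M ?X"
  obtain E where E: "(F has_derivative E) (at ?X)"
    using differentiable_at_polynomial_function[OF lifts_polynomial[OF F]] unfolding differentiable_def by blast
  have "E (real_diag \<iota> w) \<bullet> b = 0" for b
  proof -
    have poly: "real_polynomial_function (\<lambda>Z. F Z \<bullet> b)"
      using polynomial_function_inner[OF lifts_polynomial[OF F]] by (simp add: real_polynomial_function_eq)
    then have "(\<lambda>Z. F Z \<bullet> b) \<in> vanishing_ideal M" using F0 by (simp add: vanishing_ideal_def)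
    then have "gradient (\<lambda>Z. F Z \<bullet> b) ?X \<bullet> real_diag \<iota> w = 0"
      using w unfolding tangent_space_def by blast
    moreover have "(\<lambda>v. gradient (\<lambda>Z. F Z \<bullet> b) ?X \<bullet> v) = (\<lambda>v. E v \<bullet> b)"
      by (rule has_derivative_unique[OF has_derivative_gradient[OF poly] has_derivative_inner_left[OF E]])
    ultimately show ?thesis by metis
  qed
  then have "E (real_diag \<iota> w) = 0" by (metis inner_eq_zero_iff)
  moreover have "(\<lambda>v. E (real_diag \<iota> v)) = (\<lambda>v. real_diag \<iota> (D v))"
  proof (rule has_derivative_unique)
    show "((\<lambda>z. F (real_diag \<iota> z)) has_derivative (\<lambda>v. E (real_diag \<iota> v))) (at x)"
      using diff_chain_at[OF has_derivative_real_diag E] by (simp add: o_def)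
    show "((\<lambda>z. F (real_diag \<iota> z)) has_derivative (\<lambda>v. real_diag \<iota> (D v))) (at x)"
      using diff_chain_at[OF D(1) has_derivative_real_diag] by (simp add: o_def lifts_real_diag[OF F])
  qed
  ultimately have "real_diag \<iota> (D w) = 0" by metis
  then have "D w \<bullet> D w = 0" using inner_real_diag[of \<iota> "D w" "D w"] by simp
  then show "w \<in> tangent_space S x" using D(2) by simp
qed

text \<open>
  A tubular map of \<open>M\<close> that commutes with all flips maps real diagonal matrices to such matrices, and
  its restriction is tubular for \<open>S\<close>.
\<close>

lemma smooth_restrict:
  assumes X: "real_diag \<iota> x \<in> smooth_points M"
  shows "x \<in> smooth_points S"
proof -
  let ?X = "real_diag \<iota> x"
  obtain F where F: "tubular M ?X F" "\<And>g Z. g \<in> flips \<Longrightarrow> F (g Z) = g (F Z)"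
  proof (rule flips.equivariant_tubular_map[OF X])
    show "g Z \<in> M" if "g \<in> flips" "Z \<in> M" for g Z using that by (rule M_flip_invariant)
  qed (rule that)
  define G where "G = adjoint (real_diag \<iota>) \<circ> F \<circ> real_diag \<iota>"
  have adj_diag: "adjoint (real_diag \<iota>) (real_diag \<iota> z) = z" for z
  proof -
    have "adjoint (real_diag \<iota>) (real_diag \<iota> z) \<bullet> w = z \<bullet> w" for w
      by (simp add: adjoint_clauses[OF linear_real_diag] inner_real_diag)
    then show ?thesis by (metis vector_eq_rdot)
  qed
  have FG: "F (real_diag \<iota> z) = real_diag \<iota> (G z)" for z
  proof -
    have "g (F (real_diag \<iota> z)) = F (real_diag \<iota> z)" if "g \<in> flips" for g
      using F(2)[OF that, of "real_diag \<iota> z"] flip_real_diag[OF that] by simp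
    then obtain u where u: "F (real_diag \<iota> z) = real_diag \<iota> u"
      using real_diag_if_flip_invariant by blast
    then show ?thesis by (simp add: G_def adj_diag)
  qed
  have norm: "norm (real_diag \<iota> z) = norm z" for z
    by (simp add: norm_eq_sqrt_inner inner_real_diag)
  have lin: "linear (real_diag \<iota>)" by (rule linear_real_diag)
  obtain \<delta> where \<delta>: "\<delta> > 0" "\<And>Z. Z \<in> ball ?X \<delta> \<Longrightarrow> F Z = 0 \<Longrightarrow> Z \<in> M"
    "\<And>Z. Z \<in> ball ?X \<delta> \<Longrightarrow> norm (F (Z - F Z)) \<le> norm (F Z) / 4"
    using F(1) unfolding tubular_def by blast
  have "tubular S x G"
    unfolding tubular_def
  proof (intro conjI exI[of _ \<delta>] ballI impI)
    have "polynomial_function (real_diag \<iota>)" "polynomial_function (adjoint (real_diag \<iota>))"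
      using lin adjoint_linear[OF lin] by (simp_all add: polynomial_function_bounded_linear linear_linear)
    then show "polynomial_function G"
      using F(1) unfolding tubular_def G_def by (intro polynomial_function_compose) auto
    show "G z = 0" if "z \<in> S" for z
    proof -
      have "F (real_diag \<iota> z) = 0" using F(1) that real_diag_in_M_iff unfolding tubular_def by blast
      then have "norm (G z) = 0" using norm[of "G z"] by (simp add: FG)
      then show ?thesis by simp
    qed
    show "\<delta> > 0" by fact
    fix z assume "z \<in> ball x \<delta>"
    then have z: "real_diag \<iota> z \<in> ball ?X \<delta>"
      using norm[of "x - z"] by (simp add: dist_norm linear_diff[OF lin])
    show "z \<in> S" if "G z = 0"
      using \<delta>(2)[OF z] that real_diag_in_M_iff by (simp add: FG linear_0[OF lin])
    have "F (real_diag \<iota> z - F (real_diag \<iota> z)) = real_diag \<iota> (G (z - G z))"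
      by (simp add: FG linear_diff[OF lin, symmetric])
    then show "norm (G (z - G z)) \<le> norm (G z) / 4"
      using \<delta>(3)[OF z] by (simp add: FG norm)
  qed
  moreover have "x \<in> S" using X real_diag_in_M_iff by (simp add: smooth_points_def)
  ultimately show ?thesis by (intro tubular_imp_smooth)
qed

text \<open>
  The average of \<open>A\<close> over all flips is tangent to \<open>M\<close> and fixed by the flips, hence diagonal. Its inner
  product with a diagonal matrix is that of \<open>A\<close>, because flips are isometries fixing the diagonal.
\<close>

lemma tangent_diag_part:
  assumes A: "A \<in> tangent_space M (real_diag \<iota> x)"
  obtains w where "real_diag \<iota> w \<in> tangent_space M (real_diag \<iota> x)"
    "\<And>v. real_diag \<iota> v \<bullet> A = v \<bullet> w"
proof -
  define m where "m = real (card flips)"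
  have m: "m > 0" unfolding m_def using flips.finite_group flips.id_closed by (auto simp: card_gt_0_iff)
  define B where "B = (\<Sum>g\<in>flips. g A)"
  have "B \<in> tangent_space M (real_diag \<iota> x)"
    unfolding B_def
  proof (intro subspace_sum[OF tangent_space_subspace])
    fix g assume g: "g \<in> flips"
    have "g A \<in> tangent_space M (g (real_diag \<iota> x))"
      by (rule tangent_space_linear_image[OF flips.linear_group[OF g] M_flip_invariant[OF g] A])
    then show "g A \<in> tangent_space M (real_diag \<iota> x)" by (simp add: flip_real_diag[OF g])
  qed
  have "g B = B" if g: "g \<in> flips" for g
  proof -
    have "g B = (\<Sum>h\<in>flips. (g \<circ> h) A)" by (simp add: B_def linear_sum[OF flips.linear_group[OF g]])
    also have "\<dots> = (\<Sum>h\<in>flips. h A)"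
    proof (rule sum.reindex_bij_witness[where i = "\<lambda>h. inv g \<circ> h" and j = "\<lambda>h. g \<circ> h"])
      fix h assume h: "h \<in> flips"
      show "inv g \<circ> (g \<circ> h) = h" "g \<circ> (inv g \<circ> h) = h" using g by (simp_all add: fun_eq_iff)
      show "g \<circ> h \<in> flips" "inv g \<circ> h \<in> flips"
        using flips.comp_closed flips.inv_closed g h by blast+
    qed simp
    finally show ?thesis by (simp add: B_def)
  qed
  then obtain u where u: "B = real_diag \<iota> u" using real_diag_if_flip_invariant by blast
  have inner: "real_diag \<iota> v \<bullet> B = m * (real_diag \<iota> v \<bullet> A)" for v
  proof -
    have "real_diag \<iota> v \<bullet> g A = real_diag \<iota> v \<bullet> A" if g: "g \<in> flips" for g
    proof -
      have "g (real_diag \<iota> v) \<bullet> g A = real_diag \<iota> v \<bullet> A"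
        using flips.isometry[OF g] unfolding orthogonal_transformation_def by blast
      then show ?thesis by (simp add: flip_real_diag[OF g])
    qed
    then show ?thesis by (simp add: B_def inner_sum_right m_def)
  qed
  show thesis
  proof
    have "real_diag \<iota> ((1 / m) *\<^sub>R u) = (1 / m) *\<^sub>R B" by (simp add: u linear_cmul[OF linear_real_diag])
    then show "real_diag \<iota> ((1 / m) *\<^sub>R u) \<in> tangent_space M (real_diag \<iota> x)"
      using \<open>B \<in> _\<close> subspace_scale[OF tangent_space_subspace] by simp
    show "real_diag \<iota> v \<bullet> A = v \<bullet> ((1 / m) *\<^sub>R u)" for v
      using inner[of v] m by (simp add: u inner_real_diag)
  qed
qed

section \<open>Critical points and degrees\<close>

lemma orbit_tangent:
  assumes "X \<in> M" "norm w = 1"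
  shows "souter \<i> w ** X \<in> tangent_space M X"
proof -
  let ?\<phi> = "\<lambda>t. phase_shift (cis t) w ** X"
  have "(?\<phi> has_vector_derivative souter \<i> w ** X) (at 0)"
    using bounded_linear.has_vector_derivative[OF bounded_bilinear.bounded_linear_left[OF bounded_bilinear_matrix_mult] phase_curve] .
  moreover have "?\<phi> t \<in> M" for t
  proof -
    have "unitary (phase_shift (cis t) w)"
      by (intro unitary_phase_shift assms(2)) simp
    from unitary_mult_in_M[OF this unitary_1 assms(1)] show ?thesis by simp
  qed
  ultimately have "souter \<i> w ** X \<in> tangent_space M (?\<phi> 0)" by (rule tangent_of_curve)
  then show ?thesis by (simp add: phase_shift_def souter_def zero_vec_def[symmetric])
qed

lemma orbit_tangent_right:
  assumes "X \<in> M" "norm w = 1"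
  shows "X ** adj (souter \<i> w) \<in> tangent_space M X"
proof -
  let ?\<phi> = "\<lambda>t. X ** adj (phase_shift (cis t) w)"
  have "bounded_linear (\<lambda>V. X ** adj V)"
    using bounded_linear_compose[OF bounded_bilinear.bounded_linear_right[OF bounded_bilinear_matrix_mult] linear_linear[THEN iffD2, OF linear_adj]] .
  then have "(?\<phi> has_vector_derivative X ** adj (souter \<i> w)) (at 0)"
    using bounded_linear.has_vector_derivative[OF _ phase_curve] by blast
  moreover have "?\<phi> t \<in> M" for t
  proof -
    have "unitary (phase_shift (cis t) w)"
      by (intro unitary_phase_shift assms(2)) simp
    from unitary_mult_in_M[OF unitary_1 this assms(1)] show ?thesis by simp
  qed
  ultimately have "X ** adj (souter \<i> w) \<in> tangent_space M (?\<phi> 0)" by (rule tangent_of_curve)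
  then show ?thesis by (simp add: phase_shift_def souter_def zero_vec_def[symmetric])
qed

text \<open>
  Orthogonality to the directions \<open>\<i> w w\<^sup>* X\<close> says that the form of \<open>(diag y - X) X\<^sup>*\<close> at \<open>w\<close> is real,
  and \<open>X X\<^sup>*\<close> is Hermitian anyway; similarly on the other side.
\<close>

lemma critical_imp_diagonal:
  assumes "regular y" and X: "X \<in> HD_critical M (real_diag \<iota> y)"
  obtains x where "X = real_diag \<iota> x"
proof -
  let ?Y = "real_diag \<iota> y"
  have XM: "X \<in> M" using X smooth_in unfolding HD_critical_inner by blast
  have crit: "(?Y - X) \<bullet> A = 0" if "A \<in> tangent_space M X" for A
    using X that unfolding HD_critical_inner by blast
  have self: "adj (X ** adj X) = X ** adj X" "adj (adj X ** X) = adj X ** X"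
    by (simp_all add: adj_mult)
  have "adj ((?Y - X) ** adj X) = (?Y - X) ** adj X"
  proof (rule hermitian_if_real_form)
    fix w :: "complex^'n" assume w: "norm w = 1"
    have "(souter \<i> w ** X) \<bullet> (?Y - X) = 0"
      using crit[OF orbit_tangent[OF XM w]] by (simp add: inner_commute)
    then show "Im (sform ((?Y - X) ** adj X) w w) = 0"
      by (simp add: inner_mult_right inner_souter)
  qed
  moreover have "(?Y - X) ** adj X = ?Y ** adj X - X ** adj X"
    using bounded_bilinear.diff_left[OF bounded_bilinear_matrix_mult] by blast
  ultimately have "adj (?Y ** adj X) = ?Y ** adj X"
    using self(1) by (simp add: linear_diff[OF linear_adj])
  then have left: "adj (X ** adj ?Y) = X ** adj ?Y" by (simp add: adj_mult)
  have "adj (adj (?Y - X) ** X) = adj (?Y - X) ** X"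
  proof (rule hermitian_if_real_form)
    fix w :: "complex^'t" assume w: "norm w = 1"
    have "(X ** adj (souter \<i> w)) \<bullet> (?Y - X) = 0"
      using crit[OF orbit_tangent_right[OF XM w]] by (simp add: inner_commute)
    then have "souter \<i> w \<bullet> (adj (?Y - X) ** X) = 0"
      using inner_adj[of "X ** adj (souter \<i> w)" "?Y - X"] by (simp add: adj_mult inner_mult_right)
    then show "Im (sform (adj (?Y - X) ** X) w w) = 0"
      by (simp add: inner_souter)
  qed
  moreover have "adj (?Y - X) ** X = adj ?Y ** X - adj X ** X"
    unfolding linear_diff[OF linear_adj] using bounded_bilinear.diff_left[OF bounded_bilinear_matrix_mult] by blast
  ultimately have "adj (adj ?Y ** X) = adj ?Y ** X"
    using self(2) by (simp add: linear_diff[OF linear_adj])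
  then have right: "adj (adj X ** ?Y) = adj X ** ?Y" by (simp add: adj_mult)
  show thesis using real_diag_if_hermitian[OF inj_\<iota> assms(1) left right] that by blast
qed

lemma HD_critical_real_diag:
  assumes "regular y"
  shows "HD_critical M (real_diag \<iota> y) = real_diag \<iota> ` ED_critical S y"
proof (intro subset_antisym subsetI)
  fix X assume X: "X \<in> HD_critical M (real_diag \<iota> y)"
  obtain x where x: "X = real_diag \<iota> x" using critical_imp_diagonal[OF assms X] .
  have "x \<in> smooth_points S"
    by (rule smooth_restrict) (use X x in \<open>simp add: HD_critical_inner\<close>)
  moreover have "(x - y) \<bullet> a = 0" if a: "a \<in> tangent_space S x" for a
  proof -
    have "real_diag \<iota> a \<in> tangent_space M X"
      unfolding x by (rule tangent_space_linear_image[OF linear_real_diag _ a]) (simp add: real_diag_in_M_iff)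
    then have "(real_diag \<iota> y - X) \<bullet> real_diag \<iota> a = 0" using X unfolding HD_critical_inner by blast
    then have "(y - x) \<bullet> a = 0"
      by (simp add: x linear_diff[OF linear_real_diag, symmetric] inner_real_diag)
    then show ?thesis by (simp add: inner_diff_left)
  qed
  ultimately show "X \<in> real_diag \<iota> ` ED_critical S y" unfolding x ED_critical_def by blast
next
  fix X assume "X \<in> real_diag \<iota> ` ED_critical S y"
  then obtain x where x: "X = real_diag \<iota> x" "x \<in> ED_critical S y" by blast
  have smooth: "x \<in> smooth_points S" and crit: "\<And>a. a \<in> tangent_space S x \<Longrightarrow> (x - y) \<bullet> a = 0"
    using x(2) by (auto simp: ED_critical_def)
  have "(real_diag \<iota> y - X) \<bullet> A = 0" if A: "A \<in> tangent_space M X" for A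
  proof -
    obtain w where w: "real_diag \<iota> w \<in> tangent_space M X" "\<And>v. real_diag \<iota> v \<bullet> A = v \<bullet> w"
      using tangent_diag_part[OF A[unfolded x(1)]] unfolding x(1) by blast
    have "(x - y) \<bullet> w = 0" using crit smooth_lift(2)[OF smooth] w(1) unfolding x(1) by blast
    then show ?thesis
      using w(2)[of "y - x"] by (simp add: x(1) linear_diff[OF linear_real_diag] inner_diff_left)
  qed
  then show "X \<in> HD_critical M (real_diag \<iota> y)"
    using smooth_lift(1)[OF smooth] by (simp add: HD_critical_inner x(1))
qed

text \<open>
  The isometry \<open>Z \<mapsto> U Z V\<^sup>*\<close> preserves \<open>M\<close> and reduces the claim to diagonal matrices.
\<close>

theorem HD_critical_svd_matrix:
  assumes U: "unitary U" and V: "unitary V" and y: "regular y"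
  shows "HD_critical M (svd_matrix \<iota> U y V) = (\<lambda>x. svd_matrix \<iota> U x V) ` ED_critical S y"
proof -
  define \<gamma> where "\<gamma> A B Z = A ** Z ** adj B" for A :: "complex^'n^'n" and B :: "complex^'t^'t" and Z :: "complex^'t^'n"
  have iso: "orthogonal_transformation (\<gamma> A B)" if "unitary A" "unitary B" for A B
  proof -
    have "linear (\<gamma> A B)"
      by (simp add: \<gamma>_def linear_iff matrix_add_ldistrib matrix_add_mult_distrib
          matrix_mult_scaleR_left matrix_mult_scaleR_right)
    then show ?thesis
      unfolding orthogonal_transformation_def \<gamma>_def
      using that by (simp add: inner_unitary_left inner_unitary_right)
  qed
  have mem: "\<gamma> A B Z \<in> M \<longleftrightarrow> Z \<in> M" if "unitary A" "unitary B" for A B Z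
    unfolding \<gamma>_def by (rule unitary_mult_in_M_iff[OF that])
  have diag: "\<gamma> U V (real_diag \<iota> z) = svd_matrix \<iota> U z V" for z
    by (simp add: \<gamma>_def svd_matrix_real_diag)
  have cancel: "\<gamma> U V (\<gamma> (adj U) (adj V) Z) = Z" "\<gamma> (adj U) (adj V) (\<gamma> U V Z) = Z" for Z
  proof -
    have "\<gamma> U V (\<gamma> (adj U) (adj V) Z) = (U ** adj U) ** Z ** (V ** adj V)"
      "\<gamma> (adj U) (adj V) (\<gamma> U V Z) = (adj U ** U) ** Z ** (adj V ** V)"
      by (simp_all add: \<gamma>_def matrix_mul_assoc)
    then show "\<gamma> U V (\<gamma> (adj U) (adj V) Z) = Z" "\<gamma> (adj U) (adj V) (\<gamma> U V Z) = Z"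
      using U V by (simp_all add: unitary_def)
  qed
  have "HD_critical M (\<gamma> U V (real_diag \<iota> y)) = \<gamma> U V ` HD_critical M (real_diag \<iota> y)"
  proof (intro subset_antisym subsetI)
    fix X assume "X \<in> HD_critical M (\<gamma> U V (real_diag \<iota> y))"
    then have "\<gamma> (adj U) (adj V) X \<in> HD_critical M (\<gamma> (adj U) (adj V) (\<gamma> U V (real_diag \<iota> y)))"
      by (rule HD_critical_isometry_subset[OF iso[OF unitary_adj[OF U] unitary_adj[OF V]] mem[OF unitary_adj[OF U] unitary_adj[OF V]]])
    then show "X \<in> \<gamma> U V ` HD_critical M (real_diag \<iota> y)"
      unfolding cancel(2) using cancel(1)[of X] by (metis image_eqI)
  next
    fix X assume "X \<in> \<gamma> U V ` HD_critical M (real_diag \<iota> y)"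
    then show "X \<in> HD_critical M (\<gamma> U V (real_diag \<iota> y))"
      using HD_critical_isometry_subset[OF iso[OF U V] mem[OF U V]] by blast
  qed
  then show ?thesis by (simp add: diag HD_critical_real_diag[OF y] image_image)
qed

end

theorem theorem23:
  fixes \<iota> :: "'n::finite \<Rightarrow> 't::finite"
    and S :: "(real^'n) set"
    and M :: "(complex^'t^'n) set"
  assumes "inj \<iota>"
    and "algebraic_set S"
    and "absolutely_symmetric S"
    and "M = sigma_inv \<iota> S"
  shows "(\<exists>\<Omega> :: (complex^'t^'n) set.
            semialgebraic \<Omega> \<and> open \<Omega> \<and> closure \<Omega> = UNIV \<and>
            (\<forall>Y\<in>\<Omega>. \<exists>U y V. unitary U \<and> unitary V \<and> Y = svd_matrix \<iota> U y V \<and>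
               HD_critical M Y = {svd_matrix \<iota> U x V | x. x \<in> ED_critical S y} \<and>
               HDdeg_at M Y = REDdeg_at S y))
         \<and> HDdeg M = REDdeg S"
proof -
  interpret singular_value_set \<iota> S M
    using assms by unfold_locales
  obtain p :: "complex^'t^'n \<Rightarrow> real" where p: "real_polynomial_function p"
    "\<And>U z V. unitary U \<Longrightarrow> unitary V \<Longrightarrow> p (svd_matrix \<iota> U z V) \<noteq> 0 \<longleftrightarrow> regular z"
    using generic_polynomial[OF inj_\<iota>] by blast
  define \<Omega> where "\<Omega> = {Z. p Z \<noteq> 0}"
  obtain c :: "real^'n" where c: "regular c" using regular_exists by blast
  have pc: "p (real_diag \<iota> c) \<noteq> 0"
    using p(2)[OF unitary_1 unitary_1, of c] c by (simp add: svd_matrix_1)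
  have dense: "\<exists>Z\<in>W. Z \<in> \<Omega>" if W: "open W" "Z0 \<in> W" for W Z0
    using real_polynomial_nonzero_dense[OF p(1) pc W] unfolding \<Omega>_def by blast
  have crit: "HD_critical M (svd_matrix \<iota> U y V) = (\<lambda>x. svd_matrix \<iota> U x V) ` ED_critical S y"
    "finite (HD_critical M (svd_matrix \<iota> U y V)) \<longleftrightarrow> finite (ED_critical S y)"
    "card (HD_critical M (svd_matrix \<iota> U y V)) = card (ED_critical S y)"
    if UV: "unitary U" "unitary V" and y: "regular y" for U y V
  proof -
    show eq: "HD_critical M (svd_matrix \<iota> U y V) = (\<lambda>x. svd_matrix \<iota> U x V) ` ED_critical S y"
      by (rule HD_critical_svd_matrix[OF UV y])
    have inj: "inj_on (\<lambda>x. svd_matrix \<iota> U x V) (ED_critical S y)"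
      by (rule inj_onI) (rule svd_matrix_inj[OF UV])
    show "finite (HD_critical M (svd_matrix \<iota> U y V)) \<longleftrightarrow> finite (ED_critical S y)"
      unfolding eq by (rule finite_image_iff[OF inj])
    show "card (HD_critical M (svd_matrix \<iota> U y V)) = card (ED_critical S y)"
      unfolding eq by (rule card_image[OF inj])
  qed
  have svd: "\<exists>U y V. unitary U \<and> unitary V \<and> Y = svd_matrix \<iota> U y V \<and> regular y" if Y: "Y \<in> \<Omega>" for Y
  proof -
    obtain U y V where "unitary U" "unitary V" "Y = svd_matrix \<iota> U y V"
      by (rule svd_exists[OF inj_\<iota>])
    then show ?thesis using Y p(2)[of U V y] unfolding \<Omega>_def by auto
  qed
  have "semialgebraic \<Omega>"
  proof -
    have "real_polynomial_function (\<lambda>Z. p Z * p Z)" using p(1) p(1) by (rule real_polynomial_function.intros(4))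
    then have "semialgebraic {Z. 0 < p Z * p Z}" by (rule semialgebraic.pos)
    moreover have "{Z. 0 < p Z * p Z} = \<Omega>"
      unfolding \<Omega>_def by (auto simp: zero_less_mult_iff)
    ultimately show ?thesis by simp
  qed
  moreover have "open \<Omega>"
    unfolding \<Omega>_def using p(1) continuous_real_polymonial_function
    by (intro open_Collect_neq continuous_at_imp_continuous_on continuous_on_const) auto
  moreover have "closure \<Omega> = UNIV"
  proof -
    have "Z \<in> closure \<Omega>" for Z
      unfolding closure_iff_nhds_not_empty
      using dense by blast
    then show ?thesis by blast
  qed
  moreover have "\<exists>U y V. unitary U \<and> unitary V \<and> Y = svd_matrix \<iota> U y V \<and>
      HD_critical M Y = {svd_matrix \<iota> U x V | x. x \<in> ED_critical S y} \<and>
      HDdeg_at M Y = REDdeg_at S y" if Y: "Y \<in> \<Omega>" for Y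
  proof -
    obtain U y V where *: "unitary U" "unitary V" "Y = svd_matrix \<iota> U y V" "regular y"
      using svd[OF Y] by blast
    have "HD_critical M Y = {svd_matrix \<iota> U x V | x. x \<in> ED_critical S y}"
      unfolding *(3) crit(1)[OF *(1,2,4)] by blast
    moreover have "HDdeg_at M Y = REDdeg_at S y"
      unfolding HDdeg_at_def REDdeg_at_def *(3) by (rule crit(3)[OF *(1,2,4)])
    ultimately show ?thesis using * by blast
  qed
  moreover have "HDdeg M = REDdeg S"
  proof (intro subset_antisym subsetI)
    \<comment> \<open>\<open>Y\<close> itself need not have distinct nonzero singular values, but some nearby matrix does\<close>
    fix k assume "k \<in> HDdeg M"
    then obtain Y W where k: "k = card (HD_critical M Y)" and W: "open W" "Y \<in> W"
      "\<And>Z. Z \<in> W \<Longrightarrow> finite (HD_critical M Z) \<and> card (HD_critical M Z) = card (HD_critical M Y)"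
      unfolding HDdeg_def HDdeg_at_def discriminant_def by blast
    obtain Z where Z: "Z \<in> W" "Z \<in> \<Omega>" using dense[OF W(1,2)] by blast
    obtain U y V where y: "unitary U" "unitary V" "Z = svd_matrix \<iota> U y V" "regular y"
      using svd[OF Z(2)] by blast
    define W' where "W' = {z. svd_matrix \<iota> U z V \<in> W} \<inter> {z. disc z \<noteq> 0}"
    have "continuous_on UNIV (\<lambda>z. svd_matrix \<iota> U z V)"
      using linear_svd_matrix[of \<iota> U V] by (simp add: linear_continuous_on linear_linear)
    then have "open {z. svd_matrix \<iota> U z V \<in> W}"
      using W(1) by (simp add: continuous_on_open_vimage vimage_def)
    then have "open W'" unfolding W'_def using open_disc_nonzero by (rule open_Int)
    have "y \<in> W'" unfolding W'_def using y Z(1) by (simp add: disc_nonzero_iff)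
    have k': "finite (ED_critical S z) \<and> card (ED_critical S z) = k" if z: "z \<in> W'" for z
    proof -
      have "svd_matrix \<iota> U z V \<in> W" "regular z" using z by (simp_all add: W'_def disc_nonzero_iff)
      then show ?thesis
        using W(3)[of "svd_matrix \<iota> U z V"] crit(2,3)[OF y(1,2), of z] k by simp
    qed
    have "\<forall>z\<in>W'. finite (ED_critical S z) \<and> card (ED_critical S z) = card (ED_critical S y)"
      using k' k'[OF \<open>y \<in> W'\<close>] by simp
    then have "y \<notin> discriminant (ED_critical S)"
      unfolding discriminant_def using \<open>open W'\<close> \<open>y \<in> W'\<close> by blast
    moreover have "k = card (ED_critical S y)" using k'[OF \<open>y \<in> W'\<close>] by simp
    ultimately show "k \<in> REDdeg S" unfolding REDdeg_def REDdeg_at_def by blast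
  next
    fix k assume "k \<in> REDdeg S"
    then obtain y W where k: "k = card (ED_critical S y)" and W: "open W" "y \<in> W"
      "\<And>z. z \<in> W \<Longrightarrow> finite (ED_critical S z) \<and> card (ED_critical S z) = card (ED_critical S y)"
      unfolding REDdeg_def REDdeg_at_def discriminant_def by blast
    have "disc c \<noteq> 0" using c by (simp add: disc_nonzero_iff)
    then obtain y' where y': "y' \<in> W" "disc y' \<noteq> 0"
      using real_polynomial_nonzero_dense[OF real_polynomial_disc _ W(1,2)] by blast
    have "open (W \<inter> {z. disc z \<noteq> 0})" using W(1) open_disc_nonzero by (rule open_Int)
    then obtain \<epsilon> where \<epsilon>: "\<epsilon> > 0" "ball y' \<epsilon> \<subseteq> W \<inter> {z. disc z \<noteq> 0}"
      using y' by (auto elim!: openE)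
    obtain \<delta> where \<delta>: "\<delta> > 0" "\<And>Z. dist Z (real_diag \<iota> y') < \<delta> \<Longrightarrow>
        \<exists>U z V. unitary U \<and> unitary V \<and> Z = svd_matrix \<iota> U z V \<and> dist z y' < \<epsilon>"
      using svd_near_real_diag[OF inj_\<iota> \<epsilon>(1), of y'] by blast
    define Y where "Y = (real_diag \<iota> y' :: complex^'t^'n)"
    have k': "finite (HD_critical M Z) \<and> card (HD_critical M Z) = k" if Z: "Z \<in> ball Y \<delta>" for Z
    proof -
      obtain U z V where z: "unitary U" "unitary V" "Z = svd_matrix \<iota> U z V" "dist z y' < \<epsilon>"
        using \<delta>(2)[of Z] Z by (auto simp: Y_def dist_commute)
      then have "z \<in> ball y' \<epsilon>" by (simp add: dist_commute)
      then have zW: "z \<in> W" "regular z" using \<epsilon>(2) by (auto simp: disc_nonzero_iff)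
      show ?thesis
        unfolding z(3) using crit(2,3)[OF z(1,2) zW(2)] W(3)[OF zW(1)] k by simp
    qed
    have YB: "Y \<in> ball Y \<delta>" using \<delta>(1) by simp
    have "\<forall>Z\<in>ball Y \<delta>. finite (HD_critical M Z) \<and> card (HD_critical M Z) = card (HD_critical M Y)"
      using k' k'[OF YB] by simp
    then have "Y \<notin> discriminant (HD_critical M)"
      unfolding discriminant_def using open_ball YB by blast
    moreover have "k = card (HD_critical M Y)" using k'[OF YB] by simp
    ultimately show "k \<in> HDdeg M" unfolding HDdeg_def HDdeg_at_def by blast
  qed
  ultimately show ?thesis by blast
qed

end
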